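(* Let $1<p<\infty$. For any non-negative $f\in L^1(\mathbb{R}^n)\cap C(\mathbb{R}^n)$ that is not radially decreasing about any center, there are a constant $\tau_0=\tau_0(f)>0$ and a hyperplane $H\subset\mathbb{R}^n$ such that, with $f^\tau$ the continuous Steiner symmetrization of $f$ about $H$, $$[f^{\tau}]_{W^{1,p}(\mathbb{R}^n)}^p\le[f]_{W^{1,p}(\mathbb{R}^n)}^p\qquad\text{for all }0\le\tau\le\tau_0.$$ Consequently, $$[f^{\tau}]_{\mathrm{Lip}(\mathbb{R}^n)}\le[f]_{\mathrm{Lip}(\mathbb{R}^n)}\qquad\text{for all }0\le\tau\le\tau_0.$$
   Context: Seminorms: $[f]_{W^{1,p}(\mathbb{R}^n)}^p=\int_{\mathbb{R}^n}|\nabla f|^p\,dx$ (equal to $+\infty$ if $\nabla f\notin L^p$), and $[f]_{\mathrm{Lip}(\mathbb{R}^n)}=\sup_{x\ne y}\frac{|f(x)-f(y)|}{|x-y|}\in[0,\infty]$. A function $f$ is radially decreasing about a center $x_0$ if $f(x)=\Phi(|x-x_0|)$ with $\Phi$ non-increasing. Continuous Steiner symmetrization of open sets $U\subset\mathbb{R}$, denoted $M^\tau(U)$, $\tau\ge0$: (1) If $U=(y_-,y_+)$, then $M^\tau(U)=(y_-^\tau,y_+^\tau)$ with $y_\pm^\tau=y_\pm-\tau\,\mathrm{sgn}(y_++y_-)$ for $0<\tau\le|y_++y_-|/2$, and $y_\pm^\tau=\pm(y_+-y_-)/2$ for $\tau>|y_++y_-|/2$. (2) If $U=\bigcup_{i=1}^m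 I_i$ is a finite union of disjoint open intervals, then $M^\tau(U)=\bigcup_{i=1}^m M^\tau(I_i)$ for $0\le\tau<\tau_1$, where $\tau_1$ is the first time two of the intervals $M^\tau(I_i)$ touch; at $\tau_1$ the two intervals are merged into one and the process is restarted. (3) If $U=\bigcup_{i=1}^\infty I_i$ is a countable union of disjoint open intervals, then $M^\tau(U)=\bigcup_{m=1}^\infty M^\tau(U_m)$ with $U_m=\bigcup_{i=1}^m I_i$. Continuous Steiner symmetrization of a function: write $x=(x',x_n)\in\mathbb{R}^{n-1}\times\mathbb{R}$. For nonnegative $f\in L^1(\mathbb{R}^n)\cap C(\mathbb{R}^n)$ let $U_{x'}^h=\{x_n\in\mathbb{R}: f(x',x_n)>h\}$, and, for the hyperplane $\{x_n=0\}$ (direction $e_n$), $f^\tau(x)=\int_0^\infty\chi_{M^\tau(U_{x'}^h)}(x_n)\,dh$. For a general hyperplane $H$, $f^\tau$ is defined by the same procedure after a rigid motion of $\mathbb{R}^n$ taking $H$ to $\{x_n=0\}$. *)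

theory Defs
  imports "HOL-Analysis.Analysis"
begin

section \<open>Continuous Steiner symmetrization of open subsets of the line\<close>

text \<open>The pair \<open>(a, b)\<close> with \<open>a < b\<close> stands for the interval \<open>{a<..<b}\<close>.\<close>

fun interval_flow :: "real \<Rightarrow> real \<times> real \<Rightarrow> real \<times> real" where
  "interval_flow \<tau> (a, b) =
     (if \<tau> \<le> \<bar>b + a\<bar> / 2
      then (a - \<tau> * sgn (b + a), b - \<tau> * sgn (b + a))
      else (- ((b - a) / 2), (b - a) / 2))"

definition touching_at :: "real \<Rightarrow> (real \<times> real) set \<Rightarrow> bool" where
  "touching_at \<tau> S \<longleftrightarrow>
     (\<exists>I\<in>S. \<exists>J\<in>S. I \<noteq> J \<and> snd (interval_flow \<tau> I) = fst (interval_flow \<tau> J))"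

text \<open>\<open>evolves S \<tau> T\<close>: the finite system \<open>S\<close> of disjoint intervals has become \<open>T\<close> at time \<open>\<tau>\<close>.
  In rule \<open>merge\<close>, \<open>t\<close> is the first touching time. One touching pair is merged there, and the
  process restarts with the remaining time; simultaneous contacts are resolved by further merges
  at time \<open>0\<close>. Their order is irrelevant, so that \<open>T\<close> is determined by \<open>S\<close> and \<open>\<tau>\<close>.\<close>

inductive evolves :: "(real \<times> real) set \<Rightarrow> real \<Rightarrow> (real \<times> real) set \<Rightarrow> bool" where
  free: "0 \<le> \<tau> \<Longrightarrow> (\<And>t. 0 \<le> t \<Longrightarrow> t \<le> \<tau> \<Longrightarrow> \<not> touching_at t S)
    \<Longrightarrow> evolves S \<tau> (interval_flow \<tau> ` S)"
| merge: "0 \<le> t \<Longrightarrow> t \<le> \<tau> \<Longrightarrow> (\<And>r. 0 \<le> r \<Longrightarrow> r < t \<Longrightarrow> \<not> touching_at r S)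
    \<Longrightarrow> I \<in> S \<Longrightarrow> J \<in> S \<Longrightarrow> I \<noteq> J \<Longrightarrow> snd (interval_flow t I) = fst (interval_flow t J)
    \<Longrightarrow> evolves
          (insert (fst (interval_flow t I), snd (interval_flow t J)) (interval_flow t ` (S - {I, J})))
          (\<tau> - t) T
    \<Longrightarrow> evolves S \<tau> T"

definition M_finite :: "real \<Rightarrow> (real \<times> real) set \<Rightarrow> real set" where
  "M_finite \<tau> S = (\<Union>T\<in>{T. evolves S \<tau> T}. \<Union>(a, b)\<in>T. {a<..<b})"

definition component_intervals :: "real set \<Rightarrow> (real \<times> real) set" where
  "component_intervals U = {(a, b). a < b \<and> {a<..<b} \<in> components U}"

text \<open>If \<open>component_intervals U\<close> is infinite, \<open>from_nat_into\<close> enumerates it without repetition.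
  Open sets with an unbounded component are outside the scope of the construction; they are left
  unchanged. If \<open>f\<close> is integrable and continuous, this only concerns the slices at height \<open>0\<close> and
  the slices on a null set of lines.\<close>

definition M :: "real \<Rightarrow> real set \<Rightarrow> real set" where
  "M \<tau> U =
     (if \<forall>C\<in>components U. bounded C then
        (if finite (component_intervals U) then M_finite \<tau> (component_intervals U)
         else (\<Union>m. M_finite \<tau> (from_nat_into (component_intervals U) ` {..<m})))
      else U)"

section \<open>Continuous Steiner symmetrization of functions\<close>

text \<open>The index \<open>k\<close> designates the coordinate that plays the role of $x_n$.\<close>

definition slice :: "'n::finite \<Rightarrow> (real ^ 'n \<Rightarrow> real) \<Rightarrow> real ^ 'n \<Rightarrow> real \<Rightarrow> real set" where
  "slice k f x h = {s. f (\<chi> i. if i = k then s else x $ i) > h}"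

definition css_coord :: "'n::finite \<Rightarrow> real \<Rightarrow> (real ^ 'n \<Rightarrow> real) \<Rightarrow> real ^ 'n \<Rightarrow> real" where
  "css_coord k \<tau> f x = (LBINT h:{0..}. indicator (M \<tau> (slice k f x h)) (x $ k))"

definition hyperplane :: "(real ^ 'n::finite) set \<Rightarrow> bool" where
  "hyperplane H \<longleftrightarrow> (\<exists>a b. a \<noteq> 0 \<and> H = {x. a \<bullet> x = b})"

definition rigid_motion :: "(real ^ 'n::finite \<Rightarrow> real ^ 'n) \<Rightarrow> bool" where
  "rigid_motion T \<longleftrightarrow> bij T \<and> (\<forall>x y. dist (T x) (T y) = dist x y)"

lemma rigid_motion_to_coordinate_hyperplane:
  fixes H :: "(real ^ 'n::finite) set"
  assumes "hyperplane H"
  shows "\<exists>T. rigid_motion T \<and> T ` H = {x. x $ k = 0}"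
proof -
  obtain a b where a: "a \<noteq> 0" and H: "H = {x. a \<bullet> x = b}"
    using assms unfolding hyperplane_def by blast
  have "norm ((1 / norm a) *\<^sub>R a) = norm (axis k 1 :: real ^ 'n)"
    using a by (simp add: norm_axis_1)
  then obtain R :: "real ^ 'n \<Rightarrow> real ^ 'n"
    where R: "orthogonal_transformation R" "R ((1 / norm a) *\<^sub>R a) = axis k 1"
    by (rule orthogonal_transformation_exists)
  define T where "T = (\<lambda>x. R x - (b / norm a) *\<^sub>R axis k 1)"
  have bR: "bij R" using R(1) orthogonal_transformation_bij by blast
  have "bij (\<lambda>y. y - (b / norm a) *\<^sub>R (axis k 1 :: real ^ 'n))"
    by (rule o_bij[where g = "\<lambda>y. y + (b / norm a) *\<^sub>R axis k 1"]) auto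
  from bij_comp[OF bR this] have bT: "bij T"
    by (simp add: T_def comp_def)
  have dT: "dist (T x) (T y) = dist x y" for x y
  proof -
    have "T x - T y = R (x - y)"
      using linear_diff[OF orthogonal_transformation_linear[OF R(1)]] by (simp add: T_def)
    then show ?thesis by (simp only: dist_norm orthogonal_transformation_norm[OF R(1)])
  qed
  have "R x $ k = (a \<bullet> x) / norm a" for x
  proof -
    have "R x $ k = R x \<bullet> R ((1 / norm a) *\<^sub>R a)" by (simp add: R(2) inner_axis)
    also have "\<dots> = x \<bullet> ((1 / norm a) *\<^sub>R a)" using R(1) by (simp only: orthogonal_transformation_def)
    finally show ?thesis by (simp add: inner_commute)
  qed
  then have "T x $ k = 0 \<longleftrightarrow> x \<in> H" for x
    using a by (simp add: T_def H axis_def)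
  then have "T ` H = {x. x $ k = 0}"
    using surjD[OF bij_is_surj[OF bT]] by fastforce
  with bT dT show ?thesis unfolding rigid_motion_def by blast
qed

text \<open>The choice of the rigid motion is immaterial: two of them differ by a motion preserving
  the hyperplane $\{x_k = 0\}$, and \<open>M \<tau>\<close> commutes with the reflection of the line at \<open>0\<close>.\<close>

definition css ::
    "'n::finite \<Rightarrow> (real ^ 'n) set \<Rightarrow> real \<Rightarrow> (real ^ 'n \<Rightarrow> real) \<Rightarrow> real ^ 'n \<Rightarrow> real" where
  "css k H \<tau> f =
     (let T = (SOME T. rigid_motion T \<and> T ` H = {x. x $ k = 0})
      in css_coord k \<tau> (f \<circ> inv T) \<circ> T)"

definition radially_decreasing_about ::
    "real ^ 'n::finite \<Rightarrow> (real ^ 'n \<Rightarrow> real) \<Rightarrow> bool" where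
  "radially_decreasing_about x0 f \<longleftrightarrow>
     (\<exists>\<Phi>::real \<Rightarrow> real. antimono_on {0..} \<Phi> \<and> (\<forall>x. f x = \<Phi> (norm (x - x0))))"

section \<open>Seminorms\<close>

definition partial_deriv :: "'n::finite \<Rightarrow> (real ^ 'n \<Rightarrow> real) \<Rightarrow> real ^ 'n \<Rightarrow> real" where
  "partial_deriv i \<phi> x = frechet_derivative \<phi> (at x) (axis i 1)"

primrec C_k :: "nat \<Rightarrow> (real ^ 'n::finite \<Rightarrow> real) \<Rightarrow> bool" where
  "C_k 0 \<phi> \<longleftrightarrow> continuous_on UNIV \<phi>"
| "C_k (Suc m) \<phi> \<longleftrightarrow> (\<forall>x. \<phi> differentiable at x) \<and> (\<forall>i. C_k m (partial_deriv i \<phi>))"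

definition test_function :: "(real ^ 'n::finite \<Rightarrow> real) \<Rightarrow> bool" where
  "test_function \<phi> \<longleftrightarrow> (\<forall>m. C_k m \<phi>) \<and> compact (closure {x. \<phi> x \<noteq> 0})"

definition locally_integrable ::
    "(real ^ 'n::finite \<Rightarrow> 'b::{banach, second_countable_topology}) \<Rightarrow> bool" where
  "locally_integrable g \<longleftrightarrow> (\<forall>K. compact K \<longrightarrow> set_integrable lebesgue K g)"

definition weak_gradient ::
    "(real ^ 'n::finite \<Rightarrow> real) \<Rightarrow> (real ^ 'n \<Rightarrow> real ^ 'n) \<Rightarrow> bool" where
  "weak_gradient f g \<longleftrightarrow> locally_integrable f \<and> locally_integrable g \<and>
     (\<forall>\<phi> i. test_function \<phi> \<longrightarrow>
        (LINT x|lebesgue. f x * partial_deriv i \<phi> x) = - (LINT x|lebesgue. g x $ i * \<phi> x))"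

text \<open>The \<open>p\<close>-th power of the seminorm. Weak gradients agree almost everywhere, so the infimum is
  the common value of the integral; it is \<open>\<infinity>\<close> if there is no weak gradient at all.\<close>

definition W1p_seminorm_power :: "real \<Rightarrow> (real ^ 'n::finite \<Rightarrow> real) \<Rightarrow> ennreal" where
  "W1p_seminorm_power p f =
     (INF g\<in>{g. weak_gradient f g}. \<integral>\<^sup>+ x. ennreal (norm (g x) powr p) \<partial>lebesgue)"

definition Lip_seminorm :: "(real ^ 'n::finite \<Rightarrow> real) \<Rightarrow> ennreal" where
  "Lip_seminorm f = (SUP (x, y)\<in>{(x, y). x \<noteq> y}. ennreal (\<bar>f x - f y\<bar> / norm (x - y)))"

end

theory Submission
  imports Defs "HOL-Computational_Algebra.Polynomial"
begin

text \<open>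
  Continuous Steiner symmetrization does not increase the energy with respect to any hyperplane, for
  all times. On the line, an open set and its image have the same measure, inclusions are preserved,
  and \<open>M\<^sup>\<tau>(U) + (-r, r) \<subseteq> M\<^sup>\<tau>(U + (-r, r))\<close>. Hence, if \<open>v\<close> dominates the supremum of \<open>u\<close> over
  balls of radius \<open>r\<close>, then \<open>v\<^sup>\<tau>\<close> dominates the supremum of \<open>u\<^sup>\<tau>\<close> over these balls, which gives the
  Lipschitz bound, and the layer cake formula gives
  \<open>\<integral> (v\<^sup>\<tau> - u\<^sup>\<tau>)\<^sup>p \<le> \<integral> (v - u)\<^sup>p\<close>.
  For the energy, let \<open>u\<close> be a truncated mollification of \<open>f\<close> and \<open>v = u + r \<bar>\<nabla>u\<bar> + o(r)\<close> on a
  compact set. Dividing by \<open>r\<^sup>p\<close> and letting \<open>r \<rightarrow> 0\<close> bounds the \<open>L\<^sup>p\<close> norm of the gradient of every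
  mollification of \<open>u\<^sup>\<tau>\<close> by that of \<open>\<nabla>f\<close>, and by the \<open>L\<^sup>1\<close> contraction property the same
  holds for \<open>f\<^sup>\<tau>\<close>. Uniform convexity then makes the mollified gradients converge strongly,
  and their limit is the weak gradient of \<open>f\<^sup>\<tau>\<close>.
\<close>


section \<open>Evolution of finite systems of intervals\<close>

text \<open>The process is given as a relation with merging, so neither uniqueness of its outcome
  nor monotonicity is visible; both come from a single comparison with families that never have
  touching intervals. No regularity of \<open>f^\<tau>\<close> is known beforehand, hence there is
  no gradient of it to compute with. Suprema over balls replace it: domination over balls is a
  statement about inclusions of level sets, and \<open>(v - u) / r\<close> recovers the length of
  the gradient. Truncation confines \<open>v - u\<close> to a fixed compact set, on which the error
  terms disappear as \<open>r\<close> tends to 0. For \<open>p = 1\<close> bounded mollified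
  gradients would only yield a measure in the limit; \<open>1 < p\<close> brings strict convexity,
  which turns bounds into strong convergence. A second obstacle is the null set of lines on which a
  slice at positive height has infinite measure: there the symmetrization as defined and its
  monotone variant may differ. The energy does not see this set. The Lipschitz bound is pointwise,
  and rests on the fact that Lipschitz functions have no such lines.\<close>

text \<open>Soft thresholding, applied to the midpoint: it moves towards 0 with unit speed and rests
  there, while the length is kept. In this form the semigroup law and the nonexpansive dependence on
  the midpoint are elementary.\<close>

definition soft :: "real \<Rightarrow> real \<Rightarrow> real" where
  "soft \<tau> m = (if 0 \<le> m then max (m - \<tau>) 0 else min (m + \<tau>) 0)"

lemma interval_flow_eq:
  assumes "0 \<le> \<tau>"
  shows "interval_flow \<tau> (a, b) =
    (soft \<tau> ((a + b) / 2) - (b - a) / 2, soft \<tau> ((a + b) / 2) + (b - a) / 2)"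
  using assms by (auto simp: soft_def sgn_if field_simps max_def min_def abs_if)

lemma soft_lipschitz: "0 \<le> \<tau> \<Longrightarrow> \<bar>soft \<tau> m - soft \<tau> m'\<bar> \<le> \<bar>m - m'\<bar>"
  by (auto simp: soft_def)

lemma soft_soft: "0 \<le> s \<Longrightarrow> 0 \<le> t \<Longrightarrow> soft s (soft t m) = soft (t + s) m"
  by (auto simp: soft_def)

lemma fst_interval_flow:
  "0 \<le> \<tau> \<Longrightarrow> fst (interval_flow \<tau> I) = soft \<tau> ((fst I + snd I) / 2) - (snd I - fst I) / 2"
  and snd_interval_flow:
  "0 \<le> \<tau> \<Longrightarrow> snd (interval_flow \<tau> I) = soft \<tau> ((fst I + snd I) / 2) + (snd I - fst I) / 2"
  using interval_flow_eq[of \<tau> "fst I" "snd I"] by auto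

lemma interval_flow_length:
  "0 \<le> \<tau> \<Longrightarrow> snd (interval_flow \<tau> I) - fst (interval_flow \<tau> I) = snd I - fst I"
  by (simp add: fst_interval_flow snd_interval_flow)

lemma interval_flow_flow:
  "0 \<le> s \<Longrightarrow> 0 \<le> t \<Longrightarrow> interval_flow s (interval_flow t I) = interval_flow (t + s) I"
  by (rule prod_eqI) (simp_all add: fst_interval_flow snd_interval_flow soft_soft)

lemma interval_flow_0 [simp]: "interval_flow 0 I = I"
  by (cases I) (auto simp: interval_flow_eq soft_def field_simps)

text \<open>The \<open>r\<close>-neighbourhood of \<open>I\<close> lies in \<open>J\<close>,
  expressed by end points. The parameter treats monotonicity (\<open>r = 0\<close>) and the
  neighbourhood property at once.\<close>

definition near :: "real \<Rightarrow> real \<times> real \<Rightarrow> real \<times> real \<Rightarrow> bool" where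
  "near r I J \<longleftrightarrow> fst J \<le> fst I - r \<and> snd I + r \<le> snd J"

declare interval_flow.simps [simp del]

lemma near_trans: "near r I J \<Longrightarrow> near s J K \<Longrightarrow> near (r + s) I K"
  by (auto simp: near_def)

text \<open>For intervals with midpoints \<open>m\<close>, \<open>m'\<close> and half lengths \<open>l\<close>, \<open>l'\<close>, \<open>near r\<close> says
  \<open>\<bar>m - m'\<bar> \<le> l' - l - r\<close>, and the flow acts on midpoints by a nonexpansive map.\<close>

lemma near_interval_flow:
  assumes "0 \<le> t" "near r I J"
  shows "near r (interval_flow t I) (interval_flow t J)"
  using soft_lipschitz[OF assms(1), of "(fst I + snd I) / 2" "(fst J + snd J) / 2"] assms(2)
  unfolding near_def fst_interval_flow[OF assms(1)] snd_interval_flow[OF assms(1)]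
  by (elim conjE, intro conjI) argo+

definition dominates :: "real \<Rightarrow> (real \<times> real) set \<Rightarrow> (real \<times> real) set \<Rightarrow> bool" where
  "dominates r S V \<longleftrightarrow> (\<forall>I\<in>S. \<exists>J\<in>V. near r I J)"

lemma dominates_trans: "dominates r S V \<Longrightarrow> dominates s V W \<Longrightarrow> dominates (r + s) S W"
  unfolding dominates_def by (meson near_trans)

lemma dominates_refl: "S \<subseteq> V \<Longrightarrow> dominates 0 S V"
  by (force simp: dominates_def near_def)

definition disj_system :: "(real \<times> real) set \<Rightarrow> bool" where
  "disj_system S \<longleftrightarrow> finite S \<and> (\<forall>I\<in>S. fst I < snd I) \<and>
     (\<forall>I\<in>S. \<forall>J\<in>S. I \<noteq> J \<longrightarrow> snd I \<le> fst J \<or> snd J \<le> fst I)"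

lemma disj_systemD:
  assumes "disj_system S"
  shows "finite S" "I \<in> S \<Longrightarrow> fst I < snd I"
    "I \<in> S \<Longrightarrow> J \<in> S \<Longrightarrow> I \<noteq> J \<Longrightarrow> snd I \<le> fst J \<or> snd J \<le> fst I"
  using assms unfolding disj_system_def by blast+

text \<open>Excluding common end points is what forces two touching intervals that lie below such a
  system into one and the same member.\<close>

definition sep_system :: "(real \<times> real) set \<Rightarrow> bool" where
  "sep_system S \<longleftrightarrow> disj_system S \<and> (\<forall>I\<in>S. \<forall>J\<in>S. snd I \<noteq> fst J)"

text \<open>A supersolution of the free motion: asking only for an inclusion leaves room for merging
  at any time.\<close>

definition flow_family :: "(real \<Rightarrow> (real \<times> real) set) \<Rightarrow> bool" where
  "flow_family V \<longleftrightarrow> (\<forall>t\<ge>0. sep_system (V t)) \<and>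
     (\<forall>s\<ge>0. \<forall>t\<ge>0. dominates 0 (interval_flow t ` V s) (V (s + t)))"

lemma flow_family_shift: "flow_family V \<Longrightarrow> 0 \<le> a \<Longrightarrow> flow_family (\<lambda>t. V (a + t))"
  unfolding flow_family_def by (auto simp: add.assoc[symmetric])

lemma dominates_flow:
  assumes "flow_family V" "dominates r S (V s)" "0 \<le> s" "0 \<le> t"
  shows "dominates r (interval_flow t ` S) (V (s + t))"
proof -
  have "dominates r (interval_flow t ` S) (interval_flow t ` V s)"
    unfolding dominates_def
  proof (intro ballI)
    fix I assume "I \<in> interval_flow t ` S"
    then obtain I' where I': "I' \<in> S" "I = interval_flow t I'" by blast
    with assms(2) obtain J where "J \<in> V s" "near r I' J" unfolding dominates_def by blast
    then show "\<exists>J\<in>interval_flow t ` V s. near r I J"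
      using near_interval_flow[OF assms(4), of r I' J] I' by blast
  qed
  moreover have "dominates 0 (interval_flow t ` V s) (V (s + t))"
    using assms unfolding flow_family_def by blast
  ultimately show ?thesis using dominates_trans by fastforce
qed

text \<open>Two intervals that touch lie in the same interval of a separated system.\<close>

lemma evolves_dominates:
  assumes "evolves S \<tau> T" "flow_family V" "0 \<le> r" "\<forall>I\<in>S. fst I < snd I" "dominates r S (V 0)"
  shows "dominates r T (V \<tau>)"
  using assms
proof (induction arbitrary: V rule: evolves.induct)
  case (free \<tau> S)
  then show ?case using dominates_flow[of V r S 0 \<tau>] by simp
next
  case (merge t \<tau> S I J T)
  let ?F = "interval_flow t"
  let ?K = "(fst (?F I), snd (?F J))"
  have d: "dominates r (?F ` S) (V t)"
    using dominates_flow[of V r S 0 t] merge.prems merge.hyps by simp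
  have sep: "sep_system (V t)" using merge.prems(1) merge.hyps(1) by (auto simp: flow_family_def)
  obtain I' J' where I': "I' \<in> V t" "near r (?F I) I'" and J': "J' \<in> V t" "near r (?F J) J'"
    using d merge.hyps unfolding dominates_def by blast
  have lt: "fst (?F K) < snd (?F K)" if "K \<in> S" for K
    using interval_flow_length[of t K] merge.hyps(1) merge.prems(3) that by force
  have "I' = J'"
  proof (rule ccontr)
    assume "I' \<noteq> J'"
    then have "snd I' \<le> fst J' \<or> snd J' \<le> fst I'" "snd I' \<noteq> fst J'"
      using sep I'(1) J'(1) unfolding sep_system_def disj_system_def by blast+
    then show False using I' J' lt[of I] lt[of J] merge.hyps merge.prems(2)
      by (auto simp: near_def)
  qed
  then have "near r ?K I'" using I' J' by (auto simp: near_def)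
  then have 1: "dominates r (insert ?K (?F ` (S - {I, J}))) (V (t + 0))"
    using d I'(1) by (auto simp: dominates_def)
  have 2: "\<forall>K\<in>insert ?K (?F ` (S - {I, J})). fst K < snd K"
    using lt lt[OF merge.hyps(4)] lt[OF merge.hyps(5)] merge.hyps(7) by fastforce
  have "dominates r T (V (t + (\<tau> - t)))"
    using merge.IH[OF flow_family_shift[OF merge.prems(1) merge.hyps(1)] merge.prems(2) 2 1] .
  then show ?case by simp
qed

definition total_length :: "(real \<times> real) set \<Rightarrow> real" where
  "total_length S = (\<Sum>I\<in>S. snd I - fst I)"

lemma continuous_on_soft: "continuous_on A (\<lambda>t. soft t m)"
  unfolding soft_def by (cases "0 \<le> m") (auto intro!: continuous_intros)

text \<open>The signed gap between two moving intervals is continuous in time, so it cannot become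
  negative without vanishing first, and a zero of the gap is a contact.\<close>

lemma gap_persists:
  assumes S: "\<And>r. 0 \<le> r \<Longrightarrow> r < t \<Longrightarrow> \<not> touching_at r S"
    and "I \<in> S" "J \<in> S" "I \<noteq> J" "snd I \<le> fst J" "0 \<le> t"
  shows "snd (interval_flow t I) \<le> fst (interval_flow t J)"
proof (rule ccontr)
  assume neg: "\<not> ?thesis"
  define g where "g = (\<lambda>t. (soft t ((fst J + snd J) / 2) - (snd J - fst J) / 2)
     - (soft t ((fst I + snd I) / 2) + (snd I - fst I) / 2))"
  have g: "g r = fst (interval_flow r J) - snd (interval_flow r I)" if "0 \<le> r" for r
    using that by (simp add: g_def fst_interval_flow snd_interval_flow)
  have c: "continuous_on {0..t} g"
    unfolding g_def by (intro continuous_intros continuous_on_soft)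
  have "g t \<le> 0" "0 \<le> g 0" using neg assms g[of t] g[of 0] by auto
  then obtain r where r: "0 \<le> r" "r \<le> t" "g r = 0"
    using IVT2'[of g t 0 0] c \<open>0 \<le> t\<close> by auto
  \<comment> \<open>The gap is strictly negative at \<open>t\<close>, so the contact happens
    strictly earlier, where contacts are excluded.\<close>
  then have "r \<noteq> t" using neg g[of t] \<open>0 \<le> t\<close> by auto
  then have "\<not> touching_at r S" using S r by auto
  then show False using r g[of r] assms unfolding touching_at_def by fastforce
qed

text \<open>Up to and including the first contact the images of distinct intervals are disjoint and
  nondegenerate. Hence the motion is injective on the system, and lengths may be summed over the
  image.\<close>

lemma disj_system_flow:
  assumes S: "\<And>r. 0 \<le> r \<Longrightarrow> r < t \<Longrightarrow> \<not> touching_at r S"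
    and D: "disj_system S" and "0 \<le> t"
  shows "disj_system (interval_flow t ` S)" "inj_on (interval_flow t) S"
    "total_length (interval_flow t ` S) = total_length S"
proof -
  have *: "snd (interval_flow t I) \<le> fst (interval_flow t J) \<or>
      snd (interval_flow t J) \<le> fst (interval_flow t I)" if "I \<in> S" "J \<in> S" "I \<noteq> J" for I J
    using gap_persists[OF S _ _ _ _ \<open>0 \<le> t\<close>] that D unfolding disj_system_def by metis
  have lt: "fst (interval_flow t K) < snd (interval_flow t K)" if "K \<in> S" for K
    using interval_flow_length[of t K] \<open>0 \<le> t\<close> D that unfolding disj_system_def by force
  show "disj_system (interval_flow t ` S)"
    unfolding disj_system_def
  proof (intro conjI ballI impI)
    show "finite (interval_flow t ` S)" using D by (simp add: disj_system_def)
  qed (use lt * in blast)+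
  show inj: "inj_on (interval_flow t) S"
    using * lt by (intro inj_onI) (metis leD)
  show "total_length (interval_flow t ` S) = total_length S"
    unfolding total_length_def sum.reindex[OF inj] using \<open>0 \<le> t\<close> by (simp add: interval_flow_length)
qed

text \<open>The set of touching times is a finite union, over pairs of intervals, of zero sets of
  continuous functions; being closed and bounded below it has a least element.\<close>

lemma first_touching_time:
  assumes "finite S" "0 \<le> t" "touching_at t S"
  obtains t1 where "0 \<le> t1" "touching_at t1 S" "\<And>r. 0 \<le> r \<Longrightarrow> r < t1 \<Longrightarrow> \<not> touching_at r S"
proof -
  define X where "X = {t. 0 \<le> t \<and> touching_at t S}"
  define P where "P I J = {t. 0 \<le> t} \<inter> {t.
     soft t ((fst I + snd I) / 2) + (snd I - fst I) / 2 =
     soft t ((fst J + snd J) / 2) - (snd J - fst J) / 2}" for I J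
  have P: "t \<in> P I J \<longleftrightarrow> 0 \<le> t \<and> snd (interval_flow t I) = fst (interval_flow t J)" for t I J
    by (auto simp: P_def fst_interval_flow snd_interval_flow)
  have "X = (\<Union>I\<in>S. \<Union>J\<in>S - {I}. P I J)"
  proof (rule set_eqI, rule iffI)
    fix t assume "t \<in> X"
    then obtain I J where "0 \<le> t" "I \<in> S" "J \<in> S" "J \<noteq> I"
        "snd (interval_flow t I) = fst (interval_flow t J)"
      unfolding X_def touching_at_def by fast
    then have "I \<in> S" "J \<in> S - {I}" "t \<in> P I J" by (simp_all add: P)
    then show "t \<in> (\<Union>I\<in>S. \<Union>J\<in>S - {I}. P I J)" by (intro UN_I)
  next
    fix t assume "t \<in> (\<Union>I\<in>S. \<Union>J\<in>S - {I}. P I J)"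
    then obtain I J where "I \<in> S" "J \<in> S - {I}" "t \<in> P I J" by (elim UN_E)
    then show "t \<in> X" unfolding X_def touching_at_def P mem_Collect_eq by (metis DiffE singletonI)
  qed
  moreover have "closed \<dots>"
    unfolding P_def using assms(1)
    by (intro closed_UN ballI closed_Int closed_Collect_eq closed_Collect_le
        continuous_intros continuous_on_soft) auto
  ultimately have "closed X" by simp
  moreover have "X \<noteq> {}" "bdd_below X" using assms by (auto simp: X_def)
  ultimately have "Inf X \<in> X" by (rule closed_contains_Inf[rotated 2])
  moreover have "r \<notin> X" if "r < Inf X" for r
    using that \<open>bdd_below X\<close> cInf_lower by force
  ultimately show ?thesis using that[of "Inf X"] by (auto simp: X_def)
qed

lemma sep_system_no_touch: "disj_system S \<Longrightarrow> \<not> touching_at 0 S \<Longrightarrow> sep_system S"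
  by (force simp: sep_system_def touching_at_def disj_system_def)

lemma touching_at_flow:
  assumes "0 \<le> t" "\<not> touching_at t S" shows "\<not> touching_at 0 (interval_flow t ` S)"
  using assms unfolding touching_at_def by auto

lemma sep_system_flow:
  assumes "\<And>r. 0 \<le> r \<Longrightarrow> r \<le> t \<Longrightarrow> \<not> touching_at r S" "disj_system S" "0 \<le> t"
  shows "sep_system (interval_flow t ` S)"
  using assms disj_system_flow(1)[of t S] touching_at_flow[of t S] sep_system_no_touch by force

text \<open>Each merge lowers the number of intervals, so induction on the cardinality applies to
  the system after the first contact. \<open>V 0\<close> may differ from \<open>S\<close>: contacts
  of \<open>S\<close> at time 0 are already resolved in it.\<close>

lemma evolution_exists:
  assumes "disj_system S"
  shows "\<exists>V. flow_family V \<and> dominates 0 S (V 0) \<and>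
     (\<forall>t\<ge>0. evolves S t (V t) \<and> total_length (V t) = total_length S)"
  using assms
proof (induction "card S" arbitrary: S rule: less_induct)
  case less
  note D = less.prems
  have fin: "finite S" using D by (simp add: disj_system_def)
  show ?case
  proof (cases "\<exists>t\<ge>0. touching_at t S")
    case False
    have "flow_family (\<lambda>t. interval_flow t ` S)"
      unfolding flow_family_def
      using False D by (auto intro!: sep_system_flow dominates_refl simp: image_image interval_flow_flow
         )
    then show ?thesis
      using False D disj_system_flow(3)[of _ S]
      by (intro exI[of _ "\<lambda>t. interval_flow t ` S"]) (auto intro!: evolves.free dominates_refl)
  next
    case True
    then obtain t1 where t1: "0 \<le> t1" "touching_at t1 S"
        "\<And>r. 0 \<le> r \<Longrightarrow> r < t1 \<Longrightarrow> \<not> touching_at r S"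
      using first_touching_time[OF fin] by metis
    let ?F = "interval_flow t1"
    obtain I J where IJ: "I \<in> S" "J \<in> S" "I \<noteq> J" "snd (?F I) = fst (?F J)"
      using t1(2) unfolding touching_at_def by blast
    define K where "K = (fst (?F I), snd (?F J))"
    define R where "R = ?F ` (S - {I, J})"
    define S1 where "S1 = insert K R"
    have DF: "disj_system (?F ` S)" and inj: "inj_on ?F S" and tot: "total_length (?F ` S) = total_length S"
      using disj_system_flow[OF t1(3) D t1(1)] by auto
    have FS: "?F ` S = insert (?F I) (insert (?F J) R)" using IJ by (auto simp: R_def)
    have notin: "?F I \<notin> insert (?F J) R" "?F J \<notin> R"
      using inj IJ by (auto simp: R_def inj_on_def)
    have lt: "fst (?F I) < snd (?F I)" "fst (?F J) < snd (?F J)"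
      using DF IJ by (auto simp: disj_system_def)
    have Kdisj: "snd L \<le> fst K \<or> snd K \<le> fst L" if "L \<in> R" for L
    proof -
      have "snd L \<le> fst (?F I) \<or> snd (?F I) \<le> fst L" "snd L \<le> fst (?F J) \<or> snd (?F J) \<le> fst L"
        "fst L < snd L"
        using disj_systemD(2,3)[OF DF] that notin unfolding FS by (metis insertCI)+
      then show ?thesis using IJ(4) lt by (auto simp: K_def)
    qed
    have D1: "disj_system S1"
      using DF Kdisj lt IJ(4) unfolding S1_def FS disj_system_def by (auto simp: K_def)
    have finR: "finite R" using fin by (simp add: R_def)
    have "K \<notin> R" using Kdisj lt IJ(4) by (force simp: K_def)
    then have tot1: "total_length S1 = total_length S"
      unfolding tot[symmetric] FS using finR notin IJ(4) by (simp add: S1_def total_length_def K_def)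
    have "card S1 \<le> Suc (card R)" by (simp add: S1_def card_insert_if finR)
    moreover have "card R \<le> card (S - {I, J})" unfolding R_def using fin by (intro card_image_le) simp
    moreover have "card (S - {I, J}) = card S - 2" "card S \<ge> 2"
      using IJ fin card_mono[of S "{I, J}"] by (auto simp: card_Diff_subset)
    ultimately have "card S1 < card S" by linarith
    from less.hyps[OF this D1] obtain V where V: "flow_family V" "dominates 0 S1 (V 0)"
      "\<And>t. 0 \<le> t \<Longrightarrow> evolves S1 t (V t) \<and> total_length (V t) = total_length S1" by blast
    define V' where "V' t = (if t < t1 then interval_flow t ` S else V (t - t1))" for t
    have ev: "evolves S t (V' t)" if "0 \<le> t" for t
    proof (cases "t < t1")
      case True
      then show ?thesis using that t1(3) by (auto simp: V'_def intro!: evolves.free)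
    next
      case False
      then show ?thesis
        using evolves.merge[OF t1(1) _ t1(3) IJ] V(3)[of "t - t1"]
        by (auto simp: V'_def S1_def R_def K_def)
    qed
    have tl: "total_length (V' t) = total_length S" if "0 \<le> t" for t
      using that disj_system_flow(3)[of t S] D t1(3) V(3)[of "t - t1"] tot1 by (auto simp: V'_def)
    have FS_S1: "dominates 0 (?F ` S) S1"
      using lt IJ(4) unfolding FS S1_def by (auto simp: dominates_def near_def K_def)
    have dom: "dominates 0 (interval_flow t ` V' s) (V' (s + t))" if "0 \<le> s" "0 \<le> t" for s t
    proof -
      \<comment> \<open>Only the middle case crosses the merge: move freely up to \<open>t1\<close>,
        pass to the larger merged system, then follow \<open>V\<close>.\<close>
      consider "s + t < t1" | "s < t1" "t1 \<le> s + t" | "t1 \<le> s" by linarith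
      then show ?thesis
      proof cases
        case 1
        then show ?thesis using that
          by (auto simp: V'_def image_image interval_flow_flow intro!: dominates_refl)
      next
        case 2
        have "dominates (0 + 0) (?F ` S) (V 0)" using dominates_trans[OF FS_S1 V(2)] .
        then have "dominates 0 (interval_flow (s + t - t1) ` ?F ` S) (V (0 + (s + t - t1)))"
          using 2 that dominates_flow[OF V(1), of 0 "?F ` S" 0 "s + t - t1"] by simp
        then show ?thesis using 2 that t1(1) by (simp add: V'_def image_image interval_flow_flow)
      next
        case 3
        have "dominates 0 (interval_flow t ` V (s - t1)) (V ((s - t1) + t))"
          using 3 that V(1) unfolding flow_family_def by (meson diff_ge_0_iff_ge)
        moreover have "(s - t1) + t = s + t - t1" by simp
        ultimately show ?thesis using 3 that unfolding V'_def by simp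
      qed
    qed
    have sep: "sep_system (V' t)" if "0 \<le> t" for t
      using that V(1) sep_system_flow[of t S] t1(3) D by (auto simp: V'_def flow_family_def)
    have d0: "dominates 0 S (V' 0)"
    proof (cases "t1 = 0")
      case True
      then have "dominates (0 + 0) S (V 0)" using dominates_trans[OF FS_S1 V(2)] by simp
      then show ?thesis using True by (simp add: V'_def)
    next
      case False
      then show ?thesis using t1(1) by (auto simp: V'_def intro!: dominates_refl)
    qed
    show ?thesis using ev tl dom sep d0 by (intro exI[of _ V']) (auto simp: flow_family_def)
  qed
qed

section \<open>From finite systems of intervals to open subsets of the line\<close>

definition sys_union :: "(real \<times> real) set \<Rightarrow> real set" where
  "sys_union S = (\<Union>(a, b)\<in>S. {a<..<b})"

lemma sys_union_iff: "x \<in> sys_union S \<longleftrightarrow> (\<exists>I\<in>S. fst I < x \<and> x < snd I)"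
  unfolding sys_union_def by force

lemma open_sys_union: "open (sys_union S)"
  unfolding sys_union_def by auto

lemma sys_union_mono: "S \<subseteq> T \<Longrightarrow> sys_union S \<subseteq> sys_union T"
  by (auto simp: sys_union_def)

lemma dominates_sys_union:
  assumes "dominates r S V" "x \<in> sys_union S" "\<bar>y - x\<bar> \<le> r"
  shows "y \<in> sys_union V"
proof -
  obtain I where I: "I \<in> S" "fst I < x" "x < snd I" using assms(2) by (auto simp: sys_union_iff)
  then obtain J where "J \<in> V" "near r I J" using assms(1) by (auto simp: dominates_def)
  then show ?thesis using I assms(3) unfolding sys_union_iff near_def
    by (intro bexI[of _ J]) (auto simp: abs_le_iff)
qed

text \<open>\<open>M_finite\<close> is a union over all possible outcomes. The separated family is
  one of them and, by the comparison, contains every other one; so the order of simultaneous merges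
  does not matter.\<close>

lemma M_finite_evolution:
  assumes "disj_system S"
  obtains V where "flow_family V" "dominates 0 S (V 0)"
    "\<And>t. 0 \<le> t \<Longrightarrow> evolves S t (V t)" "\<And>t. 0 \<le> t \<Longrightarrow> total_length (V t) = total_length S"
    "\<And>t. 0 \<le> t \<Longrightarrow> M_finite t S = sys_union (V t)"
proof -
  obtain V where V: "flow_family V" "dominates 0 S (V 0)"
    "\<And>t. 0 \<le> t \<Longrightarrow> evolves S t (V t)" "\<And>t. 0 \<le> t \<Longrightarrow> total_length (V t) = total_length S"
    using evolution_exists[OF assms] by metis
  have "M_finite t S = sys_union (V t)" if t: "0 \<le> t" for t
  proof
    show "sys_union (V t) \<subseteq> M_finite t S"
      using V(3)[OF t] unfolding M_finite_def sys_union_def by blast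
    have "dominates 0 T (V t)" if "evolves S t T" for T
      using evolves_dominates[OF that V(1)] V(2) assms disj_systemD(2) by blast
    then have "sys_union T \<subseteq> sys_union (V t)" if "evolves S t T" for T
      using that dominates_sys_union by fastforce
    then show "M_finite t S \<subseteq> sys_union (V t)"
      unfolding M_finite_def sys_union_def[symmetric] by blast
  qed
  with V that show ?thesis by blast
qed

text \<open>The comparison is made between an outcome for \<open>S\<close> and the separated family
  of \<open>S'\<close>; domination of the initial systems with margin \<open>r\<close> is inherited
  for all times.\<close>

lemma M_finite_near:
  assumes "disj_system S" "disj_system S'" "dominates r S S'" "0 \<le> \<tau>"
    "x \<in> M_finite \<tau> S" "\<bar>y - x\<bar> \<le> r"
  shows "y \<in> M_finite \<tau> S'"
proof -
  obtain V where V: "evolves S \<tau> (V \<tau>)" "M_finite \<tau> S = sys_union (V \<tau>)"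
    using M_finite_evolution[OF assms(1)] assms(4) by metis
  obtain W where W: "flow_family W" "dominates 0 S' (W 0)" "M_finite \<tau> S' = sys_union (W \<tau>)"
    using M_finite_evolution[OF assms(2)] assms(4) by metis
  have "dominates r S (W 0)" using dominates_trans[OF assms(3) W(2)] by simp
  then have "dominates r (V \<tau>) (W \<tau>)"
    using evolves_dominates[OF V(1) W(1)] assms(6) disj_systemD(2)[OF assms(1)] by force
  then show ?thesis using dominates_sys_union assms(5,6) V(2) W(3) by blast
qed

lemma emeasure_sys_union:
  assumes "disj_system S"
  shows "emeasure lborel (sys_union S) = ennreal (total_length S)"
proof -
  have "disjoint_family_on (\<lambda>I. {fst I<..<snd I}) S"
    unfolding disjoint_family_on_def using disj_systemD(3)[OF assms] by fastforce
  moreover have "sys_union S = (\<Union>I\<in>S. {fst I<..<snd I})"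
    by (rule set_eqI) (simp add: sys_union_iff)
  ultimately have "emeasure lborel (sys_union S) = (\<Sum>I\<in>S. emeasure lborel {fst I<..<snd I})"
    using disj_systemD(1)[OF assms] by (simp add: sum_emeasure image_subset_iff)
  also have "\<dots> = (\<Sum>I\<in>S. ennreal (snd I - fst I))"
    using disj_systemD(2)[OF assms] by (intro sum.cong refl) (simp add: less_imp_le)
  also have "\<dots> = ennreal (total_length S)"
    unfolding total_length_def using disj_systemD(2)[OF assms] by (intro sum_ennreal) (simp add: less_imp_le)
  finally show ?thesis .
qed

text \<open>The total length is conserved by the evolution, and it is the measure of the union
  because the intervals at time \<tau> are disjoint again.\<close>

lemma
  assumes "disj_system S" "0 \<le> \<tau>"
  shows open_M_finite: "open (M_finite \<tau> S)"
    and emeasure_M_finite: "emeasure lborel (M_finite \<tau> S) = emeasure lborel (sys_union S)"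
proof -
  obtain V where V: "flow_family V" "total_length (V \<tau>) = total_length S"
      "M_finite \<tau> S = sys_union (V \<tau>)"
    using M_finite_evolution[OF assms(1)] assms(2) by metis
  then have "disj_system (V \<tau>)" using assms(2) by (auto simp: flow_family_def sep_system_def)
  then show "open (M_finite \<tau> S)" "emeasure lborel (M_finite \<tau> S) = emeasure lborel (sys_union S)"
    using V emeasure_sys_union assms by (auto simp: open_sys_union)
qed

text \<open>Thickened intervals may overlap. They are inserted one at a time, and each new one is
  fused with the members that it overlaps into their hull, which adds no point to the union.\<close>

lemma disj_system_cover:
  assumes "finite G" "\<And>I. I \<in> G \<Longrightarrow> fst I < snd I"
  shows "\<exists>S. disj_system S \<and> dominates 0 G S \<and> sys_union S \<subseteq> sys_union G"
  using assms
proof (induction G rule: finite_induct)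
  case empty
  show ?case by (rule exI[of _ "{}"]) (simp add: disj_system_def dominates_def)
next
  case (insert I G)
  then obtain S where S: "disj_system S" "dominates 0 G S" "sys_union S \<subseteq> sys_union G" by auto
  have lt: "fst I < snd I" using insert.prems by simp
  define Q where "Q = {J \<in> S. fst J < snd I \<and> fst I < snd J}"
  define A where "A = insert (fst I) (fst ` Q)"
  define B where "B = insert (snd I) (snd ` Q)"
  define K where "K = (Min A, Max B)"
  have fin: "finite A" "finite B" "A \<noteq> {}" "B \<noteq> {}"
    using disj_systemD(1)[OF S(1)] by (auto simp: A_def B_def Q_def)
  have A: "Min A \<le> a" if "a \<in> A" for a using fin that by simp
  have B: "b \<le> Max B" if "b \<in> B" for b using fin that by simp
  have AI: "Min A \<in> A" and BI: "Max B \<in> B" using fin by simp_all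
  have KI: "near 0 I K" using A[of "fst I"] B[of "snd I"] by (simp add: near_def K_def A_def B_def)
  have KQ: "near 0 J K" if "J \<in> Q" for J
    using A[of "fst J"] B[of "snd J"] that by (simp add: near_def K_def A_def B_def)
  \<comment> \<open>A member outside \<open>Q\<close> lies on one side of \<open>I\<close>. It is
    disjoint from the members of \<open>Q\<close>, all of which overlap \<open>I\<close>, so it lies
    on the same side of these and therefore of the hull.\<close>
  have Kd: "snd K \<le> fst L \<or> snd L \<le> fst K" if L: "L \<in> S - Q" for L
  proof -
    have LS: "L \<in> S" "fst L < snd L" using L disj_systemD(2)[OF S(1)] by auto
    have sepQ: "snd L \<le> fst J \<or> snd J \<le> fst L" "fst J < snd I" "fst I < snd J" if "J \<in> Q" for J
      using disj_systemD(3)[OF S(1), of L J] that L by (auto simp: Q_def)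
    consider "snd L \<le> fst I" | "snd I \<le> fst L" using L by (force simp: Q_def)
    then show ?thesis
    proof cases
      case 1
      have "snd L \<le> fst J" if "J \<in> Q" for J using sepQ[OF that] 1 LS(2) by linarith
      then have "\<forall>a\<in>A. snd L \<le> a" using 1 by (auto simp: A_def)
      then have "snd L \<le> Min A" using AI by blast
      then show ?thesis by (simp add: K_def)
    next
      case 2
      have "snd J \<le> fst L" if "J \<in> Q" for J using sepQ[OF that] 2 LS(2) by linarith
      then have "\<forall>b\<in>B. b \<le> fst L" using 2 by (auto simp: B_def)
      then have "Max B \<le> fst L" using BI by blast
      then show ?thesis by (simp add: K_def)
    qed
  qed
  let ?S = "insert K (S - Q)"
  have "fst K < snd K" using KI lt by (simp add: near_def)
  then have "disj_system ?S"
    unfolding disj_system_def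
  proof (intro conjI ballI impI)
    show "finite ?S" using disj_systemD(1)[OF S(1)] by simp
    show "fst I < snd I" if "I \<in> ?S" for I
      using that \<open>fst K < snd K\<close> disj_systemD(2)[OF S(1)] by blast
    show "snd I \<le> fst J \<or> snd J \<le> fst I" if "I \<in> ?S" "J \<in> ?S" "I \<noteq> J" for I J
      using that Kd disj_systemD(3)[OF S(1)] by blast
  qed
  moreover have "dominates 0 (insert I G) ?S"
  proof -
    have "dominates 0 S ?S"
      unfolding dominates_def
    proof
      fix J assume "J \<in> S"
      show "\<exists>J'\<in>?S. near 0 J J'"
      proof (cases "J \<in> Q")
        case True then show ?thesis using KQ by blast
      next
        case False
        have "near 0 J J" by (simp add: near_def)
        then show ?thesis using False \<open>J \<in> S\<close> by blast
      qed
    qed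
    then have "dominates 0 G ?S" using dominates_trans[OF S(2)] by fastforce
    then show ?thesis using KI by (auto simp: dominates_def)
  qed
  moreover have "sys_union ?S \<subseteq> sys_union (insert I G)"
  proof
    fix x assume "x \<in> sys_union ?S"
    then consider "x \<in> sys_union S" | "fst K < x" "x < snd K" by (auto simp: sys_union_iff)
    then show "x \<in> sys_union (insert I G)"
    proof cases
      case 1 then show ?thesis using S(3) sys_union_mono[of G "insert I G"] by blast
    next
      case 2
      have "x \<in> sys_union S \<or> (fst I < x \<and> x < snd I)"
      proof (cases "x \<le> fst I")
        case True
        \<comment> \<open>To the left of \<open>I\<close>, the member of \<open>Q\<close> with the
          smallest left end covers the point, since it reaches beyond \<open>fst I\<close>. The
          right side is symmetric.\<close>
        then have "Min A \<in> fst ` Q" using AI 2 by (auto simp: A_def K_def)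
        then obtain J where "J \<in> Q" "Min A = fst J" by blast
        then show ?thesis using True 2 unfolding sys_union_iff Q_def K_def by force
      next
        case False
        note F1 = this
        show ?thesis
        proof (cases "snd I \<le> x")
          case True
          then have "Max B \<in> snd ` Q" using BI 2 by (auto simp: B_def K_def)
          then obtain J where "J \<in> Q" "Max B = snd J" by blast
          then show ?thesis using True 2 unfolding sys_union_iff Q_def K_def by force
        qed (use F1 in auto)
      qed
      moreover have "x \<in> sys_union (insert I G)" if "fst I < x" "x < snd I"
        using that unfolding sys_union_iff by blast
      ultimately show ?thesis using S(3) sys_union_mono[of G "insert I G"] by blast
    qed
  qed
  ultimately show ?case by blast
qed

text \<open>Agrees with \<open>M \<tau>\<close> on open sets with bounded components, and is monotone without this
  restriction.\<close>

definition css_open :: "real \<Rightarrow> real set \<Rightarrow> real set" where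
  "css_open \<tau> U = (\<Union>S\<in>{S. disj_system S \<and> sys_union S \<subseteq> U}. M_finite \<tau> S)"

lemma open_css_open: "0 \<le> \<tau> \<Longrightarrow> open (css_open \<tau> U)"
  unfolding css_open_def using open_M_finite by blast

lemma css_open_mono: "U \<subseteq> V \<Longrightarrow> css_open \<tau> U \<subseteq> css_open \<tau> V"
  unfolding css_open_def by blast

text \<open>Thicken each interval of \<open>S\<close> by \<open>r\<close> and make the result
  disjoint again: this system dominates \<open>S\<close> with margin \<open>r\<close> and still fits
  into \<open>V\<close>.\<close>

lemma M_finite_css_open_near:
  assumes "0 \<le> \<tau>" "disj_system S" "x \<in> M_finite \<tau> S" "\<bar>y - x\<bar> \<le> r"
    and V: "\<And>s t. s \<in> sys_union S \<Longrightarrow> \<bar>t - s\<bar> \<le> r \<Longrightarrow> t \<in> V"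
  shows "y \<in> css_open \<tau> V"
proof -
  have r: "0 \<le> r" using assms(4) by simp
  define G where "G = (\<lambda>I. (fst I - r, snd I + r)) ` S"
  have "finite G" using disj_systemD(1)[OF assms(2)] by (simp add: G_def)
  moreover have "fst I < snd I" if "I \<in> G" for I
    using that disj_systemD(2)[OF assms(2)] r unfolding G_def by force
  ultimately obtain S' where S': "disj_system S'" "dominates 0 G S'" "sys_union S' \<subseteq> sys_union G"
    using disj_system_cover by metis
  have "dominates r S G" unfolding dominates_def G_def near_def by force
  from dominates_trans[OF this S'(2)] have "y \<in> M_finite \<tau> S'"
    using M_finite_near assms S'(1) by simp
  moreover have "sys_union S' \<subseteq> V"
  proof
    fix t assume "t \<in> sys_union S'"
    then obtain I where I: "I \<in> S" "fst I - r < t" "t < snd I + r"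
      using S'(3) by (force simp: sys_union_iff G_def)
    \<comment> \<open>A point of the thickened open interval has some point of the original interval
      within distance \<open>r\<close>; these two inequalities leave room to choose it on either
      side.\<close>
    then have "max (fst I) (t - r) < snd I" "fst I < min (snd I) (t + r)"
      using disj_systemD(2)[OF assms(2)] by auto
    have "\<exists>s. fst I < s \<and> s < snd I \<and> \<bar>t - s\<bar> \<le> r"
    proof (cases "t \<le> fst I")
      case True
      then obtain s where "fst I < s" "s < min (snd I) (t + r)"
        using dense[OF \<open>fst I < min (snd I) (t + r)\<close>] by blast
      then show ?thesis using True by (intro exI[of _ s]) auto
    next
      case F: False
      show ?thesis
      proof (cases "snd I \<le> t")
        case True
        then obtain s where "max (fst I) (t - r) < s" "s < snd I"
          using dense[OF \<open>max (fst I) (t - r) < snd I\<close>] by blast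
        then show ?thesis using True by (intro exI[of _ s]) auto
      next
        case False
        then show ?thesis using F r by (intro exI[of _ t]) auto
      qed
    qed
    then show "t \<in> V" using V I(1) by (auto simp: sys_union_iff)
  qed
  ultimately show ?thesis using S'(1) unfolding css_open_def by blast
qed

lemma css_open_near:
  assumes "0 \<le> \<tau>" "x \<in> css_open \<tau> U" "\<bar>y - x\<bar> \<le> r"
    and "\<And>s t. s \<in> U \<Longrightarrow> \<bar>t - s\<bar> \<le> r \<Longrightarrow> t \<in> V"
  shows "y \<in> css_open \<tau> V"
proof -
  obtain S where "disj_system S" "sys_union S \<subseteq> U" "x \<in> M_finite \<tau> S"
    using assms(2) by (auto simp: css_open_def)
  then show ?thesis using M_finite_css_open_near[OF assms(1) _ _ assms(3)] assms(4) by blast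
qed

lemma Ioo_eq_iff:
  fixes a b c d :: real
  assumes "a < b" "c < d"
  shows "{a<..<b} = {c<..<d} \<longleftrightarrow> a = c \<and> b = d"
  using assms greaterThanLessThan_subseteq_greaterThanLessThan[of a b c d]
    greaterThanLessThan_subseteq_greaterThanLessThan[of c d a b] by auto

lemma open_connected_bounded_real:
  fixes C :: "real set"
  assumes "open C" "connected C" "bounded C" "C \<noteq> {}"
  shows "C = {Inf C<..<Sup C} \<and> Inf C < Sup C"
proof -
  have bd: "bdd_below C" "bdd_above C" using assms(3) bounded_imp_bdd_below bounded_imp_bdd_above by auto
  have "x \<in> C" if "Inf C < x" "x < Sup C" for x
  proof -
    obtain y where "y \<in> C" "y < x" using cInf_lessD[OF assms(4) \<open>Inf C < x\<close>] by blast
    moreover obtain z where "z \<in> C" "x < z" using less_cSupD[OF assms(4) \<open>x < Sup C\<close>] by blast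
    ultimately show ?thesis using assms(2) by (meson connected_contains_Icc atLeastAtMost_iff less_imp_le subsetD)
  qed
  moreover have "Inf C < x \<and> x < Sup C" if "x \<in> C" for x
  proof -
    obtain e where e: "e > 0" "ball x e \<subseteq> C" using assms(1) \<open>x \<in> C\<close> by (meson open_contains_ball)
    then have "x - e/2 \<in> C" "x + e/2 \<in> C" by (auto simp: dist_real_def intro!: subsetD[OF e(2)])
    then have "Inf C \<le> x - e/2" "x + e/2 \<le> Sup C" using bd by (auto intro: cInf_lower cSup_upper)
    then show ?thesis using e(1) by auto
  qed
  ultimately show ?thesis using assms(4) by fastforce
qed

lemma css_open_empty [simp]: "css_open \<tau> {} = {}"
proof -
  have "S = {}" if "disj_system S" "sys_union S \<subseteq> {}" for S
  proof (rule ccontr)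
    assume "S \<noteq> {}"
    then obtain I where I: "I \<in> S" by blast
    from dense[OF disj_systemD(2)[OF that(1) this]] obtain x where "fst I < x" "x < snd I" by blast
    then have "x \<in> sys_union S" using I by (auto simp only: sys_union_iff)
    then show False using that(2) by blast
  qed
  moreover have "T = {}" if "evolves {} \<tau> T" for T
  proof -
    \<comment> \<open>The constant empty family is a flow family, and nothing but the empty system
      lies below it.\<close>
    have "dominates 0 T {}"
      by (rule evolves_dominates[OF that, of "\<lambda>_. {}"])
        (simp_all add: flow_family_def sep_system_def disj_system_def dominates_def)
    then show ?thesis by (auto simp: dominates_def)
  qed
  then have "M_finite \<tau> {} = {}" unfolding M_finite_def by blast
  ultimately show ?thesis unfolding css_open_def by blast
qed

context
  fixes U :: "real set"
  assumes U: "open U" "\<forall>C\<in>components U. bounded C"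
begin

lemma sys_union_component_intervals: "sys_union (component_intervals U) = U"
proof
  show "sys_union (component_intervals U) \<subseteq> U"
    unfolding sys_union_def component_intervals_def using in_components_subset by fast
  show "U \<subseteq> sys_union (component_intervals U)"
  proof
    fix x assume "x \<in> U"
    then obtain C where C: "C \<in> components U" "x \<in> C"
      using Union_components by blast
    then have "C = {Inf C<..<Sup C} \<and> Inf C < Sup C"
      using U in_components_connected in_components_nonempty open_components
      by (intro open_connected_bounded_real) auto
    then have "(Inf C, Sup C) \<in> component_intervals U" "x \<in> {Inf C<..<Sup C}"
      unfolding component_intervals_def using C by auto
    then show "x \<in> sys_union (component_intervals U)" by (force simp: sys_union_iff)
  qed
qed

lemma disj_system_component_intervals:
  assumes "S \<subseteq> component_intervals U" "finite S"
  shows "disj_system S"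
proof -
  have "snd I \<le> fst J \<or> snd J \<le> fst I" if "I \<in> component_intervals U" "J \<in> component_intervals U" "I \<noteq> J"
    for I J
  proof (rule ccontr)
    assume neg: "\<not> ?thesis"
    have I: "fst I < snd I" "{fst I<..<snd I} \<in> components U"
      and J: "fst J < snd J" "{fst J<..<snd J} \<in> components U"
      using that by (auto simp: component_intervals_def)
    have "max (fst I) (fst J) < min (snd I) (snd J)" using neg I J by auto
    then obtain x where "max (fst I) (fst J) < x" "x < min (snd I) (snd J)" using dense by blast
    then have "{fst I<..<snd I} \<inter> {fst J<..<snd J} \<noteq> {}" by auto
    then have "{fst I<..<snd I} = {fst J<..<snd J}"
      using components_nonoverlap[OF I(2) J(2)] by simp
    then have "fst I = fst J \<and> snd I = snd J" using I J by (simp add: Ioo_eq_iff)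
    then show False using \<open>I \<noteq> J\<close> by (simp add: prod_eq_iff)
  qed
  moreover have "fst I < snd I" if "I \<in> component_intervals U" for I
    using that by (auto simp: component_intervals_def)
  ultimately show ?thesis using assms unfolding disj_system_def by (meson subsetD)
qed

text \<open>An interval inside \<open>U\<close> is connected, hence contained in a single
  component.\<close>

lemma dominates_component_intervals:
  assumes "disj_system S" "sys_union S \<subseteq> U"
  shows "dominates 0 S (component_intervals U)"
  unfolding dominates_def
proof
  fix I assume I: "I \<in> S"
  have lt: "fst I < snd I" using disj_systemD(2)[OF assms(1) I] .
  then obtain x where x: "x \<in> {fst I<..<snd I}" using dense[OF lt] by auto
  have sub: "{fst I<..<snd I} \<subseteq> U"
    using assms(2) I by (intro subsetI, elim subsetD) (simp only: sys_union_iff greaterThanLessThan_iff, blast)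
  then have "x \<in> sys_union (component_intervals U)" using x sys_union_component_intervals by auto
  then obtain J where J: "J \<in> component_intervals U" "fst J < x" "x < snd J" by (auto simp: sys_union_iff)
  then have "{fst I<..<snd I} \<subseteq> {fst J<..<snd J}"
    using components_maximal[of "{fst J<..<snd J}" U "{fst I<..<snd I}"] sub x
    by (force simp: component_intervals_def)
  then have "near 0 I J" using lt by (simp add: near_def greaterThanLessThan_subseteq_greaterThanLessThan)
  then show "\<exists>J\<in>component_intervals U. near 0 I J" using J(1) by blast
qed

lemma countable_component_intervals: "countable (component_intervals U)"
proof -
  have "countable (components U)"
    using countable_disjoint_open_subsets[of "components U"] U(1) open_components
    pairwise_disjoint_components[of U] by (simp add: disjnt_def[abs_def] open_components)
  moreover have "inj_on (\<lambda>I. {fst I<..<snd I}) (component_intervals U)"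
    by (intro inj_onI) (auto simp: component_intervals_def Ioo_eq_iff)
  moreover have "(\<lambda>I. {fst I<..<snd I}) ` component_intervals U \<subseteq> components U"
    by (auto simp: component_intervals_def)
  ultimately show ?thesis by (meson countable_image_inj_on countable_subset)
qed

text \<open>A finite system inside \<open>U\<close> meets only finitely many components, so it is
  dominated by one of the finite stages of the enumeration. This identifies the union over all
  systems with the union over the stages.\<close>

lemma css_open_exhaustion:
  assumes "0 \<le> \<tau>" "component_intervals U \<noteq> {}"
  defines "G \<equiv> \<lambda>m. from_nat_into (component_intervals U) ` {..<m::nat}"
  shows "disj_system (G m)" "incseq G" "(\<Union>m. sys_union (G m)) = U"
    "css_open \<tau> U = (\<Union>m. M_finite \<tau> (G m))"
proof -
  have sub: "G m \<subseteq> component_intervals U" for m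
    using from_nat_into[OF assms(2)] by (auto simp: G_def)
  show D: "disj_system (G m)" for m
    using disj_system_component_intervals[OF sub] by (simp add: G_def)
  show inc: "incseq G" unfolding G_def by (intro monoI) auto
  have R: "(\<Union>m. G m) = component_intervals U"
  proof -
    have "(\<Union>m. G m) = range (from_nat_into (component_intervals U))" by (auto simp: G_def)
    then show ?thesis using range_from_nat_into[OF assms(2) countable_component_intervals] by simp
  qed
  have "(\<Union>m. sys_union (G m)) = sys_union (\<Union>m. G m)"
    by (rule set_eqI) (simp only: sys_union_iff UN_iff Bex_def, blast)
  then show "(\<Union>m. sys_union (G m)) = U" using R sys_union_component_intervals by simp
  show "css_open \<tau> U = (\<Union>m. M_finite \<tau> (G m))"
  proof
    show "(\<Union>m. M_finite \<tau> (G m)) \<subseteq> css_open \<tau> U"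
      using D sys_union_mono[OF sub] sys_union_component_intervals unfolding css_open_def by blast
    show "css_open \<tau> U \<subseteq> (\<Union>m. M_finite \<tau> (G m))"
    proof
      fix x assume "x \<in> css_open \<tau> U"
      then obtain S where S: "disj_system S" "sys_union S \<subseteq> U" "x \<in> M_finite \<tau> S"
        by (auto simp: css_open_def)
      have "\<forall>I\<in>S. \<exists>m. \<exists>J\<in>G m. near 0 I J"
        using dominates_component_intervals[OF S(1,2)] R unfolding dominates_def by blast
      then obtain m where m: "\<And>I. I \<in> S \<Longrightarrow> \<exists>J\<in>G (m I). near 0 I J" by metis
      define N where "N = Max (insert 0 (m ` S))"
      have "m I \<le> N" if "I \<in> S" for I
        unfolding N_def using disj_systemD(1)[OF S(1)] that by (intro Max_ge) auto
      then have "dominates 0 S (G N)"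
        unfolding dominates_def using m incseqD[OF inc] by (meson subsetD)
      then have "x \<in> M_finite \<tau> (G N)" using M_finite_near[OF S(1) D _ assms(1) S(3)] by simp
      then show "x \<in> (\<Union>m. M_finite \<tau> (G m))" by blast
    qed
  qed
qed

lemma M_eq_css_open:
  assumes "0 \<le> \<tau>"
  shows "M \<tau> U = css_open \<tau> U"
proof (cases "finite (component_intervals U)")
  case True
  let ?C = "component_intervals U"
  have D: "disj_system ?C" using disj_system_component_intervals True by simp
  have "M_finite \<tau> ?C \<subseteq> css_open \<tau> U"
    unfolding css_open_def using D sys_union_component_intervals by blast
  moreover have "M_finite \<tau> S \<subseteq> M_finite \<tau> ?C" if "disj_system S" "sys_union S \<subseteq> U" for S
    using M_finite_near[OF that(1) D dominates_component_intervals[OF that] assms] by auto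
  then have "css_open \<tau> U \<subseteq> M_finite \<tau> ?C" unfolding css_open_def by blast
  ultimately show ?thesis using True U(2) by (simp add: M_def)
next
  case False
  then have "component_intervals U \<noteq> {}" by auto
  then show ?thesis using css_open_exhaustion(4)[OF assms] False U(2) by (simp add: M_def)
qed

lemma emeasure_css_open_bounded_components:
  assumes "0 \<le> \<tau>"
  shows "emeasure lborel (css_open \<tau> U) = emeasure lborel U"
proof (cases "component_intervals U = {}")
  case True
  then have "U = {}" using sys_union_component_intervals by (auto simp: sys_union_def)
  then show ?thesis by simp
next
  case False
  \<comment> \<open>If there are finitely many components, \<open>from_nat_into\<close> repeats some
    of them; the stages are sets, so the finite case is included.\<close>
  define G where "G = (\<lambda>m::nat. from_nat_into (component_intervals U) ` {..<m})"
  have ex: "disj_system (G m)" "incseq G" "(\<Union>m. sys_union (G m)) = U"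
    "css_open \<tau> U = (\<Union>m. M_finite \<tau> (G m))" for m
    using css_open_exhaustion[OF assms False] unfolding G_def by simp_all
  have inc: "incseq (\<lambda>m. sys_union (G m))"
    using ex(2) sys_union_mono unfolding incseq_def by blast
  have dom: "dominates 0 (G m) (G n)" if "m \<le> n" for m n
    using ex(2) that by (intro dominates_refl) (auto dest: incseqD)
  then have inc': "incseq (\<lambda>m. M_finite \<tau> (G m))"
    unfolding incseq_def
  proof (intro allI impI subsetI)
    fix m n x assume "m \<le> n" "x \<in> M_finite \<tau> (G m)"
    then show "x \<in> M_finite \<tau> (G n)"
      using M_finite_near[OF ex(1)[of m] ex(1)[of n] dom assms, of x x] by simp
  qed
  have "emeasure lborel (css_open \<tau> U) = (SUP m. emeasure lborel (M_finite \<tau> (G m)))"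
    unfolding ex(4) using open_M_finite[OF ex(1) assms] inc'
    by (intro SUP_emeasure_incseq[symmetric]) auto
  also have "\<dots> = (SUP m. emeasure lborel (sys_union (G m)))"
    using emeasure_M_finite[OF ex(1) assms] by simp
  also have "\<dots> = emeasure lborel (\<Union>m. sys_union (G m))"
    using open_sys_union inc by (intro SUP_emeasure_incseq) auto
  finally show ?thesis using ex(3) by simp
qed

end

text \<open>An unbounded component is an interval containing two points further apart than the
  measure of \<open>U\<close>.\<close>

lemma bounded_components_finite_measure:
  fixes U :: "real set"
  assumes "open U" "emeasure lborel U < \<infinity>"
  shows "\<forall>C\<in>components U. bounded C"
proof (rule ballI, rule ccontr)
  fix C assume C: "C \<in> components U" and nb: "\<not> bounded C"
  have "connected C" "C \<noteq> {}" "open C" "C \<subseteq> U"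
    using in_components_connected[OF C] in_components_nonempty[OF C] open_components[OF assms(1) C]
      in_components_subset[OF C] by simp_all
  then obtain x where x: "x \<in> C" by auto
  define c where "c = enn2real (emeasure lborel U)"
  have c: "emeasure lborel U = ennreal c" "0 \<le> c" using assms(2) by (auto simp: c_def less_top)
  obtain y where y: "y \<in> C" "\<bar>y\<bar> > \<bar>x\<bar> + c"
    using nb unfolding bounded_iff by (metis linorder_not_le real_norm_def)
  have "{min x y..max x y} \<subseteq> C"
    using \<open>connected C\<close> x y connected_contains_Icc by (metis max_def min_def)
  then have "emeasure lborel {min x y..max x y} \<le> emeasure lborel U"
    using \<open>C \<subseteq> U\<close> assms(1) by (intro emeasure_mono) auto
  then have "ennreal (max x y - min x y) \<le> ennreal c" using c by simp
  then have "max x y - min x y \<le> c" using c(2) by simp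
  then show False using y(2) by linarith
qed

lemma emeasure_css_open:
  assumes "0 \<le> \<tau>" "open U" "emeasure lborel U < \<infinity>"
  shows "emeasure lborel (css_open \<tau> U) = emeasure lborel U"
  using emeasure_css_open_bounded_components[OF assms(2) bounded_components_finite_measure[OF assms(2,3)] assms(1)] .

text \<open>Monotonicity and preservation of measure suffice. Replacing \<open>Q\<close> by
  \<open>P \<inter> Q\<close> makes the sets nested and of finite measure, so that measures can be
  subtracted.\<close>

lemma emeasure_css_open_Diff:
  assumes "0 \<le> \<tau>" "open P" "emeasure lborel P < \<infinity>" "open Q"
  shows "emeasure lborel (css_open \<tau> P - css_open \<tau> Q) \<le> emeasure lborel (P - Q)"
proof -
  have [measurable]: "P \<in> sets borel" "Q \<in> sets borel" "css_open \<tau> P \<in> sets borel"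
    "css_open \<tau> (P \<inter> Q) \<in> sets borel"
    using assms open_css_open by auto
  have fin: "emeasure lborel (P \<inter> Q) < \<infinity>"
    using assms(3) emeasure_mono[of "P \<inter> Q" P lborel] by (simp add: le_less_trans)
  have "emeasure lborel (css_open \<tau> P - css_open \<tau> Q) \<le> emeasure lborel (css_open \<tau> P - css_open \<tau> (P \<inter> Q))"
    using css_open_mono[of "P \<inter> Q" Q \<tau>] by (intro emeasure_mono) auto
  also have "\<dots> = emeasure lborel P - emeasure lborel (P \<inter> Q)"
    using emeasure_css_open[OF assms(1)] assms fin css_open_mono[of "P \<inter> Q" P \<tau>]
    by (subst emeasure_Diff) (auto simp: less_top open_Int)
  also have "\<dots> = emeasure lborel (P - P \<inter> Q)"
    using fin by (intro emeasure_Diff[symmetric]) (auto simp: less_top)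
  finally show ?thesis by (simp add: Diff_Int_distrib Diff_Int)
qed

section \<open>Symmetrization along parallel lines\<close>

definition upd :: "'n::finite \<Rightarrow> real ^ 'n \<Rightarrow> real \<Rightarrow> real ^ 'n" where
  "upd k x s = (\<chi> i. if i = k then s else x $ i)"

lemma upd_nth [simp]: "upd k x s $ i = (if i = k then s else x $ i)"
  by (simp add: upd_def)

lemma upd_upd [simp]: "upd k (upd k x s) t = upd k x t"
  by (simp add: vec_eq_iff)

lemma upd_add: "upd k x (x $ k + t) = x + t *\<^sub>R axis k 1"
  by (simp add: vec_eq_iff axis_def)

lemma slice_upd: "slice k f x h = {s. f (upd k x s) > h}"
  by (simp add: slice_def upd_def)

lemma slice_upd_upd [simp]: "slice k f (upd k x s) h = slice k f x h"
  by (simp add: slice_upd)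

lemma continuous_on_upd [continuous_intros]:
  assumes "continuous_on A g" "continuous_on A h"
  shows "continuous_on A (\<lambda>z. upd k (g z) (h z))"
  unfolding upd_def
proof (intro continuous_on_vec_lambda)
  fix i show "continuous_on A (\<lambda>x. if i = k then h x else g x $ i)"
    using assms by (cases "i = k") (auto intro!: continuous_intros)
qed

lemma measurable_upd [measurable]:
  "(\<lambda>p. upd k (fst p) (snd p)) \<in> borel_measurable (borel \<Otimes>\<^sub>M borel)"
  unfolding borel_prod by (intro borel_measurable_continuous_onI continuous_intros)

lemma measurable_upd_comp [measurable (raw)]:
  assumes [measurable]: "g \<in> borel_measurable N" "h \<in> borel_measurable N"
  shows "(\<lambda>z. upd k (g z) (h z)) \<in> borel_measurable N"
  using measurable_compose[OF measurable_Pair[OF assms] measurable_upd] by simp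

lemma measurable_vec_nth [measurable (raw)]:
  fixes h :: "'b \<Rightarrow> real ^ 'n::finite"
  assumes "h \<in> borel_measurable N"
  shows "(\<lambda>z. h z $ k) \<in> borel_measurable N"
  using assms by (rule measurable_compose) (intro borel_measurable_continuous_onI continuous_intros)

lemma nn_integral_lborel_translate:
  fixes F :: "'a::euclidean_space \<Rightarrow> ennreal"
  assumes [measurable]: "F \<in> borel_measurable borel"
  shows "(\<integral>\<^sup>+ x. F (c + x) \<partial>lborel) = (\<integral>\<^sup>+ x. F x \<partial>lborel)"
proof -
  have "(\<integral>\<^sup>+ x. F x \<partial>lborel) = (\<integral>\<^sup>+ x. F x \<partial>distr lborel borel ((+) c))"
    by (simp add: lborel_distr_plus)
  also have "\<dots> = (\<integral>\<^sup>+ x. F (c + x) \<partial>lborel)"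
    by (subst nn_integral_distr) simp_all
  finally show ?thesis by simp
qed

text \<open>Averaging over translations in direction \<open>k\<close> replaces the splitting of the space into
  \<open>x\<^sub>k\<close> and the remaining coordinates.\<close>

lemma nn_integral_lines:
  fixes F :: "real ^ 'n::finite \<Rightarrow> ennreal"
  assumes [measurable]: "F \<in> borel_measurable borel"
  shows "(\<integral>\<^sup>+ x. F x \<partial>lborel) =
    (\<integral>\<^sup>+ x. indicator {0..1} (x $ k) * (\<integral>\<^sup>+ s. F (upd k x s) \<partial>lborel) \<partial>lborel)"
proof -
  have line: "(\<integral>\<^sup>+ s. F (upd k x s) \<partial>lborel) = (\<integral>\<^sup>+ t. F (t *\<^sub>R axis k 1 + x) \<partial>lborel)" for x
    using nn_integral_lborel_translate[of "\<lambda>s. F (upd k x s)" "x $ k"]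
    unfolding upd_add by (simp add: add.commute)
  have "(\<integral>\<^sup>+ x. indicator {0..1} (x $ k) * (\<integral>\<^sup>+ s. F (upd k x s) \<partial>lborel) \<partial>lborel) =
      (\<integral>\<^sup>+ x. (\<integral>\<^sup>+ t. indicator {0..1} (x $ k) * F (t *\<^sub>R axis k 1 + x) \<partial>lborel) \<partial>lborel)"
    unfolding line by (simp add: nn_integral_cmult)
  also have "\<dots> = (\<integral>\<^sup>+ t. (\<integral>\<^sup>+ x. indicator {0..1} (x $ k) * F (t *\<^sub>R axis k 1 + x) \<partial>lborel) \<partial>lborel)"
    by (intro lborel_pair.Fubini') measurable
  \<comment> \<open>The translation is moved from \<open>F\<close> to the slab. For fixed
    \<open>x\<close>, the times at which \<open>x\<close> lies in the shifted slab form an interval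
    of length 1.\<close>
  also have "\<dots> = (\<integral>\<^sup>+ t. (\<integral>\<^sup>+ x. indicator {0..1} (x $ k - t) * F x \<partial>lborel) \<partial>(lborel :: real measure))"
  proof (rule nn_integral_cong)
    fix t :: real
    have "(\<integral>\<^sup>+ x. indicator {0..1} ((t *\<^sub>R axis k 1 + x) $ k - t) * F (t *\<^sub>R axis k 1 + x) \<partial>lborel) =
        (\<integral>\<^sup>+ x. indicator {0..1} (x $ k - t) * F x \<partial>lborel)"
      by (rule nn_integral_lborel_translate) measurable
    then show "(\<integral>\<^sup>+ x. indicator {0..1} (x $ k) * F (t *\<^sub>R axis k 1 + x) \<partial>lborel) =
        (\<integral>\<^sup>+ x. indicator {0..1} (x $ k - t) * F x \<partial>lborel)" by simp
  qed
  also have "\<dots> = (\<integral>\<^sup>+ x. (\<integral>\<^sup>+ t. indicator {0..1} (x $ k - t) * F x \<partial>(lborel :: real measure)) \<partial>lborel)"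
    by (intro lborel_pair.Fubini') measurable
  also have "\<dots> = (\<integral>\<^sup>+ x. F x \<partial>lborel)"
  proof (intro nn_integral_cong)
    fix x
    have "(\<integral>\<^sup>+ t. indicator {0..1} (x $ k - t) * F x \<partial>(lborel :: real measure)) =
        (\<integral>\<^sup>+ t. F x * indicator {x $ k - 1..x $ k} t \<partial>lborel)"
      by (intro nn_integral_cong) (auto simp: indicator_def)
    then show "(\<integral>\<^sup>+ t. indicator {0..1} (x $ k - t) * F x \<partial>(lborel :: real measure)) = F x"
      by (simp add: nn_integral_cmult_indicator)
  qed
  finally show ?thesis by simp
qed

text \<open>Within the slab this is finiteness of the iterated integral. The exceptional set is a
  union of whole lines, so being null in the slab makes it null everywhere.\<close>

lemma AE_lines:
  fixes F :: "real ^ 'n::finite \<Rightarrow> ennreal"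
  assumes [measurable]: "F \<in> borel_measurable borel" and fin: "(\<integral>\<^sup>+ x. F x \<partial>lborel) < \<infinity>"
  shows "AE x in lborel. x $ k \<in> {0..1} \<longrightarrow> (\<integral>\<^sup>+ s. F (upd k x s) \<partial>lborel) < \<infinity>"
    and "AE x in lborel. (\<integral>\<^sup>+ s. F (upd k x s) \<partial>lborel) < \<infinity>"
proof -
  have "AE x in lborel. indicator {0..1} (x $ k) * (\<integral>\<^sup>+ s. F (upd k x s) \<partial>lborel) \<noteq> \<infinity>"
    using fin unfolding nn_integral_lines[of F k, OF assms(1)]
    by (intro nn_integral_PInf_AE) (auto simp: less_top)
  then show slab: "AE x in lborel. x $ k \<in> {0..1} \<longrightarrow> (\<integral>\<^sup>+ s. F (upd k x s) \<partial>lborel) < \<infinity>"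
    by eventually_elim (auto simp: less_top)
  define N where "N = {x. (\<integral>\<^sup>+ s. F (upd k x s) \<partial>lborel) = \<infinity>}"
  have [measurable]: "N \<in> sets borel" unfolding N_def by measurable
  have "(\<integral>\<^sup>+ x. indicator N x \<partial>lborel) =
      (\<integral>\<^sup>+ x. indicator {0..1} (x $ k) * (\<integral>\<^sup>+ s. indicator N (upd k x s) \<partial>lborel) \<partial>lborel)"
    by (intro nn_integral_lines) measurable
  also have "\<dots> = (\<integral>\<^sup>+ x. 0 \<partial>(lborel :: (real ^ 'n) measure))"
  proof (intro nn_integral_cong_AE, use slab in eventually_elim)
    fix x :: "real ^ 'n"
    assume *: "x $ k \<in> {0..1} \<longrightarrow> (\<integral>\<^sup>+ s. F (upd k x s) \<partial>lborel) < \<infinity>"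
    have inv: "upd k x s \<in> N \<longleftrightarrow> x \<in> N" for s by (simp add: N_def)
    show "indicator {0..1} (x $ k) * (\<integral>\<^sup>+ s. indicator N (upd k x s) \<partial>lborel) = 0"
    proof (cases "x $ k \<in> {0..1}")
      case True
      then have "indicator N (upd k x s) = (0 :: ennreal)" for s using * inv by (simp add: N_def)
      then show ?thesis by simp
    qed simp
  qed
  finally have "N \<in> null_sets lborel" by (intro null_setsI) (simp_all add: nn_integral_indicator)
  from AE_not_in[OF this] show "AE x in lborel. (\<integral>\<^sup>+ s. F (upd k x s) \<partial>lborel) < \<infinity>"
    by eventually_elim (simp add: N_def less_top)
qed

section \<open>Level sets of the symmetrized function and the contraction property\<close>

definition css_levels :: "'n::finite \<Rightarrow> real \<Rightarrow> (real ^ 'n \<Rightarrow> real) \<Rightarrow> real ^ 'n \<Rightarrow> real set" where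
  "css_levels k \<tau> f x = {h. 0 \<le> h \<and> x $ k \<in> css_open \<tau> (slice k f x h)}"

text \<open>The layer integral of the symmetrization, built from the monotone
  \<open>css_open\<close>. Values in \<open>ennreal\<close> keep it meaningful on lines where the
  integral is infinite.\<close>

definition css_ext :: "'n::finite \<Rightarrow> real \<Rightarrow> (real ^ 'n \<Rightarrow> real) \<Rightarrow> real ^ 'n \<Rightarrow> ennreal" where
  "css_ext k \<tau> f x = emeasure lborel (css_levels k \<tau> f x)"

lemma slice_antimono: "h \<le> h' \<Longrightarrow> slice k f x h' \<subseteq> slice k f x h"
  by (auto simp: slice_def)

lemma css_levels_down:
  assumes "h \<in> css_levels k \<tau> f x" "0 \<le> h'" "h' \<le> h"
  shows "h' \<in> css_levels k \<tau> f x"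
  using assms css_open_mono[OF slice_antimono[OF assms(3)]] unfolding css_levels_def by blast

lemma css_levels_measurable [measurable]: "css_levels k \<tau> f x \<in> sets borel"
proof -
  have "is_interval (css_levels k \<tau> f x)"
    unfolding is_interval_1
  proof (intro ballI allI impI)
    fix a b y assume "a \<in> css_levels k \<tau> f x" "b \<in> css_levels k \<tau> f x" "a \<le> y \<and> y \<le> b"
    then show "y \<in> css_levels k \<tau> f x"
      using css_levels_down[of b k \<tau> f x y] by (auto simp: css_levels_def)
  qed
  then show ?thesis by (simp add: is_interval_convex real_interval_borel_measurable)
qed

lemma css_ext_ge: "h \<in> css_levels k \<tau> f x \<Longrightarrow> ennreal h \<le> css_ext k \<tau> f x"
proof -
  assume h: "h \<in> css_levels k \<tau> f x"
  then have "0 \<le> h" by (simp add: css_levels_def)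
  moreover have "emeasure lborel {0..h} \<le> css_ext k \<tau> f x"
    unfolding css_ext_def using css_levels_down[OF h] by (intro emeasure_mono) auto
  ultimately show ?thesis by simp
qed

lemma css_ext_gtD:
  assumes "ennreal c < css_ext k \<tau> f x" "0 \<le> c"
  obtains h where "c < h" "h \<in> css_levels k \<tau> f x"
proof (rule ccontr)
  assume "\<not> thesis"
  then have "css_levels k \<tau> f x \<subseteq> {0..c}" using that by (force simp: css_levels_def)
  then have "css_ext k \<tau> f x \<le> emeasure lborel {0..c}"
    unfolding css_ext_def by (intro emeasure_mono) auto
  then show False using assms by simp
qed

lemma css_ext_gt_imp: "ennreal c < css_ext k \<tau> f x \<Longrightarrow> 0 \<le> c \<Longrightarrow> x $ k \<in> css_open \<tau> (slice k f x c)"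
proof -
  assume "ennreal c < css_ext k \<tau> f x" "0 \<le> c"
  then obtain h where "c < h" "h \<in> css_levels k \<tau> f x" by (rule css_ext_gtD)
  then have "c \<in> css_levels k \<tau> f x" using css_levels_down[of h k \<tau> f x c] \<open>0 \<le> c\<close> by simp
  then show ?thesis by (simp add: css_levels_def)
qed

lemma dist_upd_le: 
  assumes "\<bar>t - s\<bar> \<le> \<bar>x $ k - y $ k\<bar>"
  shows "dist (upd k x t) (upd k y s) \<le> dist x y"
  unfolding dist_norm using assms by (intro norm_le_componentwise_cart) auto

text \<open>Here the property of the line becomes one of the space: a shift along the parallel lines
  by at most the difference of the \<open>k\<close>-th coordinates keeps the distance of the two
  points below \<open>r\<close>. The constant \<open>c\<close> shifts the height.\<close>

lemma css_ext_near:
  assumes uv: "\<And>x y. dist x y < r \<Longrightarrow> u y \<le> v x + c" and "0 \<le> c" "0 \<le> \<tau>" "dist x y < r"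
  shows "css_ext k \<tau> u y \<le> css_ext k \<tau> v x + ennreal c"
proof (rule ccontr)
  assume "\<not> ?thesis"
  then have gt: "css_ext k \<tau> v x + ennreal c < css_ext k \<tau> u y" by simp
  then obtain b where b: "css_ext k \<tau> v x = ennreal b" "0 \<le> b"
    by (cases "css_ext k \<tau> v x") auto
  then have "ennreal (b + c) < css_ext k \<tau> u y" using gt assms(2) by simp
  then obtain h where h: "b + c < h" "h \<in> css_levels k \<tau> u y"
    using css_ext_gtD b(2) assms(2) by (metis add_nonneg_nonneg)
  have "x $ k \<in> css_open \<tau> (slice k v x (h - c))"
  proof (rule css_open_near[OF assms(3)])
    show "y $ k \<in> css_open \<tau> (slice k u y h)" using h(2) by (simp add: css_levels_def)
    fix s t assume s: "s \<in> slice k u y h" and t: "\<bar>t - s\<bar> \<le> \<bar>x $ k - y $ k\<bar>"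
    have "u (upd k y s) \<le> v (upd k x t) + c"
      using uv dist_upd_le[OF t] assms(4) by (meson le_less_trans)
    then show "t \<in> slice k v x (h - c)" using s by (simp add: slice_upd)
  qed simp
  then have "h - c \<in> css_levels k \<tau> v x" using h(1) b(2) by (simp add: css_levels_def)
  from css_ext_ge[OF this] have "h - c \<le> b" using b by simp
  then show False using h(1) by simp
qed

lemma compact_closure_sys_union: "disj_system S \<Longrightarrow> compact (\<Union>I\<in>S. {fst I..snd I})"
  using disj_systemD(1) by blast

text \<open>The relevant part of a slice at height \<open>h'\<close> is a finite union of
  intervals, whose closure is a compact subset of the open set \<open>{f > h}\<close> for \<open>h < h'\<close>.\<close>

lemma open_css_ext_gt:
  fixes f :: "real ^ 'n::finite \<Rightarrow> real"
  assumes f: "continuous_on UNIV f" and "0 \<le> \<tau>" "0 \<le> c"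
  shows "open {x. ennreal c < css_ext k \<tau> f x}"
  unfolding open_dist
proof (intro ballI)
  fix x assume "x \<in> {x. ennreal c < css_ext k \<tau> f x}"
  then obtain h' where h': "c < h'" "h' \<in> css_levels k \<tau> f x" using css_ext_gtD assms(3) by blast
  obtain h where h: "c < h" "h < h'" using dense[OF h'(1)] by blast
  obtain S where S: "disj_system S" "sys_union S \<subseteq> slice k f x h'" "x $ k \<in> M_finite \<tau> S"
    using h'(2) by (auto simp: css_levels_def css_open_def)
  define C where "C = upd k x ` (\<Union>I\<in>S. {fst I..snd I})"
  have upd_c: "continuous_on A (upd k x)" for A by (intro continuous_intros)
  have "compact C"
    unfolding C_def using compact_closure_sys_union[OF S(1)] upd_c by (rule compact_continuous_image[rotated])
  moreover have "C \<subseteq> {y. h < f y}"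
  proof
    fix y assume "y \<in> C"
    then obtain I s where I: "I \<in> S" "fst I \<le> s" "s \<le> snd I" "y = upd k x s" by (auto simp: C_def)
    have cl: "closed {s. h' \<le> f (upd k x s)}"
      by (intro closed_Collect_le continuous_intros continuous_on_compose2[OF f upd_c]) auto
    have "{fst I<..<snd I} \<subseteq> {s. h' \<le> f (upd k x s)}"
    proof
      fix s assume "s \<in> {fst I<..<snd I}"
      then have "s \<in> sys_union S" using I(1) by (auto simp only: sys_union_iff greaterThanLessThan_iff)
      then show "s \<in> {s. h' \<le> f (upd k x s)}" using S(2) by (force simp: slice_upd)
    qed
    then have "closure {fst I<..<snd I} \<subseteq> {s. h' \<le> f (upd k x s)}" using cl by (simp add: closure_minimal)
    then show "y \<in> {y. h < f y}" using I h disj_systemD(2)[OF S(1) I(1)] by (force simp: closure_greaterThanLessThan)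
  qed
  moreover have "open {y. h < f y}" using f by (intro open_Collect_less continuous_intros)
  \<comment> \<open>The uniform radius \<open>e\<close> lets the one system \<open>S\<close>,
    thickened by the difference of the \<open>k\<close>-th coordinates, serve all points close to
    \<open>x\<close>.\<close>
  ultimately obtain e where e: "e > 0" "(\<Union>y\<in>C. ball y e) \<subseteq> {y. h < f y}"
    using compact_subset_open_imp_ball_epsilon_subset by metis
  have "ennreal c < css_ext k \<tau> f y" if "dist y x < e" for y
  proof -
    have "y $ k \<in> css_open \<tau> (slice k f y h)"
    proof (rule M_finite_css_open_near[OF assms(2) S(1,3), where r = "\<bar>y $ k - x $ k\<bar>"])
      fix s t assume s: "s \<in> sys_union S" and t: "\<bar>t - s\<bar> \<le> \<bar>y $ k - x $ k\<bar>"
      have "upd k x s \<in> C" using s unfolding C_def sys_union_iff by (force simp: less_imp_le)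
      moreover have "dist (upd k x s) (upd k y t) < e"
        using dist_upd_le[OF t] that by (simp add: dist_commute)
      ultimately have "upd k y t \<in> {y. h < f y}"
        by (intro subsetD[OF e(2)]) (auto simp del: upd_nth)
      then show "t \<in> slice k f y h" by (simp add: slice_upd)
    qed simp
    then have "h \<in> css_levels k \<tau> f y" using h assms(3) by (simp add: css_levels_def)
    from css_ext_ge[OF this] show ?thesis using h assms(3) by (metis ennreal_less_iff less_le_trans)
  qed
  then show "\<exists>e>0. \<forall>y. dist y x < e \<longrightarrow> y \<in> {x. ennreal c < css_ext k \<tau> f x}" using e(1) by blast
qed

lemma css_ext_measurable [measurable]:
  fixes f :: "real ^ 'n::finite \<Rightarrow> real"
  assumes "continuous_on UNIV f" "0 \<le> \<tau>"
  shows "css_ext k \<tau> f \<in> borel_measurable borel"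
proof (rule borel_measurableI_greater)
  fix y :: ennreal
  show "{x \<in> space borel. y < css_ext k \<tau> f x} \<in> sets borel"
    using open_css_ext_gt[OF assms] by (cases y) auto
qed

lemma emeasure_lines:
  fixes A :: "(real ^ 'n::finite) set"
  assumes [measurable]: "A \<in> sets borel"
  shows "emeasure lborel A =
    (\<integral>\<^sup>+ x. indicator {0..1} (x $ k) * emeasure lborel {s. upd k x s \<in> A} \<partial>lborel)"
proof -
  have "(\<integral>\<^sup>+ s. indicator A (upd k x s) \<partial>lborel) = emeasure lborel {s. upd k x s \<in> A}" for x
  proof -
    have "(\<integral>\<^sup>+ s. indicator A (upd k x s) \<partial>lborel) = (\<integral>\<^sup>+ s. indicator {s. upd k x s \<in> A} s \<partial>lborel)"
      by (intro nn_integral_cong) (simp add: indicator_def)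
    also have "\<dots> = emeasure lborel {s. upd k x s \<in> A}"
      by (intro nn_integral_indicator) simp
    finally show ?thesis .
  qed
  then show ?thesis using nn_integral_lines[of "indicator A" k] by simp
qed

lemma emeasure_superlevel_finite:
  fixes f :: "'a::euclidean_space \<Rightarrow> real"
  assumes [measurable]: "f \<in> borel_measurable borel" and "(\<integral>\<^sup>+ x. ennreal (f x) \<partial>lborel) < \<infinity>" "0 < l"
  shows "emeasure lborel {x. l < f x} < \<infinity>"
proof -
  have "ennreal l * emeasure lborel {x. l < f x} = (\<integral>\<^sup>+ x. ennreal l * indicator {x. l < f x} x \<partial>lborel)"
    by (simp add: nn_integral_cmult_indicator)
  also have "\<dots> \<le> (\<integral>\<^sup>+ x. ennreal (f x) \<partial>lborel)"
    by (intro nn_integral_mono) (auto simp: indicator_def ennreal_leI)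
  finally have "ennreal l * emeasure lborel {x. l < f x} < \<infinity>" using assms(2) by (simp add: le_less_trans)
  then show ?thesis using assms(3) by (auto simp: ennreal_mult_less_top)
qed

lemma open_slice: "continuous_on UNIV f \<Longrightarrow> open (slice k f x h)"
  unfolding slice_upd
  by (intro open_Collect_less continuous_intros) (auto intro!: continuous_on_compose2[of UNIV f] continuous_intros)

lemma emeasure_slice_finite:
  assumes "continuous_on UNIV f" "(\<integral>\<^sup>+ s. ennreal (f (upd k x s)) \<partial>lborel) < \<infinity>" "0 < h"
  shows "emeasure lborel (slice k f x h) < \<infinity>"
  using emeasure_superlevel_finite[of "\<lambda>s. f (upd k x s)"] borel_measurable_continuous_onI[OF assms(1)] assms(2,3)
  by (simp add: slice_upd)

text \<open>On each line this is the estimate for differences of symmetrized sets; integrating over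
  the lines gives it in space. The lines with infinite integral of \<open>v\<close> form a null
  set.\<close>

lemma emeasure_css_ext_levels:
  fixes u v :: "real ^ 'n::finite \<Rightarrow> real"
  assumes u: "continuous_on UNIV u" and v: "continuous_on UNIV v"
    and fin: "(\<integral>\<^sup>+ x. ennreal (v x) \<partial>lborel) < \<infinity>"
    and "0 \<le> \<tau>" "0 < l" "0 \<le> c"
  shows "emeasure lborel {x. ennreal (l + c) < css_ext k \<tau> v x \<and> \<not> ennreal l < css_ext k \<tau> u x}
    \<le> emeasure lborel {x. l + c < v x \<and> \<not> l < u x}" (is "emeasure _ ?A \<le> emeasure _ ?B")
proof -
  note [measurable] = borel_measurable_continuous_onI[OF u] borel_measurable_continuous_onI[OF v]
    css_ext_measurable[OF u \<open>0 \<le> \<tau>\<close>] css_ext_measurable[OF v \<open>0 \<le> \<tau>\<close>]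
  have A [measurable]: "?A \<in> sets borel" by measurable
  \<comment> \<open>A point where \<open>css_ext\<close> of \<open>u\<close> is at most
    \<open>l\<close> avoids only the symmetrized slices at heights strictly above \<open>l\<close>;
    hence the height is raised a little and lowered again in the limit.\<close>
  define B where "B j = {x. l + c < v x \<and> \<not> l + 1 / real (Suc j) < u x}" for j :: nat
  have B [measurable]: "B j \<in> sets borel" for j unfolding B_def by measurable
  have le: "emeasure lborel ?A \<le> emeasure lborel (B j)" for j
  proof -
    let ?l = "l + 1 / real (Suc j)"
    have l: "l < ?l" by simp
    have *: "indicator {0..1} (x $ k) * emeasure lborel {s. upd k x s \<in> ?A}
        \<le> indicator {0..1} (x $ k) * emeasure lborel {s. upd k x s \<in> B j}"
      if *: "x $ k \<in> {0..1} \<longrightarrow> (\<integral>\<^sup>+ s. ennreal (v (upd k x s)) \<partial>lborel) < \<infinity>" for x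
    proof (cases "x $ k \<in> {0..1}")
      case True
      have "{s. upd k x s \<in> ?A} \<subseteq> css_open \<tau> (slice k v x (l + c)) - css_open \<tau> (slice k u x ?l)"
      proof
        fix s assume s: "s \<in> {s. upd k x s \<in> ?A}"
        then have "s \<in> css_open \<tau> (slice k v x (l + c))"
          using css_ext_gt_imp[of "l + c" k \<tau> v "upd k x s"] assms(5,6) by simp
        moreover have "s \<notin> css_open \<tau> (slice k u x ?l)"
        proof
          assume "s \<in> css_open \<tau> (slice k u x ?l)"
          then have "?l \<in> css_levels k \<tau> u (upd k x s)" using l assms(5) by (simp add: css_levels_def)
          from css_ext_ge[OF this] have "ennreal l < css_ext k \<tau> u (upd k x s)"
            using l assms(5) by (metis ennreal_less_iff less_le_trans less_imp_le)
          then show False using s by simp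
        qed
        ultimately show "s \<in> css_open \<tau> (slice k v x (l + c)) - css_open \<tau> (slice k u x ?l)" by simp
      qed
      then have "emeasure lborel {s. upd k x s \<in> ?A} \<le>
          emeasure lborel (css_open \<tau> (slice k v x (l + c)) - css_open \<tau> (slice k u x ?l))"
        using open_css_open[OF \<open>0 \<le> \<tau>\<close>] by (intro emeasure_mono) auto
      also have "\<dots> \<le> emeasure lborel (slice k v x (l + c) - slice k u x ?l)"
        using True * assms(5,6) emeasure_slice_finite[OF v]
        by (intro emeasure_css_open_Diff open_slice u v assms(4)) auto
      also have "slice k v x (l + c) - slice k u x ?l = {s. upd k x s \<in> B j}"
        by (auto simp: slice_upd B_def)
      finally show ?thesis by (intro mult_left_mono) auto
    qed simp
    then show ?thesis
      unfolding emeasure_lines[OF A, of k] emeasure_lines[OF B[of j], of k]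
    proof (intro nn_integral_mono_AE)
      have "AE x in lborel. x $ k \<in> {0..1} \<longrightarrow> (\<integral>\<^sup>+ s. ennreal (v (upd k x s)) \<partial>lborel) < \<infinity>"
        using fin by (intro AE_lines(1)) measurable
      then show "AE x in lborel. indicator {0..1} (x $ k) * emeasure lborel {s. upd k x s \<in> ?A}
          \<le> indicator {0..1} (x $ k) * emeasure lborel {s. upd k x s \<in> B j}"
        by (rule AE_mp) (use * in simp)
    qed
  qed
  have "decseq B"
  proof (rule decseq_SucI)
    fix j
    have "1 / real (Suc (Suc j)) \<le> 1 / real (Suc j)" by (simp add: field_simps)
    then show "B (Suc j) \<subseteq> B j" unfolding B_def by auto
  qed
  \<comment> \<open>Continuity from above needs finite measure; the superlevel set of
    \<open>v\<close> at the positive height \<open>l + c\<close> provides it.\<close>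
  moreover have "emeasure lborel (B j) \<noteq> \<infinity>" for j
  proof -
    have "emeasure lborel (B j) \<le> emeasure lborel {x. l + c < v x}"
      by (intro emeasure_mono) (auto simp: B_def)
    also have "\<dots> < \<infinity>" using emeasure_superlevel_finite[of v "l + c"] fin assms(5,6) by simp
    finally show ?thesis by simp
  qed
  ultimately have "(INF j. emeasure lborel (B j)) = emeasure lborel (\<Inter>j. B j)"
    using B by (intro INF_emeasure_decseq) auto
  moreover have "(\<Inter>j. B j) = ?B"
  proof -
    have "u x \<le> l" if "\<And>j. \<not> l + 1 / real (Suc j) < u x" for x
    proof (rule ccontr)
      assume "\<not> u x \<le> l"
      then obtain j where "1 / real (Suc j) < u x - l" using nat_approx_posE[of "u x - l"] by auto
      then show False using that[of j] by simp
    qed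
    moreover have "\<not> l + 1 / real (Suc j) < u x" if "u x \<le> l" for x j
    proof -
      have "0 < 1 / real (Suc j)" by simp
      then show ?thesis using that by linarith
    qed
    ultimately show ?thesis unfolding B_def by (auto simp: not_less)
  qed
  moreover have "emeasure lborel ?A \<le> (INF j. emeasure lborel (B j))"
    by (intro INF_greatest le)
  ultimately show ?thesis by simp
qed


text \<open>Layer cake: the positive part of \<open>v x - u x - c\<close> is the length of the set
  of heights \<open>l\<close> with \<open>u x \<le> l\<close> and \<open>l < v x - c\<close>. Since
  \<open>u\<close> is nonnegative, positive heights are enough.\<close>

lemma nn_integral_pos_part_layers:
  fixes u v :: "'a::euclidean_space \<Rightarrow> real"
  assumes [measurable]: "u \<in> borel_measurable borel" "v \<in> borel_measurable borel" and u: "\<And>x. 0 \<le> u x"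
  shows "(\<integral>\<^sup>+ x. ennreal (v x - u x - c) \<partial>lborel) =
    (\<integral>\<^sup>+ l. indicator {0<..} l * emeasure lborel {x. l + c < v x \<and> \<not> l < u x} \<partial>lborel)"
proof -
  have layer: "ennreal (v x - u x - c) =
      (\<integral>\<^sup>+ l. indicator {0<..} l * indicator {x. l + c < v x \<and> \<not> l < u x} x \<partial>lborel)" for x
  proof -
    have "(\<integral>\<^sup>+ l. indicator {0<..} l * indicator {x. l + c < v x \<and> \<not> l < u x} x \<partial>lborel) =
        (\<integral>\<^sup>+ l. indicator {l. 0 < l \<and> l + c < v x \<and> \<not> l < u x} l \<partial>lborel)"
      by (rule nn_integral_cong) (simp add: indicator_def)
    also have "\<dots> = emeasure lborel {l. 0 < l \<and> l + c < v x \<and> \<not> l < u x}"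
      by (rule nn_integral_indicator) measurable
    also have "\<dots> = ennreal (v x - u x - c)"
    proof (cases "u x = 0")
      case True
      then have "{l. 0 < l \<and> l + c < v x \<and> \<not> l < u x} = {0<..<v x - c}" by auto
      then show ?thesis using True unfolding \<open>_ = {0<..<v x - c}\<close>
        by (cases "0 \<le> v x - c") (simp_all add: ennreal_neg)
    next
      case False
      then have "{l. 0 < l \<and> l + c < v x \<and> \<not> l < u x} = {u x..<v x - c}" using u[of x] by auto
      then show ?thesis unfolding \<open>_ = {u x..<v x - c}\<close>
        by (cases "u x \<le> v x - c") (simp_all add: ennreal_neg algebra_simps)
    qed
    finally show ?thesis by simp
  qed
  have "(\<integral>\<^sup>+ x. ennreal (v x - u x - c) \<partial>lborel) = (\<integral>\<^sup>+ l. (\<integral>\<^sup>+ x.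
      indicator {0<..} l * indicator {x. l + c < v x \<and> \<not> l < u x} x \<partial>lborel) \<partial>lborel)"
    unfolding layer by (intro lborel_pair.Fubini') measurable
  also have "\<dots> = (\<integral>\<^sup>+ l. indicator {0<..} l * emeasure lborel {x. l + c < v x \<and> \<not> l < u x} \<partial>lborel)"
    by (intro nn_integral_cong) (simp add: nn_integral_cmult)
  finally show ?thesis .
qed

lemma css_ext_zero [simp]: "css_ext k \<tau> (\<lambda>_. 0) x = 0"
proof -
  have "css_levels k \<tau> (\<lambda>_. 0) x = {}" by (auto simp: css_levels_def slice_def)
  then show ?thesis by (simp add: css_ext_def)
qed

text \<open>The level estimate against the zero function. Finiteness of \<open>css_ext\<close> is
  only a consequence, so the layer formula is proved for values in \<open>ennreal\<close>.\<close>

lemma nn_integral_css_ext_le: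
  fixes v :: "real ^ 'n::finite \<Rightarrow> real"
  assumes v: "continuous_on UNIV v" and fin: "(\<integral>\<^sup>+ x. ennreal (v x) \<partial>lborel) < \<infinity>" and "0 \<le> \<tau>"
  shows "(\<integral>\<^sup>+ x. css_ext k \<tau> v x \<partial>lborel) \<le> (\<integral>\<^sup>+ x. ennreal (v x) \<partial>lborel)"
proof -
  note [measurable] = borel_measurable_continuous_onI[OF v] css_ext_measurable[OF v \<open>0 \<le> \<tau>\<close>]
  have layer: "y = (\<integral>\<^sup>+ l. indicator {0<..} l * indicator {l. ennreal l < y} l \<partial>lborel)" for y :: ennreal
  proof -
    have "(\<integral>\<^sup>+ l. indicator {0<..} l * indicator {l. ennreal l < y} l \<partial>lborel) =
        (\<integral>\<^sup>+ l. indicator {l. 0 < l \<and> ennreal l < y} l \<partial>lborel)"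
      by (rule nn_integral_cong) (simp add: indicator_def)
    also have "\<dots> = emeasure lborel {l. 0 < l \<and> ennreal l < y}"
      by (rule nn_integral_indicator) measurable
    also have "\<dots> = y"
    proof (cases y)
      case (real r)
      then have "{l. 0 < l \<and> ennreal l < y} = {0<..<r}" by (auto simp: ennreal_less_iff)
      then show ?thesis using real by simp
    next
      case top
      have "ennreal r < emeasure lborel {l. 0 < l \<and> ennreal l < y}" if "0 \<le> r" for r
      proof -
        have "ennreal r < emeasure lborel {0<..<r + 1}" using that by (simp add: ennreal_less_iff)
        also have "\<dots> \<le> emeasure lborel {l. 0 < l \<and> ennreal l < y}"
          using top by (intro emeasure_mono) auto
        finally show ?thesis .
      qed
      then show ?thesis using top by (metis ennreal_cases less_irrefl)
    qed
    finally show ?thesis by simp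
  qed
  have "(\<integral>\<^sup>+ x. css_ext k \<tau> v x \<partial>lborel) =
      (\<integral>\<^sup>+ x. (\<integral>\<^sup>+ l. indicator {0<..} l * indicator {l. ennreal l < css_ext k \<tau> v x} l \<partial>lborel) \<partial>lborel)"
    using layer by simp
  also have "\<dots> = (\<integral>\<^sup>+ l. (\<integral>\<^sup>+ x. indicator {0<..} l * indicator {x. ennreal l < css_ext k \<tau> v x} x \<partial>lborel) \<partial>lborel)"
    by (subst lborel_pair.Fubini') (auto simp: indicator_def)
  also have "\<dots> = (\<integral>\<^sup>+ l. indicator {0<..} l * emeasure lborel {x. ennreal l < css_ext k \<tau> v x} \<partial>lborel)"
    by (intro nn_integral_cong) (simp add: nn_integral_cmult)
  also have "\<dots> \<le> (\<integral>\<^sup>+ l. indicator {0<..} l * emeasure lborel {x. l < v x} \<partial>lborel)"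
  proof (rule nn_integral_mono)
    fix l
    show "indicator {0<..} l * emeasure lborel {x. ennreal l < css_ext k \<tau> v x}
      \<le> indicator {0<..} l * emeasure lborel {x. l < v x}"
      using emeasure_css_ext_levels[of "\<lambda>_. 0" v \<tau> l 0 k] v fin \<open>0 \<le> \<tau>\<close>
      by (auto simp: indicator_def)
  qed
  also have "\<dots> = (\<integral>\<^sup>+ x. ennreal (v x) \<partial>lborel)"
  proof -
    have "{x. l < v x \<and> \<not> l < 0} = {x. l < v x}" if "0 < l" for l using that by auto
    then show ?thesis
      using nn_integral_pos_part_layers[of "\<lambda>_. 0" v 0]
      by (auto intro!: nn_integral_cong simp: indicator_def)
  qed
  finally show ?thesis .
qed

lemma AE_css_ext_finite:
  fixes v :: "real ^ 'n::finite \<Rightarrow> real"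
  assumes v: "continuous_on UNIV v" and fin: "(\<integral>\<^sup>+ x. ennreal (v x) \<partial>lborel) < \<infinity>" and "0 \<le> \<tau>"
  shows "AE x in lborel. css_ext k \<tau> v x \<noteq> \<infinity>"
  using nn_integral_css_ext_le[OF assms, of k] fin css_ext_measurable[OF v \<open>0 \<le> \<tau>\<close>]
  by (intro nn_integral_PInf_AE) (auto simp: less_top[symmetric] top_unique)

text \<open>The difference makes sense only for finite values, so it is taken after
  \<open>enn2real\<close>; off a null set this changes neither level condition. The level estimates
  are then integrated over the heights.\<close>

lemma css_ext_contraction:
  fixes u v :: "real ^ 'n::finite \<Rightarrow> real"
  assumes u: "continuous_on UNIV u" and v: "continuous_on UNIV v" and nn: "\<And>x. 0 \<le> u x"
    and fin: "(\<integral>\<^sup>+ x. ennreal (u x) \<partial>lborel) < \<infinity>" "(\<integral>\<^sup>+ x. ennreal (v x) \<partial>lborel) < \<infinity>"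
    and "0 \<le> \<tau>" "0 \<le> c"
  shows "(\<integral>\<^sup>+ x. ennreal (enn2real (css_ext k \<tau> v x) - enn2real (css_ext k \<tau> u x) - c) \<partial>lborel)
    \<le> (\<integral>\<^sup>+ x. ennreal (v x - u x - c) \<partial>lborel)"
proof -
  note [measurable] = borel_measurable_continuous_onI[OF u] borel_measurable_continuous_onI[OF v]
    css_ext_measurable[OF u \<open>0 \<le> \<tau>\<close>] css_ext_measurable[OF v \<open>0 \<le> \<tau>\<close>]
  have "emeasure lborel {x. l + c < enn2real (css_ext k \<tau> v x) \<and> \<not> l < enn2real (css_ext k \<tau> u x)}
      \<le> emeasure lborel {x. l + c < v x \<and> \<not> l < u x}" if "0 < l" for l
  proof -
    have "emeasure lborel {x. l + c < enn2real (css_ext k \<tau> v x) \<and> \<not> l < enn2real (css_ext k \<tau> u x)}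
        \<le> emeasure lborel {x. ennreal (l + c) < css_ext k \<tau> v x \<and> \<not> ennreal l < css_ext k \<tau> u x}"
    proof (intro emeasure_mono_AE)
      show "AE x in lborel. x \<in> {x. l + c < enn2real (css_ext k \<tau> v x) \<and> \<not> l < enn2real (css_ext k \<tau> u x)}
          \<longrightarrow> x \<in> {x. ennreal (l + c) < css_ext k \<tau> v x \<and> \<not> ennreal l < css_ext k \<tau> u x}"
        using AE_css_ext_finite[OF u fin(1) \<open>0 \<le> \<tau>\<close>, of k] AE_css_ext_finite[OF v fin(2) \<open>0 \<le> \<tau>\<close>, of k]
      proof eventually_elim
        case (elim x)
        then obtain a b where "css_ext k \<tau> u x = ennreal a" "0 \<le> a" "css_ext k \<tau> v x = ennreal b" "0 \<le> b"
          by (metis ennreal_cases infinity_ennreal_def)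
        then show ?case using that assms(7)
          by (auto simp: ennreal_less_iff simp del: ennreal_plus)
      qed
    qed measurable
    also have "\<dots> \<le> emeasure lborel {x. l + c < v x \<and> \<not> l < u x}"
      using emeasure_css_ext_levels[OF u v fin(2) \<open>0 \<le> \<tau>\<close> that \<open>0 \<le> c\<close>] .
    finally show ?thesis .
  qed
  then show ?thesis
    by (subst (1 2) nn_integral_pos_part_layers)
      (auto intro!: nn_integral_mono nn split: split_indicator)
qed

section \<open>Invariance under rigid motions\<close>

text \<open>An isometry turns translations into translations, so the image measure is translation
  invariant, and by uniqueness of such measures it is a multiple of Lebesgue measure. The unit ball
  shows that the factor is 1.\<close>

lemma lborel_isometry_invariant:
  fixes T :: "'a::euclidean_space \<Rightarrow> 'a"
  assumes bij: "bij T" and iso: "\<And>x y. dist (T x) (T y) = dist x y"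
  shows "distr lborel borel T = lborel"
proof (rule measure_eqI)
  have cont: "continuous_on UNIV T"
    unfolding continuous_on_iff using iso by auto
  then have [measurable]: "T \<in> borel_measurable borel" by (rule borel_measurable_continuous_onI)
  define R where "R x = T x - T 0" for x
  have lin: "linear R"
    by (rule isometry_linear) (auto simp: R_def dist_norm iso[unfolded dist_norm])
  define m where "m = distr lborel borel T"
  have sets_m [measurable_cong]: "sets m = sets borel" by (simp add: m_def)
  interpret m: sigma_finite_measure m
  proof
    show "\<exists>A. countable A \<and> A \<subseteq> sets m \<and> \<Union>A = space m \<and> (\<forall>a\<in>A. emeasure m a \<noteq> \<infinity>)"
    proof (intro exI conjI)
      let ?A = "range (\<lambda>n::nat. cball (T 0) (real n))"
      show "countable ?A" "?A \<subseteq> sets m" by (auto simp: sets_m)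
      show "\<Union> ?A = space m" by (auto simp: m_def intro: real_arch_simple)
      have "T -` cball (T 0) r = cball 0 r" for r by (auto simp: iso)
      then show "\<forall>a\<in>?A. emeasure m a \<noteq> \<infinity>"
        by (auto simp: m_def emeasure_distr emeasure_cball)
    qed
  qed
  have trans: "(\<integral>\<^sup>+ x. F (x + y) \<partial>m) = (\<integral>\<^sup>+ x. F x \<partial>m)" if [measurable]: "F \<in> borel_measurable borel" for F y
  proof -
    obtain z where z: "T z = T 0 + y" using bij by (metis bij_pointE)
    have "T (z + x) = T x + y" for x
    proof -
      have "R (z + x) = R z + R x" by (rule linear_add[OF lin])
      then show ?thesis using z by (simp add: R_def algebra_simps)
    qed
    then show ?thesis
      using nn_integral_lborel_translate[of "\<lambda>x. F (T x)" z] by (simp add: m_def nn_integral_distr)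
  qed
  interpret p: pair_sigma_finite m "lborel :: 'a measure" ..
  define B where "B = ball (0::'a) 1"
  have [measurable]: "B \<in> sets borel" by (simp add: B_def)
  have mB: "emeasure m B = emeasure lborel B"
  proof -
    obtain z where z: "T z = 0" using bij by (metis bij_pointE)
    have "x \<in> T -` B \<longleftrightarrow> x \<in> ball z 1" for x
      using iso[of z x] by (simp add: B_def z)
    then have "T -` B = ball z 1" by blast
    then have "emeasure m B = emeasure lborel (ball z 1)"
      by (simp add: m_def emeasure_distr)
    also have "\<dots> = emeasure lborel B"
      by (simp add: B_def emeasure_ball)
    finally show ?thesis .
  qed
  show "sets (distr lborel borel T) = sets lborel" by simp
  fix A assume "A \<in> sets (distr lborel borel T)"
  then have [measurable]: "A \<in> sets borel" by simp
  \<comment> \<open>Both products are the measure of the set of pairs \<open>(x, y)\<close> with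
    \<open>x\<close> in \<open>A\<close> and \<open>y - x\<close> in \<open>B\<close>: once
    integrated over \<open>y\<close> first, once over \<open>x\<close> first, with \<open>x\<close>
    replaced by \<open>x + y\<close> and the symmetry of the ball.\<close>
  have "emeasure m A * emeasure lborel B = (\<integral>\<^sup>+ x. indicator A x * emeasure lborel B \<partial>m)"
    by (simp add: nn_integral_multc sets_m)
  also have "\<dots> = (\<integral>\<^sup>+ x. (\<integral>\<^sup>+ y. indicator A x * indicator B (- x + y) \<partial>lborel) \<partial>m)"
  proof (rule nn_integral_cong)
    fix x
    show "indicator A x * emeasure lborel B = (\<integral>\<^sup>+ y. indicator A x * indicator B (- x + y) \<partial>lborel)"
      using nn_integral_lborel_translate[of "indicator B" "- x"] by (simp add: nn_integral_cmult)
  qed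
  also have "\<dots> = (\<integral>\<^sup>+ y. (\<integral>\<^sup>+ x. indicator A x * indicator B (- x + y) \<partial>m) \<partial>lborel)"
    by (intro p.Fubini'[symmetric]) measurable
  also have "\<dots> = (\<integral>\<^sup>+ y. (\<integral>\<^sup>+ x. indicator A (x + y) * indicator B x \<partial>m) \<partial>lborel)"
  proof (rule nn_integral_cong)
    fix y
    have [simp]: "indicator B (- x) = (indicator B x :: ennreal)" for x by (simp add: indicator_def B_def)
    show "(\<integral>\<^sup>+ x. indicator A x * indicator B (- x + y) \<partial>m) = (\<integral>\<^sup>+ x. indicator A (x + y) * indicator B x \<partial>m)"
      using trans[of "\<lambda>x. indicator A x * indicator B (- x + y)" y] by simp
  qed
  also have "\<dots> = (\<integral>\<^sup>+ x. (\<integral>\<^sup>+ y. indicator A (x + y) * indicator B x \<partial>lborel) \<partial>m)"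
    by (intro p.Fubini') measurable
  also have "\<dots> = (\<integral>\<^sup>+ x. emeasure lborel A * indicator B x \<partial>m)"
  proof (rule nn_integral_cong)
    fix x
    show "(\<integral>\<^sup>+ y. indicator A (x + y) * indicator B x \<partial>lborel) = emeasure lborel A * indicator B x"
      using nn_integral_lborel_translate[of "indicator A" x] by (simp add: nn_integral_multc)
  qed
  also have "\<dots> = emeasure lborel A * emeasure lborel B"
    by (simp add: nn_integral_cmult sets_m mB)
  finally have "emeasure m A * emeasure lborel B = emeasure lborel A * emeasure lborel B" .
  moreover have "emeasure lborel B \<noteq> 0" "emeasure lborel B \<noteq> \<infinity>"
    unfolding B_def using unit_ball_vol_pos[of "real DIM('a)"]
    by (simp_all add: emeasure_ball del: unit_ball_vol_pos)
  ultimately show "emeasure (distr lborel borel T) A = emeasure lborel A"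
    unfolding m_def[symmetric] by (metis infinity_ennreal_def mult_divide_eq_ennreal)
qed


lemma rigid_motion_inv: "rigid_motion T \<Longrightarrow> rigid_motion (inv T)"
  unfolding rigid_motion_def
  by (metis bij_imp_bij_inv bij_inv_eq_iff)

lemma rigid_motion_continuous: "rigid_motion T \<Longrightarrow> continuous_on A T"
  unfolding rigid_motion_def continuous_on_iff by auto

lemma rigid_motion_lborel: "rigid_motion T \<Longrightarrow> distr lborel borel T = lborel"
  unfolding rigid_motion_def by (intro lborel_isometry_invariant) auto

lemma rigid_motion_measurable: "rigid_motion T \<Longrightarrow> T \<in> borel_measurable borel"
  using rigid_motion_continuous by (intro borel_measurable_continuous_onI)

lemma nn_integral_rigid_motion:
  assumes T: "rigid_motion T" and [measurable]: "F \<in> borel_measurable borel"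
  shows "(\<integral>\<^sup>+ x. F (T x) \<partial>lborel) = (\<integral>\<^sup>+ x. F x \<partial>lborel)"
proof -
  note [measurable] = rigid_motion_measurable[OF T]
  have "(\<integral>\<^sup>+ x. F x \<partial>lborel) = (\<integral>\<^sup>+ x. F x \<partial>distr lborel borel T)"
    using rigid_motion_lborel[OF T] by simp
  also have "\<dots> = (\<integral>\<^sup>+ x. F (T x) \<partial>lborel)"
    by (subst nn_integral_distr) simp_all
  finally show ?thesis by simp
qed

section \<open>The symmetrization as an operator on functions\<close>

definition nice :: "(real ^ 'n::finite \<Rightarrow> real) \<Rightarrow> bool" where
  "nice f \<longleftrightarrow> (\<forall>x. 0 \<le> f x) \<and> continuous_on UNIV f \<and> integrable lborel f"

lemma niceD:
  assumes "nice f"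
  shows "0 \<le> f x" "continuous_on UNIV f" "integrable lborel f" "f \<in> borel_measurable borel"
    "(\<integral>\<^sup>+ x. ennreal (f x) \<partial>lborel) < \<infinity>"
  using assms borel_measurable_continuous_onI[of f]
  by (auto simp: nice_def integrable_iff_bounded)

lemma nice_rigid_motion:
  assumes "nice f" "rigid_motion T"
  shows "nice (f \<circ> T)"
  unfolding nice_def
proof (intro conjI allI)
  show "0 \<le> (f \<circ> T) x" for x using niceD(1)[OF assms(1)] by simp
  show c: "continuous_on UNIV (f \<circ> T)"
    using rigid_motion_continuous[OF assms(2)] niceD(2)[OF assms(1)]
    by (intro continuous_on_compose) (auto intro: continuous_on_subset)
  have "(\<integral>\<^sup>+ x. ennreal (norm ((f \<circ> T) x)) \<partial>lborel) = (\<integral>\<^sup>+ x. ennreal (f x) \<partial>lborel)"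
    using nn_integral_rigid_motion[OF assms(2), of "\<lambda>x. ennreal (f x)"] niceD(1,4)[OF assms(1)]
    by simp
  then show "integrable lborel (f \<circ> T)"
    using c niceD(5)[OF assms(1)] by (simp add: integrable_iff_bounded borel_measurable_continuous_onI)
qed

lemma css_ext_bounded:
  assumes "\<And>x. f x \<le> B"
  shows "css_ext k \<tau> f x \<le> ennreal B"
proof -
  have "slice k f x h = {}" if "B \<le> h" for h
    using assms that by (force simp: slice_def not_less intro: order_trans)
  then have "h < B" if "h \<in> css_levels k \<tau> f x" for h
    using that by (cases "h < B") (auto simp: css_levels_def)
  then have sub: "css_levels k \<tau> f x \<subseteq> {0..<B}" by (auto simp: css_levels_def)
  have "css_ext k \<tau> f x \<le> emeasure lborel {0..<B}"
    unfolding css_ext_def using sub by (intro emeasure_mono) auto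
  also have "\<dots> = ennreal B" by (cases "0 \<le> B") (auto simp: ennreal_neg)
  finally show ?thesis .
qed

text \<open>At positive heights the slices have finite measure, hence bounded components, and there
  \<open>M \<tau>\<close> is \<open>css_open \<tau>\<close>. The height 0 is a single point of the
  layer integral.\<close>

lemma css_coord_eq:
  fixes f :: "real ^ 'n::finite \<Rightarrow> real"
  assumes f: "continuous_on UNIV f" and \<tau>: "0 \<le> \<tau>" and b: "\<And>h. 0 < h \<Longrightarrow> emeasure lborel (slice k f x h) < \<infinity>"
  shows "css_coord k \<tau> f x = enn2real (css_ext k \<tau> f x)"
proof -
  have M: "M \<tau> (slice k f x h) = css_open \<tau> (slice k f x h)" if "0 < h" for h
    using M_eq_css_open[OF open_slice[OF f] bounded_components_finite_measure[OF open_slice[OF f] b[OF that]] \<tau>] .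
  define A where "A = {h. 0 \<le> h \<and> x $ k \<in> M \<tau> (slice k f x h)}"
  have AD: "h \<in> A \<longleftrightarrow> h \<in> css_levels k \<tau> f x" if "h \<noteq> 0" for h
    using that M by (auto simp: A_def css_levels_def)
  have "A = (css_levels k \<tau> f x - {0}) \<union> (A \<inter> {0})" using AD by auto
  moreover have "A \<inter> {0} \<in> sets borel" by (cases "0 \<in> A") auto
  ultimately have [measurable]: "A \<in> sets borel"
    by (metis borel_singleton css_levels_measurable sets.Diff sets.Un sets.empty_sets)
  have "css_coord k \<tau> f x = (LINT h|lborel. indicator A h)"
    unfolding css_coord_def set_lebesgue_integral_def
    by (intro Bochner_Integration.integral_cong) (auto simp: A_def indicator_def)
  also have "\<dots> = enn2real (emeasure lborel A)"
    by (simp add: measure_def)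
  also have "emeasure lborel A = emeasure lborel (css_levels k \<tau> f x)"
    using AE_lborel_singleton[of 0] AD by (intro emeasure_eq_AE) auto
  finally show ?thesis by (simp add: css_ext_def)
qed

text \<open>For Lipschitz functions no exceptional lines occur: a slice at height \<open>h\<close> is contained in
  the slices at height \<open>h / 2\<close> along all neighbouring parallel lines.\<close>

lemma css_coord_lipschitz:
  fixes f :: "real ^ 'n::finite \<Rightarrow> real"
  assumes f: "nice f" and \<tau>: "0 \<le> \<tau>" and L: "\<And>x y. \<bar>f x - f y\<bar> \<le> L * dist x y" "0 < L"
  shows "css_coord k \<tau> f x = enn2real (css_ext k \<tau> f x)" "css_ext k \<tau> f x < \<infinity>"
proof -
  note f' = niceD[OF f]
  note [measurable] = f'(4)
  have AE1: "AE x in lborel. (\<integral>\<^sup>+ s. ennreal (f (upd k x s)) \<partial>lborel) < \<infinity>"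
    using f'(5) by (intro AE_lines(2)) measurable
  have AE2: "AE x in lborel. css_ext k \<tau> f x \<noteq> \<infinity>"
    using AE_css_ext_finite[OF f'(2,5) \<tau>] .
  \<comment> \<open>Balls have positive measure, so a property that holds almost everywhere holds at
    points arbitrarily close to \<open>x\<close>.\<close>
  have ex: "\<exists>y\<in>ball x r. P y" if "AE y in lborel. P y" "0 < r" for P and r :: real and x :: "real ^ 'n"
  proof (rule ccontr)
    assume "\<not> ?thesis"
    then have "AE y in lborel. y \<notin> ball x r" using that(1) by (auto elim: eventually_mono)
    then have "ball x r \<in> null_sets lborel" by (subst AE_iff_null_sets) auto
    then have "emeasure lborel (ball x r) = 0" by (rule null_setsD1)
    then show False using that(2) unit_ball_vol_pos[of "real DIM(real ^ 'n)"]
      by (simp add: emeasure_ball del: unit_ball_vol_pos)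
  qed
  have "emeasure lborel (slice k f x h) < \<infinity>" if "0 < h" for h
  proof -
    \<comment> \<open>Within this radius \<open>f\<close> changes by less than \<open>h / 2\<close>,
      so the slice through \<open>x\<close> at height \<open>h\<close> lies in a slice of finite
      measure at height \<open>h / 2\<close>.\<close>
    have "0 < h / (2 * L)" using that L(2) by simp
    then obtain y where y: "dist x y < h / (2 * L)" "(\<integral>\<^sup>+ s. ennreal (f (upd k y s)) \<partial>lborel) < \<infinity>"
      using ex[OF AE1, of "h / (2 * L)" x] by auto
    have "slice k f x h \<subseteq> slice k f y (h / 2)"
    proof
      fix s assume s: "s \<in> slice k f x h"
      have "\<bar>f (upd k x s) - f (upd k y s)\<bar> \<le> L * dist (upd k x s) (upd k y s)" by (rule L)
      also have "\<dots> \<le> L * dist x y" using L(2) by (intro mult_left_mono dist_upd_le) auto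
      also have "\<dots> < L * (h / (2 * L))" using L(2) y(1) by (intro mult_strict_left_mono) auto
      also have "\<dots> = h / 2" using L(2) by simp
      finally have lt: "\<bar>f (upd k x s) - f (upd k y s)\<bar> < h / 2" .
      have "h < f (upd k x s)" using s by (simp add: slice_upd)
      then have "h / 2 < f (upd k y s)" using lt by linarith
      then show "s \<in> slice k f y (h / 2)" by (simp add: slice_upd)
    qed
    then have "emeasure lborel (slice k f x h) \<le> emeasure lborel (slice k f y (h / 2))"
      using open_slice[OF f'(2)] by (intro emeasure_mono) auto
    also have "\<dots> < \<infinity>" using emeasure_slice_finite[OF f'(2) y(2)] that by simp
    finally show ?thesis .
  qed
  then show "css_coord k \<tau> f x = enn2real (css_ext k \<tau> f x)" using css_coord_eq[OF f'(2) \<tau>] by blast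
  \<comment> \<open>Finiteness spreads from a nearby good point, since within distance 1 the values
    of \<open>f\<close> differ by at most \<open>L\<close>.\<close>
  obtain y where y: "dist x y < 1" "css_ext k \<tau> f y \<noteq> \<infinity>" using ex[OF AE2, of 1 x] by auto
  have "f y \<le> f x + L" if "dist x y < 1" for x y
  proof -
    have "L * dist x y \<le> L * 1" using that L(2) by (intro mult_left_mono) auto
    then show ?thesis using L(1)[of x y] by linarith
  qed
  then have "css_ext k \<tau> f x \<le> css_ext k \<tau> f y + ennreal L"
    using L(2) \<tau> y(1) by (intro css_ext_near[where r = 1]) (auto simp: dist_commute)
  also have "\<dots> < \<infinity>" using y(2) by (simp add: less_top[symmetric])
  finally show "css_ext k \<tau> f x < \<infinity>" .
qed

text \<open>A version of the symmetrization built on \<open>css_ext\<close>, so that its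
  inequalities hold without regard to exceptional lines; infinite values become 0 through
  \<open>enn2real\<close>.\<close>

definition css_op :: "'n::finite \<Rightarrow> (real ^ 'n \<Rightarrow> real ^ 'n) \<Rightarrow> real \<Rightarrow>
    (real ^ 'n \<Rightarrow> real) \<Rightarrow> real ^ 'n \<Rightarrow> real" where
  "css_op k T \<tau> f x = enn2real (css_ext k \<tau> (f \<circ> inv T) (T x))"

lemma css_op_nonneg [simp]: "0 \<le> css_op k T \<tau> f x"
  by (simp add: css_op_def)

context
  fixes T :: "real ^ 'n::finite \<Rightarrow> real ^ 'n" and \<tau> :: real and k :: 'n
  assumes T: "rigid_motion T" and \<tau>: "0 \<le> \<tau>"
begin

lemma T_inv_T [simp]: "T (inv T x) = x"
  using T by (simp add: rigid_motion_def bij_is_surj surj_f_inv_f)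

lemma dist_inv_T [simp]: "dist (inv T x) (inv T y) = dist x y" "dist (T x) (T y) = dist x y"
  using T rigid_motion_inv[OF T] by (auto simp: rigid_motion_def)

lemma css_op_measurable: "nice f \<Longrightarrow> css_op k T \<tau> f \<in> borel_measurable borel"
proof -
  assume f: "nice f"
  note [measurable] = rigid_motion_measurable[OF T]
    css_ext_measurable[OF niceD(2)[OF nice_rigid_motion[OF f rigid_motion_inv[OF T]]] \<tau>]
  show ?thesis unfolding css_op_def[abs_def] by measurable
qed

lemma nn_integral_css_op_le:
  assumes f: "nice f"
  shows "(\<integral>\<^sup>+ x. ennreal (css_op k T \<tau> f x) \<partial>lborel) \<le> (\<integral>\<^sup>+ x. ennreal (f x) \<partial>lborel)"
proof -
  note g = niceD[OF nice_rigid_motion[OF f rigid_motion_inv[OF T]]]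
  note [measurable] = css_ext_measurable[OF g(2) \<tau>]
  have "(\<integral>\<^sup>+ x. ennreal (css_op k T \<tau> f x) \<partial>lborel) =
      (\<integral>\<^sup>+ x. ennreal (enn2real (css_ext k \<tau> (f \<circ> inv T) x)) \<partial>lborel)"
    unfolding css_op_def by (rule nn_integral_rigid_motion[OF T]) measurable
  also have "\<dots> \<le> (\<integral>\<^sup>+ x. css_ext k \<tau> (f \<circ> inv T) x \<partial>lborel)"
    by (intro nn_integral_mono) (metis enn2real_top ennreal_0 ennreal_enn2real less_top order_refl zero_le)
  also have "\<dots> \<le> (\<integral>\<^sup>+ x. ennreal ((f \<circ> inv T) x) \<partial>lborel)"
    using nn_integral_css_ext_le[OF g(2,5) \<tau>] .
  also have "\<dots> = (\<integral>\<^sup>+ x. ennreal (f x) \<partial>lborel)"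
    using nn_integral_rigid_motion[OF rigid_motion_inv[OF T], of "\<lambda>x. ennreal (f x)"] niceD(4)[OF f] by simp
  finally show ?thesis .
qed

lemma css_op_contraction:
  assumes u: "nice u" and v: "nice v" and c: "0 \<le> c"
  shows "(\<integral>\<^sup>+ x. ennreal (css_op k T \<tau> v x - css_op k T \<tau> u x - c) \<partial>lborel)
    \<le> (\<integral>\<^sup>+ x. ennreal (v x - u x - c) \<partial>lborel)"
proof -
  note g = niceD[OF nice_rigid_motion[OF u rigid_motion_inv[OF T]]]
  note h = niceD[OF nice_rigid_motion[OF v rigid_motion_inv[OF T]]]
  note [measurable] = css_ext_measurable[OF g(2) \<tau>] css_ext_measurable[OF h(2) \<tau>] niceD(4)[OF u] niceD(4)[OF v]
  have "(\<integral>\<^sup>+ x. ennreal (css_op k T \<tau> v x - css_op k T \<tau> u x - c) \<partial>lborel) =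
      (\<integral>\<^sup>+ x. ennreal (enn2real (css_ext k \<tau> (v \<circ> inv T) x) - enn2real (css_ext k \<tau> (u \<circ> inv T) x) - c) \<partial>lborel)"
    unfolding css_op_def by (rule nn_integral_rigid_motion[OF T]) measurable
  also have "\<dots> \<le> (\<integral>\<^sup>+ x. ennreal ((v \<circ> inv T) x - (u \<circ> inv T) x - c) \<partial>lborel)"
    using css_ext_contraction[OF g(2) h(2) g(1) g(5) h(5) \<tau> c] .
  also have "\<dots> = (\<integral>\<^sup>+ x. ennreal (v x - u x - c) \<partial>lborel)"
    using nn_integral_rigid_motion[OF rigid_motion_inv[OF T], of "\<lambda>x. ennreal (v x - u x - c)"] by simp
  finally show ?thesis .
qed

text \<open>Finiteness at \<open>x\<close> is essential: an infinite value on the dominating side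
  would be read as 0.\<close>

lemma css_op_near:
  assumes uv: "\<And>x y. dist x y < r \<Longrightarrow> u y \<le> v x + c" and "0 \<le> c" "dist x y < r"
    and fin: "css_ext k \<tau> (v \<circ> inv T) (T x) < \<infinity>"
  shows "css_op k T \<tau> u y \<le> css_op k T \<tau> v x + c"
proof -
  obtain b where b: "css_ext k \<tau> (v \<circ> inv T) (T x) = ennreal b" "0 \<le> b"
    using fin by (cases "css_ext k \<tau> (v \<circ> inv T) (T x)") auto
  have "css_ext k \<tau> (u \<circ> inv T) (T y) \<le> css_ext k \<tau> (v \<circ> inv T) (T x) + ennreal c"
    using assms \<tau> by (intro css_ext_near[where r = r]) auto
  then have "css_ext k \<tau> (u \<circ> inv T) (T y) \<le> ennreal (b + c)" using b assms(2) by simp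
  then show ?thesis using b assms(2) unfolding css_op_def
    by (simp add: enn2real_leI)
qed

lemma css_op_near_bounded:
  assumes "\<And>x y. dist x y < r \<Longrightarrow> u y \<le> v x" "dist x y < r" "\<And>x. v x \<le> B"
  shows "css_op k T \<tau> u y \<le> css_op k T \<tau> v x"
proof -
  have "css_ext k \<tau> (v \<circ> inv T) (T x) < \<infinity>"
    using css_ext_bounded[of "v \<circ> inv T" B k \<tau> "T x"] assms(3) by (auto simp: less_top[symmetric] top_unique)
  then show ?thesis using css_op_near[of r u v 0 x y] assms by simp
qed

lemma AE_css_coord_eq:
  assumes f: "nice f"
  shows "AE x in lborel. css_coord k \<tau> (f \<circ> inv T) (T x) = css_op k T \<tau> f x"
proof -
  note [measurable] = rigid_motion_measurable[OF T]
  define g where "g = f \<circ> inv T"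
  note g = niceD[OF nice_rigid_motion[OF f rigid_motion_inv[OF T]], folded g_def]
  note [measurable] = g(4)
  have "AE x in lborel. (\<integral>\<^sup>+ s. ennreal (g (upd k x s)) \<partial>lborel) < \<infinity>"
    using g(5) by (intro AE_lines(2)) measurable
  then have "AE x in distr lborel borel T. (\<integral>\<^sup>+ s. ennreal (g (upd k x s)) \<partial>lborel) < \<infinity>"
    by (simp only: rigid_motion_lborel[OF T])
  then have "AE x in lborel. (\<integral>\<^sup>+ s. ennreal (g (upd k (T x) s)) \<partial>lborel) < \<infinity>"
    by (subst (asm) AE_distr_iff) measurable
  then show ?thesis
  proof eventually_elim
    case (elim x)
    then have "emeasure lborel (slice k g (T x) h) < \<infinity>" if "0 < h" for h
      using emeasure_slice_finite[OF g(2)] that by simp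
    then show ?case using css_coord_eq[OF g(2) \<tau>] by (simp add: css_op_def g_def)
  qed
qed

lemma Lip_seminorm_css_op:
  assumes f: "nice f"
  shows "Lip_seminorm (\<lambda>x. css_coord k \<tau> (f \<circ> inv T) (T x)) \<le> Lip_seminorm f"
proof (cases "Lip_seminorm f = \<infinity>")
  case False
  define g where "g = f \<circ> inv T"
  have g: "nice g" using nice_rigid_motion[OF f rigid_motion_inv[OF T]] by (simp add: g_def)
  define L where "L = enn2real (Lip_seminorm f)"
  have L: "Lip_seminorm f = ennreal L" "0 \<le> L" using False by (auto simp: L_def less_top)
  have lip: "\<bar>f x - f y\<bar> \<le> L * dist x y" for x y
  proof (cases "x = y")
    case False
    have "ennreal (\<bar>f x - f y\<bar> / norm (x - y)) \<le> Lip_seminorm f"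
      unfolding Lip_seminorm_def using False by (intro SUP_upper2[of "(x, y)"]) auto
    then have "\<bar>f x - f y\<bar> / norm (x - y) \<le> L" using L by simp
    then show ?thesis using False by (simp add: dist_norm field_simps)
  qed simp
  \<comment> \<open>The constant \<open>L + 1\<close> is positive even for constant
    \<open>f\<close>, as the regularity lemma requires.\<close>
  have lipg: "\<bar>g x - g y\<bar> \<le> (L + 1) * dist x y" for x y
  proof -
    have "\<bar>g x - g y\<bar> \<le> L * dist x y" using lip[of "inv T x" "inv T y"] by (simp add: g_def)
    also have "\<dots> \<le> (L + 1) * dist x y" by (intro mult_right_mono) auto
    finally show ?thesis .
  qed
  define W where "W = (\<lambda>x. css_coord k \<tau> (f \<circ> inv T) (T x))"
  have W: "W x = css_op k T \<tau> f x" "css_ext k \<tau> (f \<circ> inv T) (T x) < \<infinity>" for x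
    using css_coord_lipschitz[OF g \<tau> lipg, where x = "T x" and k = k] L(2) by (simp_all add: W_def css_op_def g_def[symmetric])
  have one: "W y - W x \<le> L * dist x y" for x y
  proof (rule field_le_epsilon)
    fix e :: real assume "0 < e"
    \<comment> \<open>The comparison needs a strict bound on the distance; the excess
      \<open>e / (L + 1)\<close> costs at most \<open>e\<close> after multiplication by
      \<open>L\<close>.\<close>
    define r where "r = dist x y + e / (L + 1)"
    have r: "dist x y < r" using \<open>0 < e\<close> L(2) by (simp add: r_def)
    have "0 \<le> L * r" using r L(2) by (meson le_less_trans less_imp_le mult_nonneg_nonneg zero_le_dist)
    moreover have "f y \<le> f x + L * r" if "dist x y < r" for x y
    proof -
      have "L * dist x y \<le> L * r" using that L(2) by (intro mult_left_mono) auto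
      then show ?thesis using lip[of x y] by linarith
    qed
    ultimately have "W y \<le> W x + L * r"
      unfolding W(1) using r W(2) by (intro css_op_near[where r = r]) auto
    also have "L * r \<le> L * dist x y + e"
    proof -
      have "L * (e / (L + 1)) \<le> (L + 1) * (e / (L + 1))" using \<open>0 < e\<close> L(2) by (intro mult_right_mono) auto
      then show ?thesis using L(2) by (simp add: r_def distrib_left)
    qed
    finally show "W y - W x \<le> L * dist x y + e" by simp
  qed
  have "ennreal (\<bar>W x - W y\<bar> / norm (x - y)) \<le> ennreal L" if "x \<noteq> y" for x y
  proof -
    have "\<bar>W x - W y\<bar> \<le> L * norm (x - y)"
      using one[of x y] one[of y x] by (simp add: dist_norm norm_minus_commute abs_le_iff)
    then show ?thesis using that by (intro ennreal_leI) (simp add: field_simps)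
  qed
  then show ?thesis unfolding W_def[symmetric] L(1) by (auto simp: Lip_seminorm_def intro!: SUP_least)
qed simp

end

section \<open>Mollifiers and convolution\<close>

text \<open>The standard flat function \<open>exp (- 1 / t)\<close> with a polynomial in
  \<open>1 / t\<close> as factor, a class that is closed under differentiation.\<close>

definition psi :: "real poly \<Rightarrow> real \<Rightarrow> real" where
  "psi p t = (if 0 < t then poly p (inverse t) * exp (- inverse t) else 0)"

text \<open>With \<open>s = 1 / t\<close>, the chain rule replaces the factor \<open>p\<close> by
  the polynomial \<open>s^2 * (p - p')\<close>.\<close>

definition dpsi :: "real poly \<Rightarrow> real poly" where
  "dpsi p = [:0, 0, 1:] * (p - pderiv p)"

lemma tendsto_poly_div_exp: "((\<lambda>s. s ^ k * poly p s / exp s) \<longlongrightarrow> (0::real)) at_top"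
proof (induction p arbitrary: k)
  case (pCons a p)
  have "((\<lambda>s. a * (s ^ k / exp s) + s ^ Suc k * poly p s / exp s) \<longlongrightarrow> a * 0 + 0) at_top"
    by (intro tendsto_intros tendsto_power_div_exp_0 pCons.IH)
  moreover have "a * (s ^ k / exp s) + s ^ Suc k * poly p s / exp s = s ^ k * poly (pCons a p) s / exp s" for s
    by (simp add: add_divide_distrib distrib_left mult_ac)
  ultimately show ?case by simp
qed simp

lemma tendsto_psi_0: "(psi p \<longlongrightarrow> 0) (at 0)"
proof (rule filterlim_split_at)
  have "((\<lambda>t. inverse t ^ 0 * poly p (inverse t) / exp (inverse t)) \<longlongrightarrow> 0) (at_right 0)"
    by (rule filterlim_compose[OF tendsto_poly_div_exp filterlim_inverse_at_top_right])
  moreover have "\<forall>\<^sub>F t in at_right 0. inverse t ^ 0 * poly p (inverse t) / exp (inverse t) = psi p t"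
    by (auto simp: eventually_at_filter psi_def exp_minus divide_inverse)
  ultimately show "(psi p \<longlongrightarrow> 0) (at_right 0)" by (rule Lim_transform_eventually)
  have "\<forall>\<^sub>F t in at_left 0. 0 = psi p t" by (auto simp: eventually_at_filter psi_def)
  then show "(psi p \<longlongrightarrow> 0) (at_left 0)" by (rule Lim_transform_eventually[OF tendsto_const])
qed

lemma psi_deriv: "(psi p has_real_derivative psi (dpsi p) t) (at t)"
proof -
  consider "0 < t" | "t < 0" | "t = 0" by linarith
  then show ?thesis
  proof cases
    case 1
    have "((\<lambda>t. poly p (inverse t) * exp (- inverse t)) has_real_derivative psi (dpsi p) t) (at t)"
      using 1 by (auto intro!: derivative_eq_intros DERIV_chain2[OF poly_DERIV]
          simp: psi_def dpsi_def field_simps power2_eq_square)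
    then show ?thesis
      by (rule has_field_derivative_transform_within_open[of _ _ _ "{0<..}"]) (use 1 in \<open>auto simp: psi_def\<close>)
  next
    case 2
    have "((\<lambda>t. 0) has_real_derivative psi (dpsi p) t) (at t)" using 2 by (simp add: psi_def)
    then show ?thesis
      by (rule has_field_derivative_transform_within_open[of _ _ _ "{..<0}"]) (use 2 in \<open>auto simp: psi_def\<close>)
  next
    case 3
    \<comment> \<open>At 0 the difference quotient of \<open>psi p\<close> is again of this kind,
      with the polynomial multiplied by its variable; so it tends to 0.\<close>
    have "\<forall>\<^sub>F h in at 0. psi (pCons 0 p) h = (psi p (0 + h) - psi p 0) / h"
      by (auto simp: eventually_at_filter psi_def divide_inverse)
    then have "((\<lambda>h. (psi p (0 + h) - psi p 0) / h) \<longlongrightarrow> 0) (at 0)"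
      using tendsto_psi_0 by (rule Lim_transform_eventually[rotated])
    then show ?thesis using 3 by (simp add: DERIV_def psi_def)
  qed
qed

lemmas psi_deriv_chain [derivative_intros] = DERIV_chain2[OF psi_deriv]

definition cube_fn :: "real \<Rightarrow> ('n \<Rightarrow> real poly) \<Rightarrow> ('n \<Rightarrow> real poly) \<Rightarrow> real ^ 'n::finite \<Rightarrow> real" where
  "cube_fn d p q x = (\<Prod>i\<in>UNIV. psi (p i) (d - x $ i) * psi (q i) (d + x $ i))"

text \<open>Products of flat functions over a cube, closed under partial derivatives:
  differentiating the two factors of one coordinate gives two such products, with opposite signs
  because the arguments are \<open>d - x $ i\<close> and \<open>d + x $ i\<close>.\<close>

inductive cube_smooth :: "real \<Rightarrow> (real ^ 'n::finite \<Rightarrow> real) \<Rightarrow> bool" for d where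
  base: "cube_smooth d (cube_fn d p q)"
| diff: "cube_smooth d \<phi> \<Longrightarrow> cube_smooth d \<psi> \<Longrightarrow> cube_smooth d (\<lambda>x. \<phi> x - \<psi> x)"

lemma cube_smooth_derivative:
  fixes \<phi> :: "real ^ 'n::finite \<Rightarrow> real"
  assumes "cube_smooth d \<phi>"
  shows "\<exists>\<phi>'. (\<forall>x. (\<phi> has_derivative \<phi>' x) (at x)) \<and> (\<forall>i. cube_smooth d (\<lambda>x. \<phi>' x (axis i 1)))"
  using assms
proof induction
  case (base p q)
  define g where "g i t = psi (p i) (d - t) * psi (dpsi (q i)) (d + t) - psi (dpsi (p i)) (d - t) * psi (q i) (d + t)" for i t
  define F where "F i x = psi (p i) (d - x $ i) * psi (q i) (d + x $ i)" for i and x :: "real ^ 'n"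
  have g: "((\<lambda>t. psi (p i) (d - t) * psi (q i) (d + t)) has_real_derivative g i t) (at t)" for i t
    unfolding g_def by (auto intro!: derivative_eq_intros)
  have F: "(F i has_derivative (\<lambda>h. h $ i * g i (x $ i))) (at x)" for i x
    unfolding F_def
    using has_derivative_compose[OF bounded_linear.has_derivative[OF bounded_linear_vec_nth, of "\<lambda>x. x"] 
        g[unfolded has_field_derivative_def, of i "x $ i"]]
    by (simp add: mult.commute)
  define \<phi>' where "\<phi>' x h = (\<Sum>i\<in>UNIV. (h $ i * g i (x $ i)) * (\<Prod>j\<in>UNIV - {i}. F j x))" for x h
  have "(cube_fn d p q has_derivative \<phi>' x) (at x)" for x
  proof -
    have "((\<lambda>x. \<Prod>i\<in>UNIV. F i x) has_derivative \<phi>' x) (at x)"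
      unfolding \<phi>'_def by (intro has_derivative_prod F)
    then show ?thesis by (simp add: F_def cube_fn_def[abs_def])
  qed
  moreover have "cube_smooth d (\<lambda>x. \<phi>' x (axis i 1))" for i
  proof -
    have upd: "cube_fn d p' q' x = psi (p' i) (d - x $ i) * psi (q' i) (d + x $ i) * (\<Prod>j\<in>UNIV - {i}. F j x)"
      if "\<And>j. j \<noteq> i \<Longrightarrow> p' j = p j \<and> q' j = q j" for p' q' x
      unfolding cube_fn_def by (subst prod.remove[of UNIV i]) (auto simp: F_def that intro!: prod.cong)
    have "\<phi>' x (axis i 1) = g i (x $ i) * (\<Prod>j\<in>UNIV - {i}. F j x)" for x
    proof -
      have "\<phi>' x (axis i 1) = (\<Sum>j\<in>UNIV. if j = i then g i (x $ i) * (\<Prod>j\<in>UNIV - {i}. F j x) else 0)"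
        unfolding \<phi>'_def by (intro sum.cong) (auto simp: axis_def)
      then show ?thesis by simp
    qed
    also have "\<dots> x = cube_fn d p (q(i := dpsi (q i))) x - cube_fn d (p(i := dpsi (p i))) q x" for x
      by (subst (1 2) upd) (auto simp: g_def left_diff_distrib)
    finally have "(\<lambda>x. \<phi>' x (axis i 1)) = (\<lambda>x. cube_fn d p (q(i := dpsi (q i))) x - cube_fn d (p(i := dpsi (p i))) q x)"
      by blast
    then show ?thesis by (simp add: cube_smooth.intros)
  qed
  ultimately show ?case by blast
next
  case (diff \<phi> \<psi>)
  then obtain \<phi>' \<psi>' where "\<And>x. (\<phi> has_derivative \<phi>' x) (at x)" "\<And>i. cube_smooth d (\<lambda>x. \<phi>' x (axis i 1))"
    "\<And>x. (\<psi> has_derivative \<psi>' x) (at x)" "\<And>i. cube_smooth d (\<lambda>x. \<psi>' x (axis i 1))" by blast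
  then show ?case
    by (intro exI[of _ "\<lambda>x h. \<phi>' x h - \<psi>' x h"]) (auto intro!: has_derivative_diff cube_smooth.diff)
qed

lemma partial_deriv_eq: "(\<phi> has_derivative \<phi>') (at x) \<Longrightarrow> partial_deriv i \<phi> x = \<phi>' (axis i 1)"
  unfolding partial_deriv_def using frechet_derivative_at by metis

lemma cube_smooth_C_k: "cube_smooth d \<phi> \<Longrightarrow> C_k m \<phi>"
proof (induction m arbitrary: \<phi>)
  case 0
  then obtain \<phi>' where \<phi>': "\<And>x. (\<phi> has_derivative \<phi>' x) (at x)" using cube_smooth_derivative by blast
  then show ?case
    using has_derivative_continuous[OF \<phi>'] by (auto simp: continuous_on_eq_continuous_at)
next
  case (Suc m)
  then obtain \<phi>' where \<phi>': "\<And>x. (\<phi> has_derivative \<phi>' x) (at x)"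
      "\<And>i. cube_smooth d (\<lambda>x. \<phi>' x (axis i 1))" using cube_smooth_derivative by blast
  have "partial_deriv i \<phi> = (\<lambda>x. \<phi>' x (axis i 1))" for i
    using partial_deriv_eq \<phi>'(1) by blast
  then show ?case using \<phi>' Suc.IH by (auto simp: differentiable_def)
qed

section \<open>Compactly supported functions, test functions and mollifiers\<close>

definition cc :: "('a::euclidean_space \<Rightarrow> real) \<Rightarrow> bool" where
  "cc \<phi> \<longleftrightarrow> continuous_on UNIV \<phi> \<and> compact (closure {x. \<phi> x \<noteq> 0})"

lemma ccI:
  assumes "continuous_on UNIV \<phi>" "compact K" "\<And>x. x \<notin> K \<Longrightarrow> \<phi> x = 0"
  shows "cc \<phi>"
proof -
  have "closure {x. \<phi> x \<noteq> 0} \<subseteq> K"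
    using assms(3) compact_imp_closed[OF assms(2)] by (intro closure_minimal) auto
  then have "compact (closure {x. \<phi> x \<noteq> 0})"
    using assms(2) by (metis bounded_subset closed_closure compact_eq_bounded_closed)
  then show ?thesis using assms(1) by (simp add: cc_def)
qed

lemma cc_support:
  assumes "cc \<phi>"
  shows "\<exists>R>0. \<forall>x. R < norm x \<longrightarrow> \<phi> x = 0"
proof -
  have "bounded {x. \<phi> x \<noteq> 0}"
    using assms compact_imp_bounded bounded_subset closure_subset unfolding cc_def by metis
  then obtain R where "\<forall>x\<in>{x. \<phi> x \<noteq> 0}. norm x \<le> R" "0 < R" by (auto simp: bounded_pos)
  then show ?thesis by (intro exI[of _ R]) (auto simp: not_le[symmetric])
qed

lemma cc_measurable: "cc \<phi> \<Longrightarrow> \<phi> \<in> borel_measurable borel"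
  by (simp add: cc_def borel_measurable_continuous_onI)

lemma cc_uniform:
  fixes \<phi> :: "'a::euclidean_space \<Rightarrow> real"
  assumes "cc \<phi>" "0 < e"
  obtains d where "0 < d" "\<And>x y. dist x y < d \<Longrightarrow> \<bar>\<phi> x - \<phi> y\<bar> < e"
proof -
  obtain R where R: "0 < R" "\<And>x. R < norm x \<Longrightarrow> \<phi> x = 0" using cc_support[OF assms(1)] by blast
  have "uniformly_continuous_on (cball 0 (R + 1)) \<phi>"
    using assms(1) unfolding cc_def by (intro compact_uniformly_continuous) (auto intro: continuous_on_subset)
  then obtain d where d: "0 < d" "\<And>x y. x \<in> cball 0 (R + 1) \<Longrightarrow> y \<in> cball 0 (R + 1) \<Longrightarrow> dist y x < d \<Longrightarrow> dist (\<phi> y) (\<phi> x) < e"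
    using assms(2) unfolding uniformly_continuous_on_def by metis
  show ?thesis
  proof (rule that[of "min d 1"])
    fix x y :: 'a assume xy: "dist x y < min d 1"
    have n: "norm x \<le> norm y + dist x y" "norm y \<le> norm x + dist x y"
      using norm_triangle_sub[of x y] norm_triangle_sub[of y x] by (simp_all add: dist_norm norm_minus_commute)
    show "\<bar>\<phi> x - \<phi> y\<bar> < e"
    proof (cases "norm x \<le> R + 1 \<and> norm y \<le> R + 1")
      case True
      then show ?thesis using d(2)[of y x] xy by (simp add: dist_real_def dist_commute)
    next
      case False
      then have "R < norm x" "R < norm y" using n xy by auto
      then show ?thesis using R(2) assms(2) by simp
    qed
  qed (use d(1) in simp)
qed

lemma cc_bounded:
  assumes "cc \<phi>"
  obtains B where "0 < B" "\<And>x. \<bar>\<phi> x\<bar> \<le> B"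
proof -
  obtain R where R: "0 < R" "\<And>x. R < norm x \<Longrightarrow> \<phi> x = 0" using cc_support[OF assms(1)] by blast
  have "bounded (\<phi> ` cball 0 R)"
    using assms unfolding cc_def by (intro compact_imp_bounded compact_continuous_image) (auto intro: continuous_on_subset)
  then obtain B where B: "0 < B" "\<And>x. norm x \<le> R \<Longrightarrow> \<bar>\<phi> x\<bar> \<le> B" by (auto simp: bounded_pos)
  then have "\<bar>\<phi> x\<bar> \<le> B" for x using R(2)[of x] by (cases "norm x \<le> R") auto
  with B(1) that show ?thesis by blast
qed

lemma cc_integrable:
  assumes "cc \<phi>" shows "integrable lborel \<phi>"
proof -
  have "integrable lborel (\<lambda>x. indicator (closure {x. \<phi> x \<noteq> 0}) x *\<^sub>R \<phi> x)"
    using assms unfolding cc_def by (intro borel_integrable_compact) (auto intro: continuous_on_subset)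
  moreover have "indicator (closure {x. \<phi> x \<noteq> 0}) x *\<^sub>R \<phi> x = \<phi> x" for x
    using closure_subset[of "{x. \<phi> x \<noteq> 0}"] by (cases "\<phi> x = 0") (auto simp: indicator_def)
  ultimately show ?thesis by (simp only:)
qed

lemma cc_reflect:
  fixes \<phi> :: "'a::euclidean_space \<Rightarrow> real"
  assumes "cc \<phi>" shows "cc (\<lambda>y. \<phi> (x - y))"
proof -
  obtain R where R: "0 < R" "\<And>x. R < norm x \<Longrightarrow> \<phi> x = 0" using cc_support[OF assms(1)] by blast
  show ?thesis
  proof (rule ccI[of _ "cball x R"])
    show "continuous_on UNIV (\<lambda>y. \<phi> (x - y))"
      using assms continuous_on_compose2[of UNIV \<phi> UNIV "\<lambda>y. x - y"]
      by (simp add: cc_def continuous_on_op_minus)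
    show "y \<notin> cball x R \<Longrightarrow> \<phi> (x - y) = 0" for y using R(2)[of "x - y"] by (simp add: dist_norm)
  qed simp
qed

lemma test_function_cc: "test_function \<phi> \<Longrightarrow> cc \<phi>"
  unfolding test_function_def cc_def by (metis C_k.simps(1))

lemma test_function_differentiable: "test_function \<phi> \<Longrightarrow> \<phi> differentiable at x"
  unfolding test_function_def by (metis C_k.simps(2))

lemma test_function_partial:
  assumes "test_function \<phi>" shows "test_function (partial_deriv i \<phi>)"
proof -
  have "C_k m (partial_deriv i \<phi>)" for m
    using assms unfolding test_function_def by (metis C_k.simps(2))
  moreover have "{x. partial_deriv i \<phi> x \<noteq> 0} \<subseteq> closure {x. \<phi> x \<noteq> 0}"
  proof (rule subsetI, rule ccontr)
    fix x assume x: "x \<in> {x. partial_deriv i \<phi> x \<noteq> 0}" "x \<notin> closure {x. \<phi> x \<noteq> 0}"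
    have "((\<lambda>_. 0) has_derivative (\<lambda>_. 0)) (at x)" by simp
    then have "(\<phi> has_derivative (\<lambda>_. 0)) (at x)"
      by (rule has_derivative_transform_within_open[of _ _ _ _ "- closure {x. \<phi> x \<noteq> 0}"])
        (use x closure_subset in force)+
    then show False using x(1) partial_deriv_eq by force
  qed
  then have "closure {x. partial_deriv i \<phi> x \<noteq> 0} \<subseteq> closure {x. \<phi> x \<noteq> 0}"
    by (simp add: closure_minimal)
  then have "compact (closure {x. partial_deriv i \<phi> x \<noteq> 0})"
    using assms unfolding test_function_def
    by (metis bounded_subset closed_closure compact_eq_bounded_closed)
  ultimately show ?thesis by (simp add: test_function_def)
qed

lemma partial_deriv_cc: "test_function \<phi> \<Longrightarrow> cc (partial_deriv i \<phi>)"
  by (rule test_function_cc[OF test_function_partial])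

definition grad :: "(real ^ 'n::finite \<Rightarrow> real) \<Rightarrow> real ^ 'n \<Rightarrow> real ^ 'n" where
  "grad \<phi> x = (\<chi> i. partial_deriv i \<phi> x)"

lemma has_derivative_partials:
  fixes \<phi> :: "real ^ 'n::finite \<Rightarrow> real"
  assumes "\<phi> differentiable at x"
  shows "(\<phi> has_derivative (\<lambda>h. grad \<phi> x \<bullet> h)) (at x)"
proof -
  define D where "D = frechet_derivative \<phi> (at x)"
  have D: "(\<phi> has_derivative D) (at x)" using assms frechet_derivative_works by (auto simp: D_def)
  then have lin: "linear D" by (simp add: has_derivative_linear)
  have "D h = grad \<phi> x \<bullet> h" for h
  proof -
    have "D h = D (\<Sum>i\<in>UNIV. (h $ i) *\<^sub>R axis i 1)"
      by (metis (no_types, lifting) basis_expansion scalar_mult_eq_scaleR sum.cong)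
    also have "\<dots> = (\<Sum>i\<in>UNIV. h $ i * D (axis i 1))"
      by (simp add: linear_sum[OF lin] linear_scale[OF lin])
    also have "\<dots> = grad \<phi> x \<bullet> h"
      by (simp add: grad_def inner_vec_def partial_deriv_def D_def mult.commute)
    finally show ?thesis .
  qed
  then show ?thesis using D by (metis ext)
qed

lemma C_k_reflect:
  fixes \<phi> :: "real ^ 'n::finite \<Rightarrow> real"
  shows "C_k m \<phi> \<Longrightarrow> C_k m (\<lambda>y. c * \<phi> (x - y))"
proof (induction m arbitrary: \<phi> c)
  case 0
  then show ?case by (auto intro!: continuous_intros continuous_on_compose2[of UNIV \<phi>])
next
  case (Suc m)
  have d: "((\<lambda>y. c * \<phi> (x - y)) has_derivative (\<lambda>h. c * (grad \<phi> (x - y) \<bullet> (- h)))) (at y)" for y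
  proof -
    have "(\<phi> has_derivative (\<lambda>h. grad \<phi> (x - y) \<bullet> h)) (at (x - y))"
      using Suc.prems by (intro has_derivative_partials) simp
    then have "((\<lambda>y. \<phi> (x - y)) has_derivative (\<lambda>h. grad \<phi> (x - y) \<bullet> (- h))) (at y)"
      by (rule has_derivative_compose[rotated]) (auto intro!: derivative_eq_intros)
    then show ?thesis by (intro has_derivative_mult_right)
  qed
  have "partial_deriv i (\<lambda>y. c * \<phi> (x - y)) = (\<lambda>y. (- c) * partial_deriv i \<phi> (x - y))" for i
    using partial_deriv_eq[OF d] by (auto simp: grad_def inner_axis)
  moreover have "C_k m (\<lambda>y. (- c) * partial_deriv i \<phi> (x - y))" for i
    using Suc.prems by (intro Suc.IH) simp
  ultimately show ?case using d by (auto simp: differentiable_def)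
qed

lemma test_function_reflect:
  assumes "test_function \<phi>"
  shows "test_function (\<lambda>y. \<phi> (x - y))"
    and "partial_deriv i (\<lambda>y. \<phi> (x - y)) y = - partial_deriv i \<phi> (x - y)"
proof -
  show "test_function (\<lambda>y. \<phi> (x - y))"
    using C_k_reflect[of _ \<phi> 1 x] cc_reflect[OF test_function_cc[OF assms], of x] assms
    by (simp add: test_function_def cc_def)
  have "(\<phi> has_derivative (\<lambda>h. grad \<phi> (x - y) \<bullet> h)) (at (x - y))"
    using test_function_differentiable[OF assms] by (rule has_derivative_partials)
  then have "((\<lambda>y. \<phi> (x - y)) has_derivative (\<lambda>h. grad \<phi> (x - y) \<bullet> (- h))) (at y)"
    by (rule has_derivative_compose[rotated]) (auto intro!: derivative_eq_intros)
  from partial_deriv_eq[OF this] show "partial_deriv i (\<lambda>y. \<phi> (x - y)) y = - partial_deriv i \<phi> (x - y)"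
    by (simp add: grad_def inner_axis)
qed

definition mollifier :: "real \<Rightarrow> (real ^ 'n::finite \<Rightarrow> real) \<Rightarrow> bool" where
  "mollifier d \<eta> \<longleftrightarrow> test_function \<eta> \<and> (\<forall>x. 0 \<le> \<eta> x) \<and> (LINT x|lborel. \<eta> x) = 1 \<and> (\<forall>x. \<eta> x \<noteq> 0 \<longrightarrow> norm x \<le> d)"

lemma mollifier_exists:
  assumes "0 < d" shows "\<exists>\<eta> :: real ^ 'n::finite \<Rightarrow> real. mollifier d \<eta>"
proof -
  \<comment> \<open>The Euclidean norm is at most the sum of the coordinates, so the cube of half
    side \<open>d / n\<close> lies in the ball of radius \<open>d\<close>.\<close>
  define d' where "d' = d / real CARD('n)"
  have d': "0 < d'" using assms by (simp add: d'_def)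
  define \<phi> :: "real ^ 'n \<Rightarrow> real" where "\<phi> = cube_fn d' (\<lambda>_. 1) (\<lambda>_. 1)"
  have psi1: "0 \<le> psi 1 t" "0 < t \<Longrightarrow> 0 < psi 1 t" "psi 1 t \<noteq> 0 \<Longrightarrow> 0 < t" for t
    by (auto simp: psi_def split: if_splits)
  have nn: "0 \<le> \<phi> x" for x unfolding \<phi>_def cube_fn_def using psi1 by (intro prod_nonneg) auto
  have pos: "0 < \<phi> 0" unfolding \<phi>_def cube_fn_def using psi1 d' by (intro prod_pos) auto
  have supp: "norm x \<le> d" if "\<phi> x \<noteq> 0" for x
  proof -
    have "psi 1 (d' - x $ i) \<noteq> 0 \<and> psi 1 (d' + x $ i) \<noteq> 0" for i
      using that by (auto simp: \<phi>_def cube_fn_def)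
    then have "\<bar>x $ i\<bar> \<le> d'" for i using psi1(3)[of "d' - x $ i"] psi1(3)[of "d' + x $ i"] by force
    then have "norm x \<le> (\<Sum>i\<in>(UNIV::'n set). d')"
      using norm_le_l1_cart[of x] sum_mono[of UNIV "\<lambda>i. \<bar>x $ i\<bar>" "\<lambda>_. d'"] by simp
    then show ?thesis by (simp add: d'_def)
  qed
  have Ck: "C_k m \<phi>" for m unfolding \<phi>_def by (rule cube_smooth_C_k[OF cube_smooth.base])
  have cont: "continuous_on UNIV \<phi>" using Ck[of 0] by simp
  have "cc \<phi>" by (rule ccI[OF cont, of "cball 0 d"]) (use supp in auto)
  then have int: "integrable lborel \<phi>" by (rule cc_integrable)
  define I where "I = (LINT x|lborel. \<phi> x)"
  have "I \<noteq> 0"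
  proof
    assume "I = 0"
    then have "AE x in lborel. \<phi> x = 0"
      using integral_nonneg_eq_0_iff_AE[OF int] nn by (simp add: I_def)
    then have "AE x in lborel. x \<notin> {x. 0 < \<phi> x}" by eventually_elim simp
    moreover have op: "open {x. 0 < \<phi> x}" using cont by (intro open_Collect_less continuous_intros)
    ultimately have "{x. 0 < \<phi> x} \<in> null_sets lborel" by (subst AE_iff_null_sets) auto
    moreover obtain r where r: "0 < r" "ball 0 r \<subseteq> {x. 0 < \<phi> x}" using op pos open_contains_ball by blast
    ultimately have "ball 0 r \<in> null_sets (lborel :: (real ^ 'n) measure)" by (auto intro: null_sets_subset)
    then have "emeasure (lborel :: (real ^ 'n) measure) (ball 0 r) = 0" by (rule null_setsD1)
    then show False using r(1) unit_ball_vol_pos[of "real DIM(real ^ 'n)"]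
      by (simp add: emeasure_ball del: unit_ball_vol_pos)
  qed
  moreover have "0 \<le> I" unfolding I_def using nn by (intro Bochner_Integration.integral_nonneg) auto
  ultimately have I: "0 < I" by simp
  \<comment> \<open>The reflection is harmless, the bump being even; it brings the scaled function
    into the form for which smoothness has been shown.\<close>
  define \<eta> where "\<eta> = (\<lambda>x. (1 / I) * \<phi> (0 - x))"
  have "C_k m \<eta>" for m unfolding \<eta>_def by (intro C_k_reflect Ck)
  moreover have supp\<eta>: "norm x \<le> d" if "\<eta> x \<noteq> 0" for x using supp[of "0 - x"] that by (auto simp: \<eta>_def)
  have "cc \<eta>" by (rule ccI[of _ "cball 0 d"]) (use supp\<eta> calculation[of 0] in auto)
  moreover have "(LINT x|lborel. \<eta> x) = 1"
  proof -
    have "\<phi> (0 - x) = \<phi> x" for x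
      unfolding \<phi>_def cube_fn_def by (intro prod.cong) (auto simp: mult.commute)
    then show ?thesis using I by (simp add: \<eta>_def I_def[symmetric])
  qed
  ultimately have "mollifier d \<eta>" using nn I supp\<eta> by (simp add: mollifier_def test_function_def cc_def \<eta>_def)
  then show ?thesis by blast
qed


section \<open>Convolution with test functions\<close>

lemma distr_lborel_reflect:
  "distr lborel borel (\<lambda>y. x - y) = (lborel :: 'a::euclidean_space measure)"
  using lborel_affine[of "-1" x] by (simp add: density_1)

lemma integral_lborel_reflect:
  fixes F :: "'a::euclidean_space \<Rightarrow> 'b::{banach, second_countable_topology}"
  assumes "F \<in> borel_measurable borel"
  shows "(LINT y|lborel. F (x - y)) = (LINT y|lborel. F y)"
proof -
  have "(LINT y|distr lborel borel (\<lambda>y. x - y). F y) = (LINT y|lborel. F (x - y))"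
    using assms by (intro integral_distr) simp_all
  then show ?thesis by (simp add: distr_lborel_reflect)
qed

lemma nn_integral_lborel_reflect:
  fixes F :: "'a::euclidean_space \<Rightarrow> ennreal"
  assumes "F \<in> borel_measurable borel"
  shows "(\<integral>\<^sup>+ y. F (x - y) \<partial>lborel) = (\<integral>\<^sup>+ y. F y \<partial>lborel)"
proof -
  have "(\<integral>\<^sup>+ y. F y \<partial>distr lborel borel (\<lambda>y. x - y)) = (\<integral>\<^sup>+ y. F (x - y) \<partial>lborel)"
    using assms by (intro nn_integral_distr) simp_all
  then show ?thesis by (simp add: distr_lborel_reflect)
qed

lemma integral_mult_bounded:
  fixes f k :: "'a::euclidean_space \<Rightarrow> real"
  assumes f: "integrable lborel f" and k: "k \<in> borel_measurable borel" "\<And>y. \<bar>k y\<bar> \<le> e"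
  shows "integrable lborel (\<lambda>y. f y * k y)"
    and "\<bar>LINT y|lborel. f y * k y\<bar> \<le> e * (LINT y|lborel. \<bar>f y\<bar>)"
proof -
  have [measurable]: "f \<in> borel_measurable lborel" using f by simp
  note k(1) [measurable]
  have e: "integrable lborel (\<lambda>y. e * \<bar>f y\<bar>)" using f by simp
  have le: "\<bar>f y * k y\<bar> \<le> e * \<bar>f y\<bar>" for y
    using mult_right_mono[OF k(2)[of y], of "\<bar>f y\<bar>"] by (simp add: abs_mult mult.commute)
  show i: "integrable lborel (\<lambda>y. f y * k y)"
    by (rule Bochner_Integration.integrable_bound[OF e]) (use le in \<open>auto intro: order_trans[OF _ abs_ge_self]\<close>)
  have "\<bar>LINT y|lborel. f y * k y\<bar> \<le> (LINT y|lborel. \<bar>f y * k y\<bar>)" by (rule integral_abs_bound)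
  also have "\<dots> \<le> (LINT y|lborel. e * \<bar>f y\<bar>)" using le i e by (intro integral_mono) auto
  finally show "\<bar>LINT y|lborel. f y * k y\<bar> \<le> e * (LINT y|lborel. \<bar>f y\<bar>)" by simp
qed

definition conv :: "('a::euclidean_space \<Rightarrow> real) \<Rightarrow> ('a \<Rightarrow> real) \<Rightarrow> 'a \<Rightarrow> real" where
  "conv f \<phi> x = (LINT y|lborel. f y * \<phi> (x - y))"

lemma conv_commute:
  assumes "f \<in> borel_measurable borel" "\<phi> \<in> borel_measurable borel"
  shows "conv f \<phi> = conv \<phi> f"
proof
  fix x
  show "conv f \<phi> x = conv \<phi> f x"
    unfolding conv_def using assms integral_lborel_reflect[of "\<lambda>y. f y * \<phi> (x - y)" x]
    by (simp add: mult.commute)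
qed

context
  fixes f :: "'a::euclidean_space \<Rightarrow> real"
  assumes f: "integrable lborel f"
begin

lemma conv_integrable:
  assumes "cc \<phi>" shows "integrable lborel (\<lambda>y. f y * \<phi> (x - y))"
proof -
  obtain B where "\<And>x. \<bar>\<phi> x\<bar> \<le> B" using cc_bounded[OF assms] by blast
  then show ?thesis using cc_measurable[OF cc_reflect[OF assms]] by (intro integral_mult_bounded(1)[OF f]) auto
qed

lemma conv_bounded:
  assumes "cc \<phi>" "\<And>x. \<bar>\<phi> x\<bar> \<le> B" shows "\<bar>conv f \<phi> x\<bar> \<le> B * (LINT y|lborel. \<bar>f y\<bar>)"
  unfolding conv_def using assms cc_measurable[OF cc_reflect[OF assms(1)]]
  by (intro integral_mult_bounded(2)[OF f]) auto

lemma conv_uniform: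
  assumes "cc \<phi>" "0 < e"
  shows "\<exists>d>0. \<forall>x x'. dist x x' < d \<longrightarrow> \<bar>conv f \<phi> x - conv f \<phi> x'\<bar> < e"
proof -
  define I where "I = (LINT y|lborel. \<bar>f y\<bar>)"
  have I: "0 \<le> I" unfolding I_def by simp
  \<comment> \<open>Adding 1 covers \<open>I = 0\<close> and makes the final inequality
    strict.\<close>
  have "0 < e / (I + 1)" using assms(2) I by simp
  then obtain d where d: "0 < d" "\<And>x y. dist x y < d \<Longrightarrow> \<bar>\<phi> x - \<phi> y\<bar> < e / (I + 1)"
    using cc_uniform[OF assms(1)] by blast
  have "\<bar>conv f \<phi> x - conv f \<phi> x'\<bar> < e" if "dist x x' < d" for x x'
  proof -
    have "conv f \<phi> x - conv f \<phi> x' = (LINT y|lborel. f y * (\<phi> (x - y) - \<phi> (x' - y)))"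
      unfolding conv_def using conv_integrable[OF assms(1)]
      by (simp add: right_diff_distrib)
    moreover have "\<bar>\<dots>\<bar> \<le> e / (I + 1) * I"
      unfolding I_def
    proof (rule integral_mult_bounded(2)[OF f])
      show "(\<lambda>y. \<phi> (x - y) - \<phi> (x' - y)) \<in> borel_measurable borel"
        using cc_measurable[OF cc_reflect[OF assms(1)]] by (intro borel_measurable_diff)
      show "\<bar>\<phi> (x - y) - \<phi> (x' - y)\<bar> \<le> e / ((LINT y|lborel. \<bar>f y\<bar>) + 1)" for y
        using d(2)[of "x - y" "x' - y"] that by (simp add: I_def dist_norm)
    qed
    moreover have "e / (I + 1) * I < e" using assms(2) I by (simp add: field_simps)
    ultimately show ?thesis by simp
  qed
  then show ?thesis using d(1) by blast
qed

lemma conv_continuous: "cc \<phi> \<Longrightarrow> continuous_on A (conv f \<phi>)"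
  unfolding continuous_on_iff dist_real_def using conv_uniform by (metis dist_commute)

text \<open>The mass of \<open>f\<close> outside large balls is small by dominated convergence, and
  at a distant \<open>x\<close> the kernel sees only that mass.\<close>

lemma conv_vanish:
  assumes "cc \<phi>" "0 < e"
  shows "\<exists>R>0. \<forall>x. R < norm x \<longrightarrow> \<bar>conv f \<phi> x\<bar> < e"
proof -
  obtain B where B: "0 < B" "\<And>x. \<bar>\<phi> x\<bar> \<le> B" using cc_bounded[OF assms(1)] by blast
  obtain R where R: "0 < R" "\<And>x. R < norm x \<Longrightarrow> \<phi> x = 0" using cc_support[OF assms(1)] by blast
  have [measurable]: "f \<in> borel_measurable borel" using f by simp
  define t where "t n y = \<bar>f y\<bar> * indicator {y. real n < norm y} y" for n and y :: 'a
  have tm [measurable]: "t n \<in> borel_measurable borel" for n unfolding t_def by measurable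
  have "(\<lambda>n. LINT y|lborel. t n y) \<longlonglongrightarrow> (LINT y|(lborel :: 'a measure). 0)"
  proof (rule integral_dominated_convergence[where w = "\<lambda>y. \<bar>f y\<bar>"])
    show "AE y in lborel. (\<lambda>n. t n y) \<longlonglongrightarrow> 0"
    proof (intro AE_I2)
      fix y :: 'a
      obtain N where N: "norm y \<le> real N" using real_arch_simple by blast
      have "\<forall>\<^sub>F n in sequentially. t n y = 0"
        unfolding eventually_sequentially using N by (intro exI[of _ N]) (auto simp: t_def indicator_def)
      then show "(\<lambda>n. t n y) \<longlonglongrightarrow> 0" by (rule tendsto_eventually)
    qed
    show "AE y in lborel. norm (t n y) \<le> \<bar>f y\<bar>" for n by (auto simp: t_def indicator_def)
  qed (use f in auto)
  then have "(\<lambda>n. LINT y|lborel. t n y) \<longlonglongrightarrow> 0" by simp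
  then obtain n where n: "(LINT y|lborel. t n y) < e / B"
    using order_tendstoD(2)[of _ 0 sequentially "e / B"] assms(2) B(1) by (auto simp: eventually_sequentially)
  have t_int: "integrable lborel (t n)"
    by (rule Bochner_Integration.integrable_bound[OF integrable_abs[OF f]]) (auto simp: t_def indicator_def)
  have "\<bar>conv f \<phi> x\<bar> < e" if "real n + R < norm x" for x
  proof -
    have le: "\<bar>f y * \<phi> (x - y)\<bar> \<le> B * t n y" for y
    proof (cases "real n < norm y")
      case True
      then show ?thesis using mult_left_mono[OF B(2)[of "x - y"], of "\<bar>f y\<bar>"]
        by (simp add: t_def abs_mult mult.commute)
    next
      case False
      then have "R < norm (x - y)" using that norm_triangle_sub[of x y] by linarith
      then show ?thesis using R(2) B(1) by (simp add: t_def)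
    qed
    have "\<bar>conv f \<phi> x\<bar> \<le> (LINT y|lborel. \<bar>f y * \<phi> (x - y)\<bar>)"
      unfolding conv_def by (rule integral_abs_bound)
    also have "\<dots> \<le> (LINT y|lborel. B * t n y)"
      using le conv_integrable[OF assms(1)] t_int by (intro integral_mono) auto
    also have "\<dots> = B * (LINT y|lborel. t n y)" by simp
    also have "\<dots> < B * (e / B)" using n B(1) by (intro mult_strict_left_mono)
    also have "\<dots> = e" using B(1) by simp
    finally show ?thesis .
  qed
  then show ?thesis using R(1) by (intro exI[of _ "real n + R"]) auto
qed

end

lemma mean_value_gradient:
  fixes F :: "'a::euclidean_space \<Rightarrow> real"
  assumes "\<And>x. (F has_derivative (\<lambda>h. G x \<bullet> h)) (at x)"
  shows "\<exists>\<xi>. norm (\<xi> - x) \<le> norm (y - x) \<and> F y - F x = G \<xi> \<bullet> (y - x)"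
proof -
  define g where "g t = F (x + t *\<^sub>R (y - x))" for t :: real
  have "(g has_real_derivative G (x + t *\<^sub>R (y - x)) \<bullet> (y - x)) (at t)" for t
  proof -
    have "((\<lambda>t. F (x + t *\<^sub>R (y - x))) has_derivative (\<lambda>s. G (x + t *\<^sub>R (y - x)) \<bullet> (s *\<^sub>R (y - x)))) (at t)"
      by (rule has_derivative_compose[OF _ assms]) (auto intro!: derivative_eq_intros)
    then show ?thesis unfolding g_def has_field_derivative_def by (simp add: mult.commute[of _ "G _ \<bullet> _"])
  qed
  then obtain t where t: "0 < t" "t < 1" "g 1 - g 0 = (1 - 0) * (G (x + t *\<^sub>R (y - x)) \<bullet> (y - x))"
    using MVT2[of 0 1 g "\<lambda>t. G (x + t *\<^sub>R (y - x)) \<bullet> (y - x)"] by auto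
  have "t * norm (y - x) \<le> 1 * norm (y - x)" using t by (intro mult_right_mono) auto
  then show ?thesis using t by (intro exI[of _ "x + t *\<^sub>R (y - x)"]) (simp add: g_def)
qed

lemma norm_vec_less:
  fixes v :: "real ^ 'n::finite"
  assumes "\<And>i. \<bar>v $ i\<bar> < e / real CARD('n)"
  shows "norm v < e"
proof -
  have "norm v \<le> (\<Sum>i\<in>UNIV. \<bar>v $ i\<bar>)" by (rule norm_le_l1_cart)
  also have "\<dots> < (\<Sum>i\<in>(UNIV :: 'n set). e / real CARD('n))"
    using assms by (intro sum_strict_mono) auto
  finally show ?thesis by simp
qed

lemma components_uniform:
  fixes V :: "'a::metric_space \<Rightarrow> real ^ 'n::finite"
  assumes "\<And>i e. 0 < e \<Longrightarrow> \<exists>d>0. \<forall>x y. dist x y < d \<longrightarrow> \<bar>V x $ i - V y $ i\<bar> < e" and "0 < e"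
  shows "\<exists>d>0. \<forall>x y. dist x y < d \<longrightarrow> norm (V x - V y) < e"
proof -
  have "0 < e / real CARD('n)" using assms(2) by simp
  then obtain d where d: "\<And>i. 0 < d i" "\<And>i x y. dist x y < d i \<Longrightarrow> \<bar>V x $ i - V y $ i\<bar> < e / real CARD('n)"
    using assms(1) by metis
  have "norm (V x - V y) < e" if "dist x y < Min (range d)" for x y
    using d(2) that by (intro norm_vec_less) auto
  moreover have "0 < Min (range d)" using d(1) by simp
  ultimately show ?thesis by blast
qed

lemma grad_uniform:
  assumes "test_function \<phi>" "0 < e"
  shows "\<exists>d>0. \<forall>x y. dist x y < d \<longrightarrow> norm (grad \<phi> x - grad \<phi> y) < e"
proof (rule components_uniform[OF _ assms(2)])
  fix i and e :: real assume "0 < e"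
  then show "\<exists>d>0. \<forall>x y. dist x y < d \<longrightarrow> \<bar>grad \<phi> x $ i - grad \<phi> y $ i\<bar> < e"
    using cc_uniform[OF partial_deriv_cc[OF assms(1)]] by (simp add: grad_def) metis
qed

text \<open>The remainder is uniform in the base point, because the gradient of a test function is
  uniformly continuous. This permits differentiation under the integral sign with \<open>f\<close>
  merely integrable.\<close>

lemma test_function_linearization:
  assumes "test_function \<phi>" "0 < e"
  shows "\<exists>d>0. \<forall>z h. norm h < d \<longrightarrow> \<bar>\<phi> (z + h) - \<phi> z - grad \<phi> z \<bullet> h\<bar> \<le> e * norm h"
proof -
  obtain d where d: "0 < d" "\<And>x y. dist x y < d \<Longrightarrow> norm (grad \<phi> x - grad \<phi> y) < e"
    using grad_uniform[OF assms] by blast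
  have "\<bar>\<phi> (z + h) - \<phi> z - grad \<phi> z \<bullet> h\<bar> \<le> e * norm h" if "norm h < d" for z h
  proof -
    obtain \<xi> where \<xi>: "norm (\<xi> - z) \<le> norm (z + h - z)" "\<phi> (z + h) - \<phi> z = grad \<phi> \<xi> \<bullet> (z + h - z)"
      using mean_value_gradient[OF has_derivative_partials[OF test_function_differentiable[OF assms(1)]]] by blast
    have "\<bar>\<phi> (z + h) - \<phi> z - grad \<phi> z \<bullet> h\<bar> = \<bar>(grad \<phi> \<xi> - grad \<phi> z) \<bullet> h\<bar>"
      using \<xi>(2) by (simp add: inner_diff_left)
    also have "\<dots> \<le> norm (grad \<phi> \<xi> - grad \<phi> z) * norm h" by (rule Cauchy_Schwarz_ineq2)
    also have "\<dots> \<le> e * norm h"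
      using d(2)[of \<xi> z] \<xi>(1) that by (intro mult_right_mono) (auto simp: dist_norm)
    finally show ?thesis .
  qed
  then show ?thesis using d(1) by blast
qed

definition cgrad :: "(real ^ 'n::finite \<Rightarrow> real) \<Rightarrow> (real ^ 'n \<Rightarrow> real) \<Rightarrow> real ^ 'n \<Rightarrow> real ^ 'n" where
  "cgrad f \<phi> x = (\<chi> i. conv f (partial_deriv i \<phi>) x)"

text \<open>The linearization error of the convolution is the integral of \<open>f\<close> against
  the linearization error of \<phi>, which is bounded uniformly by a small multiple of the
  increment.\<close>

lemma conv_has_derivative:
  fixes f :: "real ^ 'n::finite \<Rightarrow> real"
  assumes f: "integrable lborel f" and \<phi>: "test_function \<phi>"
  shows "(conv f \<phi> has_derivative (\<lambda>h. cgrad f \<phi> x \<bullet> h)) (at x)"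
  unfolding has_derivative_at_alt
proof (intro conjI allI impI)
  show "bounded_linear (\<lambda>h. cgrad f \<phi> x \<bullet> h)" by (rule bounded_linear_inner_right)
  fix e :: real assume e: "0 < e"
  define I where "I = (LINT y|lborel. \<bar>f y\<bar>)"
  have I: "0 \<le> I" unfolding I_def by simp
  have "0 < e / (I + 1)" using e I by simp
  then obtain d where d: "0 < d"
    "\<And>z h. norm h < d \<Longrightarrow> \<bar>\<phi> (z + h) - \<phi> z - grad \<phi> z \<bullet> h\<bar> \<le> e / (I + 1) * norm h"
    using test_function_linearization[OF \<phi>] by blast
  note pd = partial_deriv_cc[OF \<phi>]
  have "norm (conv f \<phi> y - conv f \<phi> x - cgrad f \<phi> x \<bullet> (y - x)) \<le> e * norm (y - x)" if y: "norm (y - x) < d" for y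
  proof -
    define k where "k z = \<phi> (y - z) - \<phi> (x - z) - grad \<phi> (x - z) \<bullet> (y - x)" for z
    have k_eq: "k z = \<phi> (y - z) - \<phi> (x - z) - (\<Sum>i\<in>UNIV. partial_deriv i \<phi> (x - z) * (y - x) $ i)" for z
      by (simp add: k_def grad_def inner_vec_def)
    have "cgrad f \<phi> x \<bullet> (y - x) = (\<Sum>i\<in>UNIV. (LINT z|lborel. f z * partial_deriv i \<phi> (x - z)) * (y - x) $ i)"
      by (simp add: cgrad_def inner_vec_def conv_def)
    also have "\<dots> = (LINT z|lborel. (\<Sum>i\<in>UNIV. f z * partial_deriv i \<phi> (x - z) * (y - x) $ i))"
      using conv_integrable[OF f pd] by (simp add: Bochner_Integration.integral_sum)
    finally have c: "cgrad f \<phi> x \<bullet> (y - x) = (LINT z|lborel. (\<Sum>i\<in>UNIV. f z * partial_deriv i \<phi> (x - z) * (y - x) $ i))" .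
    have "conv f \<phi> y - conv f \<phi> x - cgrad f \<phi> x \<bullet> (y - x) = (LINT z|lborel. f z * k z)"
    proof -
      have "f z * k z = f z * \<phi> (y - z) - f z * \<phi> (x - z) - (\<Sum>i\<in>UNIV. f z * partial_deriv i \<phi> (x - z) * (y - x) $ i)" for z
        unfolding k_eq by (simp add: right_diff_distrib sum_distrib_left mult.assoc)
      then show ?thesis
        unfolding c conv_def using conv_integrable[OF f test_function_cc[OF \<phi>]] conv_integrable[OF f pd]
        by simp
    qed
    moreover have "\<bar>LINT z|lborel. f z * k z\<bar> \<le> (e / (I + 1) * norm (y - x)) * I"
      unfolding I_def
    proof (rule integral_mult_bounded(2)[OF f])
      note [measurable] = cc_measurable[OF cc_reflect[OF test_function_cc[OF \<phi>]]] cc_measurable[OF cc_reflect[OF pd]]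
      show "k \<in> borel_measurable borel" unfolding k_eq[abs_def] by measurable
      show "\<bar>k z\<bar> \<le> e / ((LINT y|lborel. \<bar>f y\<bar>) + 1) * norm (y - x)" for z
        using d(2)[OF y, of "x - z"] by (simp add: k_def I_def algebra_simps)
    qed
    moreover have "(e / (I + 1) * norm (y - x)) * I \<le> e * norm (y - x)"
    proof -
      have "e / (I + 1) * I \<le> e" using e I by (simp add: field_simps)
      from mult_right_mono[OF this norm_ge_zero[of "y - x"]] show ?thesis by (simp add: mult_ac)
    qed
    ultimately show ?thesis by simp
  qed
  then show "\<exists>d>0. \<forall>y. norm (y - x) < d \<longrightarrow> norm (conv f \<phi> y - conv f \<phi> x - cgrad f \<phi> x \<bullet> (y - x)) \<le> e * norm (y - x)"
    using d(1) by blast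
qed

lemma cgrad_continuous:
  fixes h :: "real ^ 'n::finite \<Rightarrow> real"
  assumes "integrable lborel h" "test_function \<phi>"
  shows "continuous_on A (cgrad h \<phi>)"
  unfolding cgrad_def[abs_def]
  by (intro continuous_on_vec_lambda conv_continuous partial_deriv_cc assms)

text \<open>Both sides are partial derivatives of the convolution of \<open>\<phi>\<close> with the reflected \<open>\<eta>\<close>.\<close>

lemma test_function_integration_by_parts:
  fixes \<eta> \<phi> :: "real ^ 'n::finite \<Rightarrow> real"
  assumes \<eta>: "test_function \<eta>" and \<phi>: "test_function \<phi>"
  shows "(LINT x|lborel. partial_deriv i \<eta> (x - y) * \<phi> x) = - (LINT x|lborel. \<eta> (x - y) * partial_deriv i \<phi> x)"
proof -
  define \<eta>' where "\<eta>' = (\<lambda>z. \<eta> (0 - z))"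
  have \<eta>': "test_function \<eta>'" "partial_deriv i \<eta>' z = - partial_deriv i \<eta> (0 - z)" for z
    unfolding \<eta>'_def by (rule test_function_reflect[OF \<eta>])+
  have int: "integrable lborel \<eta>'" "integrable lborel \<phi>"
    using cc_integrable test_function_cc \<eta>'(1) \<phi> by auto
  note meas = cc_measurable[OF test_function_cc]
  have "cgrad \<phi> \<eta>' y \<bullet> axis i 1 = cgrad \<eta>' \<phi> y \<bullet> axis i 1"
    using has_derivative_unique[OF conv_has_derivative[OF int(2) \<eta>'(1)], of _ y]
      conv_has_derivative[OF int(1) \<phi>, of y] conv_commute[of \<phi> \<eta>'] meas[OF \<phi>] meas[OF \<eta>'(1)]
    by metis
  then have "conv \<phi> (partial_deriv i \<eta>') y = conv \<eta>' (partial_deriv i \<phi>) y"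
    by (simp add: cgrad_def inner_axis)
  also have "\<dots> = conv (partial_deriv i \<phi>) \<eta>' y"
    using conv_commute meas[OF test_function_partial[OF \<phi>]] meas[OF \<eta>'(1)] by metis
  finally show ?thesis
    by (simp add: conv_def \<eta>'(2)) (simp add: \<eta>'_def mult.commute)
qed

section \<open>Difference quotients of truncated mollifications\<close>

abbreviation Lp_energy :: "real \<Rightarrow> ('a::euclidean_space \<Rightarrow> 'b::real_normed_vector) \<Rightarrow> ennreal" where
  "Lp_energy p F \<equiv> (\<integral>\<^sup>+ x. ennreal (norm (F x) powr p) \<partial>lborel)"

text \<open>The tangent of the convex function \<open>a powr p\<close> at \<open>m\<close> lies
  below its graph, with the terms arranged so that all are nonnegative.\<close>

lemma young_tangent:
  fixes p a m :: real
  assumes "1 < p" "0 \<le> a" "0 \<le> m"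
  shows "p * m powr (p - 1) * a \<le> a powr p + (p - 1) * m powr p"
proof -
  define q where "q = p / (p - 1)"
  have q: "1 < q" "1 / p + 1 / q = 1" "(p - 1) * q = p" "p / q = p - 1"
    using assms(1) by (auto simp: q_def field_simps)
  have "a * m powr (p - 1) \<le> a powr p / p + (m powr (p - 1)) powr q / q"
    using assms q by (intro Youngs_inequality) auto
  then have "a * m powr (p - 1) \<le> a powr p / p + m powr p / q" using q(3) by (simp add: powr_powr)
  then have "p * (a * m powr (p - 1)) \<le> p * (a powr p / p + m powr p / q)"
    using assms(1) by (intro mult_left_mono) auto
  also have "\<dots> = a powr p + (p / q) * m powr p" using assms(1) by (simp add: field_simps)
  finally show ?thesis by (simp only: q(4)) (simp add: mult_ac)
qed

text \<open>Jensen's inequality by integrating the tangent inequality at \<open>m\<close>, the norm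
  of the mean, against the probability density \<open>w\<close>.\<close>

lemma jensen_density:
  fixes F :: "'a::euclidean_space \<Rightarrow> 'b::{banach, second_countable_topology}"
  assumes p: "1 < p" and [measurable]: "w \<in> borel_measurable borel" "F \<in> borel_measurable borel"
    and w: "\<And>y. 0 \<le> w y" "(\<integral>\<^sup>+ y. ennreal (w y) \<partial>lborel) = 1"
    and int: "integrable lborel (\<lambda>y. w y *\<^sub>R F y)"
  shows "ennreal (norm (LINT y|lborel. w y *\<^sub>R F y) powr p) \<le> (\<integral>\<^sup>+ y. ennreal (w y * norm (F y) powr p) \<partial>lborel)"
proof (cases "(\<integral>\<^sup>+ y. ennreal (w y * norm (F y) powr p) \<partial>lborel) = \<infinity>")
  case False
  define m where "m = norm (LINT y|lborel. w y *\<^sub>R F y)"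
  obtain r where r: "(\<integral>\<^sup>+ y. ennreal (w y * norm (F y) powr p) \<partial>lborel) = ennreal r" "0 \<le> r"
    using False by (cases "\<integral>\<^sup>+ y. ennreal (w y * norm (F y) powr p) \<partial>lborel") auto
  have m: "0 \<le> m" by (simp add: m_def)
  have m1: "ennreal m \<le> (\<integral>\<^sup>+ y. ennreal (w y * norm (F y)) \<partial>lborel)"
    using integral_norm_bound_ennreal[OF int] w(1) by (simp add: m_def)
  have mp: "m powr (p - 1) * m = m powr p"
    using m p powr_add[of m "p - 1" 1] by (cases "m = 0") auto
  have "ennreal (p * m powr p) = ennreal (p * m powr (p - 1)) * ennreal m"
    using p m by (simp add: ennreal_mult[symmetric] mp mult.assoc)
  also have "\<dots> \<le> ennreal (p * m powr (p - 1)) * (\<integral>\<^sup>+ y. ennreal (w y * norm (F y)) \<partial>lborel)"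
    using m1 by (intro mult_left_mono) auto
  also have "\<dots> = (\<integral>\<^sup>+ y. ennreal (p * m powr (p - 1)) * ennreal (w y * norm (F y)) \<partial>lborel)"
    by (intro nn_integral_cmult[symmetric]) measurable
  also have "\<dots> \<le> (\<integral>\<^sup>+ y. ennreal (w y * norm (F y) powr p) + ennreal ((p - 1) * m powr p) * ennreal (w y) \<partial>lborel)"
  proof (rule nn_integral_mono)
    fix y
    have "w y * (p * m powr (p - 1) * norm (F y)) \<le> w y * (norm (F y) powr p + (p - 1) * m powr p)"
      using young_tangent[OF p norm_ge_zero m] w(1) by (intro mult_left_mono)
    then have "p * m powr (p - 1) * (w y * norm (F y)) \<le> w y * norm (F y) powr p + (p - 1) * m powr p * w y"
      by (simp add: algebra_simps)
    from ennreal_leI[OF this]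
    show "ennreal (p * m powr (p - 1)) * ennreal (w y * norm (F y)) \<le>
        ennreal (w y * norm (F y) powr p) + ennreal ((p - 1) * m powr p) * ennreal (w y)"
      using p w(1)[of y] by (simp add: ennreal_mult[symmetric] ennreal_plus[symmetric] del: ennreal_plus)
  qed
  also have "\<dots> = ennreal r + ennreal ((p - 1) * m powr p)"
    by (simp add: nn_integral_add nn_integral_cmult r w(2))
  finally have "ennreal (p * m powr p) \<le> ennreal (r + (p - 1) * m powr p)"
    using r p by simp
  then have "p * m powr p \<le> r + (p - 1) * m powr p" using r(2) p by (simp add: ennreal_le_iff del: ennreal_plus)
  then have "m powr p \<le> r" by (simp add: algebra_simps)
  then show ?thesis by (simp add: r m_def ennreal_leI)
qed simp

lemma mollifierD:
  assumes "mollifier d \<eta>"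
  shows "test_function \<eta>" "0 \<le> \<eta> x" "(LINT x|lborel. \<eta> x) = 1" "d < norm x \<Longrightarrow> \<eta> x = 0"
    "cc \<eta>" "\<eta> \<in> borel_measurable borel" "integrable lborel \<eta>"
    "(\<integral>\<^sup>+ y. ennreal (\<eta> (x - y)) \<partial>lborel) = 1" "(\<integral>\<^sup>+ y. ennreal (\<eta> (y - x)) \<partial>lborel) = 1"
proof -
  show t: "test_function \<eta>" and nn: "0 \<le> \<eta> x" and one: "(LINT x|lborel. \<eta> x) = 1"
    and "d < norm x \<Longrightarrow> \<eta> x = 0" for x
    using assms by (auto simp: mollifier_def not_le[symmetric])
  show c: "cc \<eta>" using t by (rule test_function_cc)
  then show [measurable]: "\<eta> \<in> borel_measurable borel" and i: "integrable lborel \<eta>"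
    using cc_measurable cc_integrable by auto
  have 1: "(\<integral>\<^sup>+ y. ennreal (\<eta> y) \<partial>lborel) = 1"
    using nn_integral_eq_integral[OF i] nn one by simp
  then show "(\<integral>\<^sup>+ y. ennreal (\<eta> (x - y)) \<partial>lborel) = 1"
    using nn_integral_lborel_reflect[of "\<lambda>y. ennreal (\<eta> y)" x] by simp
  show "(\<integral>\<^sup>+ y. ennreal (\<eta> (y - x)) \<partial>lborel) = 1"
    using nn_integral_lborel_translate[of "\<lambda>y. ennreal (\<eta> y)" "- x"] 1 by simp
qed

lemma nn_integral_mollifier_average:
  fixes \<rho> :: "real ^ 'n::finite \<Rightarrow> real"
  assumes \<rho>: "mollifier d \<rho>" and [measurable]: "G \<in> borel_measurable borel"
  shows "(\<integral>\<^sup>+ x. (\<integral>\<^sup>+ y. ennreal (\<rho> (x - y)) * G y \<partial>lborel) \<partial>lborel) = (\<integral>\<^sup>+ y. G y \<partial>lborel)"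
proof -
  note [measurable] = mollifierD(6)[OF \<rho>]
  have "(\<integral>\<^sup>+ x. (\<integral>\<^sup>+ y. ennreal (\<rho> (x - y)) * G y \<partial>lborel) \<partial>lborel) =
      (\<integral>\<^sup>+ y. (\<integral>\<^sup>+ x. ennreal (\<rho> (x - y)) * G y \<partial>lborel) \<partial>lborel)"
    by (intro lborel_pair.Fubini') measurable
  also have "\<dots> = (\<integral>\<^sup>+ y. G y \<partial>lborel)"
    using mollifierD(9)[OF \<rho>] by (intro nn_integral_cong) (simp add: nn_integral_multc)
  finally show ?thesis .
qed

lemma jensen_mollifier:
  fixes \<rho> :: "real ^ 'n::finite \<Rightarrow> real" and F :: "real ^ 'n \<Rightarrow> 'b::{banach, second_countable_topology}"
  assumes \<rho>: "mollifier d \<rho>" and p: "1 < p" and [measurable]: "F \<in> borel_measurable borel"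
    and int: "\<And>x. integrable lborel (\<lambda>y. \<rho> (x - y) *\<^sub>R F y)"
  shows "Lp_energy p (\<lambda>x. LINT y|lborel. \<rho> (x - y) *\<^sub>R F y)
    \<le> Lp_energy p F"
proof -
  note [measurable] = mollifierD(6)[OF \<rho>]
  have "Lp_energy p (\<lambda>x. LINT y|lborel. \<rho> (x - y) *\<^sub>R F y)
      \<le> (\<integral>\<^sup>+ x. (\<integral>\<^sup>+ y. ennreal (\<rho> (x - y)) * ennreal (norm (F y) powr p) \<partial>lborel) \<partial>lborel)"
  proof (rule nn_integral_mono)
    fix x
    show "ennreal (norm (LINT y|lborel. \<rho> (x - y) *\<^sub>R F y) powr p)
        \<le> (\<integral>\<^sup>+ y. ennreal (\<rho> (x - y)) * ennreal (norm (F y) powr p) \<partial>lborel)"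
      using jensen_density[OF p _ _ _ _ int[of x]] mollifierD(2,8)[OF \<rho>]
      by (simp add: ennreal_mult)
  qed
  then show ?thesis using nn_integral_mollifier_average[OF \<rho>, of "\<lambda>y. ennreal (norm (F y) powr p)"] by simp
qed

lemma conv_Lp:
  fixes \<rho> :: "real ^ 'n::finite \<Rightarrow> real"
  assumes \<rho>: "mollifier d \<rho>" and p: "1 < p" and h: "integrable lborel h"
  shows "(\<integral>\<^sup>+ x. ennreal (\<bar>conv h \<rho> x\<bar> powr p) \<partial>lborel) \<le> (\<integral>\<^sup>+ y. ennreal (\<bar>h y\<bar> powr p) \<partial>lborel)"
proof -
  have "conv h \<rho> x = (LINT y|lborel. \<rho> (x - y) *\<^sub>R h y)" for x by (simp add: conv_def mult.commute)
  moreover have "integrable lborel (\<lambda>y. \<rho> (x - y) *\<^sub>R h y)" for x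
    using conv_integrable[OF h mollifierD(5)[OF \<rho>]] by (simp add: mult.commute)
  ultimately show ?thesis using jensen_mollifier[OF \<rho> p, of h] h by simp
qed

lemma measurable_vec_lambda [measurable (raw)]:
  fixes h :: "'b \<Rightarrow> 'n::finite \<Rightarrow> real"
  assumes "\<And>i. (\<lambda>z. h z i) \<in> borel_measurable N"
  shows "(\<lambda>z. \<chi> i. h z i) \<in> borel_measurable N"
proof -
  have "(\<chi> i. h z i) = (\<Sum>i\<in>UNIV. h z i *\<^sub>R axis i 1)" for z
    by (simp add: vec_eq_iff axis_def if_distrib cong: if_cong)
  moreover have "(\<lambda>z. \<Sum>i\<in>UNIV. h z i *\<^sub>R (axis i 1 :: real ^ 'n)) \<in> borel_measurable N"
    using assms by (intro borel_measurable_sum borel_measurable_scaleR) auto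
  ultimately show ?thesis by simp
qed

lemma AE_lebesgue_iff: "(AE x in lebesgue. P x) \<longleftrightarrow> (AE x in lborel. P x)"
  by (rule AE_completion_iff)

text \<open>Weak gradients are only Lebesgue measurable, while the Jensen and Fubini arguments work
  with Borel functions and \<open>lborel\<close>.\<close>

lemma locally_integrable_borel_version:
  fixes g :: "real ^ 'n::finite \<Rightarrow> real ^ 'n"
  assumes "locally_integrable g"
  obtains g' where "g' \<in> borel_measurable borel" "AE x in lborel. g x = g' x"
    "g \<in> borel_measurable lebesgue"
proof -
  have "(\<lambda>x. indicator (cball 0 (real n)) x *\<^sub>R g x) \<in> borel_measurable lebesgue" for n :: nat
    using assms unfolding locally_integrable_def set_integrable_def by (meson borel_measurable_integrable compact_cball)
  moreover have "(\<lambda>n. indicator (cball 0 (real n)) x *\<^sub>R g x) \<longlonglongrightarrow> g x" for x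
  proof -
    obtain N where "norm x \<le> real N" using real_arch_simple by blast
    then have "\<forall>\<^sub>F n in sequentially. indicator (cball 0 (real n)) x *\<^sub>R g x = g x"
      unfolding eventually_sequentially by (intro exI[of _ N]) (auto simp: indicator_def)
    then show ?thesis by (rule tendsto_eventually)
  qed
  ultimately have g: "g \<in> borel_measurable lebesgue" by (rule borel_measurable_LIMSEQ_metric)
  have "\<exists>h. h \<in> borel_measurable borel \<and> (AE x in lborel. g x $ i = h x)" for i
    using completion_ex_borel_measurable_real[of "\<lambda>x. g x $ i" lborel] measurable_vec_nth[OF g] by auto
  then obtain h where h: "\<And>i. h i \<in> borel_measurable borel" "\<And>i. AE x in lborel. g x $ i = h i x" by metis
  show ?thesis
  proof
    show "(\<lambda>x. \<chi> i. h i x) \<in> borel_measurable borel"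
      using h(1) by (intro measurable_vec_lambda)
    have "AE x in lborel. \<forall>i. g x $ i = h i x" using h(2) by (simp add: AE_all_countable)
    then show "AE x in lborel. g x = (\<chi> i. h i x)" by eventually_elim (simp add: vec_eq_iff)
  qed (rule g)
qed


text \<open>Testing the weak gradient with the reflected, translated mollifier shows that
  \<open>cgrad\<close> is the mollification of \<open>g\<close>. Jensen's inequality then gives the
  bound.\<close>

lemma weak_gradient_conv:
  fixes f :: "real ^ 'n::finite \<Rightarrow> real"
  assumes g: "weak_gradient f g" and f: "integrable lborel f" and \<eta>: "mollifier d \<eta>" and p: "1 < p"
  shows "Lp_energy p (cgrad f \<eta>) \<le> (\<integral>\<^sup>+ x. ennreal (norm (g x) powr p) \<partial>lebesgue)"
proof -
  have loc: "locally_integrable g" using g by (simp add: weak_gradient_def)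
  obtain g' where g' [measurable]: "g' \<in> borel_measurable borel" and ae: "AE x in lborel. g x = g' x"
    and gm: "g \<in> borel_measurable lebesgue"
    using locally_integrable_borel_version[OF loc] .
  note [measurable] = mollifierD(6)[OF \<eta>]
  have [measurable]: "f \<in> borel_measurable borel" using f by simp
  have int: "integrable lborel (\<lambda>y. \<eta> (x - y) *\<^sub>R g' y)" for x
  proof -
    obtain B where B: "0 < B" "\<And>x. \<bar>\<eta> x\<bar> \<le> B" using cc_bounded[OF mollifierD(5)[OF \<eta>]] by blast
    have m0: "(\<lambda>y. indicat_real (cball x d) y *\<^sub>R g' y) \<in> borel_measurable lborel"
      using g' by (intro borel_measurable_scaleR borel_measurable_indicator) auto
    note m = measurable_completion[OF m0]
    have "set_integrable lebesgue (cball x d) g"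
      using loc by (auto simp: locally_integrable_def)
    then have "integrable lebesgue (\<lambda>y. indicator (cball x d) y *\<^sub>R g' y)"
      unfolding set_integrable_def
      by (rule Bochner_Integration.integrable_cong_AE_imp)
        (use ae m in \<open>auto simp: AE_lebesgue_iff elim: eventually_mono\<close>)
    then have "integrable lborel (\<lambda>y. indicator (cball x d) y *\<^sub>R g' y)"
      using integrable_completion[OF m0] by simp
    from integrable_mult_right[OF integrable_norm[OF this], of B]
    have "integrable lborel (\<lambda>y. B * norm (indicator (cball x d) y *\<^sub>R g' y))" .
    then show ?thesis
    proof (rule Bochner_Integration.integrable_bound)
      have "norm (\<eta> (x - y) *\<^sub>R g' y) \<le> norm (B * norm (indicator (cball x d) y *\<^sub>R g' y))" for y
      proof (cases "y \<in> cball x d")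
        case True
        then show ?thesis using B mult_right_mono[OF B(2)[of "x - y"], of "norm (g' y)"] by simp
      next
        case False
        then show ?thesis using mollifierD(4)[OF \<eta>, of "x - y"] by (simp add: dist_norm)
      qed
      then show "AE y in lborel. norm (\<eta> (x - y) *\<^sub>R g' y) \<le> norm (B * norm (indicator (cball x d) y *\<^sub>R g' y))"
        by simp
    qed measurable
  qed
  have "cgrad f \<eta> x = (LINT y|lborel. \<eta> (x - y) *\<^sub>R g' y)" for x
  proof -
    have "conv f (partial_deriv i \<eta>) x = (LINT y|lborel. \<eta> (x - y) *\<^sub>R g' y) $ i" for i
    proof -
      note t = test_function_reflect[OF mollifierD(1)[OF \<eta>]]
      note [measurable] = cc_measurable[OF partial_deriv_cc[OF mollifierD(1)[OF \<eta>]]]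
      have "conv f (partial_deriv i \<eta>) x = - (LINT y|lborel. f y * partial_deriv i (\<lambda>y. \<eta> (x - y)) y)"
        by (simp add: conv_def t(2))
      also have "(LINT y|lborel. f y * partial_deriv i (\<lambda>y. \<eta> (x - y)) y) =
          (LINT y|lebesgue. f y * partial_deriv i (\<lambda>y. \<eta> (x - y)) y)"
        by (intro integral_completion[symmetric]) (simp add: t(2))
      also have "\<dots> = - (LINT y|lebesgue. g y $ i * \<eta> (x - y))"
        using g t(1) by (simp add: weak_gradient_def)
      also have "(LINT y|lebesgue. g y $ i * \<eta> (x - y)) = (LINT y|lebesgue. g' y $ i * \<eta> (x - y))"
      proof (rule integral_cong_AE)
        show "AE y in lebesgue. g y $ i * \<eta> (x - y) = g' y $ i * \<eta> (x - y)"
          using ae unfolding AE_lebesgue_iff by eventually_elim simp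
        show m: "(\<lambda>y. g' y $ i * \<eta> (x - y)) \<in> borel_measurable lebesgue"
          by (intro measurable_completion) measurable
        have "(\<lambda>y. \<eta> (x - y)) \<in> borel_measurable lborel" by measurable
        then show "(\<lambda>y. g y $ i * \<eta> (x - y)) \<in> borel_measurable lebesgue"
          by (intro borel_measurable_times measurable_vec_nth[OF gm] measurable_completion)
      qed
      also have "\<dots> = (LINT y|lborel. g' y $ i * \<eta> (x - y))"
        by (intro integral_completion) measurable
      also have "\<dots> = (LINT y|lborel. \<eta> (x - y) *\<^sub>R g' y) $ i"
        using integral_bounded_linear[OF bounded_linear_vec_nth[of i] int[of x]] by (simp add: mult.commute)
      finally show ?thesis by simp
    qed
    then show ?thesis by (simp add: cgrad_def vec_eq_iff)
  qed
  then have "Lp_energy p (cgrad f \<eta>) \<le> Lp_energy p g'"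
    using jensen_mollifier[OF \<eta> p g' int] by simp
  also have "\<dots> = Lp_energy p g"
    using ae by (intro nn_integral_cong_AE) (auto elim: eventually_mono)
  finally show ?thesis by (simp add: nn_integral_completion)
qed

section \<open>Powers as superpositions of positive parts\<close>

text \<open>Taylor's formula with integral remainder at 0. The weight is the second derivative of
  the power, nonnegative as \<open>1 < p\<close>.\<close>

lemma powr_layers:
  fixes a p :: real
  assumes p: "1 < p" and a: "0 \<le> a"
  shows "ennreal (a powr p) =
    (\<integral>\<^sup>+ c. indicator {0..} c * ennreal (p * (p - 1) * c powr (p - 2)) * ennreal (a - c) \<partial>lborel)"
proof -
  define F where "F c = p * (p - 1) * c powr (p - 2) * (a - c)" for c
  \<comment> \<open>For \<open>p < 2\<close> the weight is singular at 0: the antiderivative is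
    continuous on the closed interval, but is differentiated only inside it.\<close>
  have "(F has_integral (p * a * a powr (p - 1) - (p - 1) * a powr p) - (p * a * 0 powr (p - 1) - (p - 1) * 0 powr p)) {0..a}"
  proof (rule fundamental_theorem_of_calculus_interior[OF a])
    show "continuous_on {0..a} (\<lambda>c. p * a * c powr (p - 1) - (p - 1) * c powr p)"
      using p by (intro continuous_intros continuous_on_powr') auto
    fix c assume c: "c \<in> {0<..<a}"
    have e: "c powr (p - 1) = c * c powr (p - 2)" using c powr_add[of c 1 "p - 2"] by simp
    have "((\<lambda>c. p * a * c powr (p - 1) - (p - 1) * c powr p) has_real_derivative
        p * a * ((p - 1) * c powr (p - 1 - 1)) - (p - 1) * (p * c powr (p - 1))) (at c)"
      using c by (auto intro!: derivative_eq_intros)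
    moreover have "p * a * ((p - 1) * c powr (p - 1 - 1)) - (p - 1) * (p * c powr (p - 1)) = F c"
      unfolding F_def e by (simp add: algebra_simps)
    ultimately show "((\<lambda>c. p * a * c powr (p - 1) - (p - 1) * c powr p) has_vector_derivative F c) (at c)"
      by (simp add: has_real_derivative_iff_has_vector_derivative)
  qed
  moreover have "p * a * a powr (p - 1) = p * a powr p"
    using a p powr_add[of a 1 "p - 1"] by (cases "a = 0") auto
  ultimately have "(F has_integral a powr p) {0..a}" using p by (simp add: left_diff_distrib)
  then have "(\<integral>\<^sup>+ c. ennreal (indicator {0..a} c * F c) \<partial>lborel) = ennreal (a powr p)"
    by (rule nn_integral_has_integral_lebesgue[rotated]) (use p in \<open>simp add: F_def\<close>)
  moreover have "ennreal (indicator {0..a} c * F c) =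
      indicator {0..} c * ennreal (p * (p - 1) * c powr (p - 2)) * ennreal (a - c)" for c
    using p by (auto simp: F_def indicator_def ennreal_mult'' ennreal_neg)
  ultimately show ?thesis by simp
qed

text \<open>A power is a positive superposition of the functions \<open>(a - c)\<close> cut off at
  0, so it suffices to compare the integrals of these for every \<open>c\<close>.\<close>

lemma powr_domination:
  fixes X Y :: "'a::euclidean_space \<Rightarrow> real"
  assumes p: "1 < p" and [measurable]: "X \<in> borel_measurable borel" "Y \<in> borel_measurable borel"
    and nn: "\<And>x. 0 \<le> X x" "\<And>x. 0 \<le> Y x"
    and le: "\<And>c. 0 \<le> c \<Longrightarrow> (\<integral>\<^sup>+ x. ennreal (X x - c) \<partial>lborel) \<le> (\<integral>\<^sup>+ x. ennreal (Y x - c) \<partial>lborel)"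
  shows "(\<integral>\<^sup>+ x. ennreal (X x powr p) \<partial>lborel) \<le> (\<integral>\<^sup>+ x. ennreal (Y x powr p) \<partial>lborel)"
proof -
  have layers: "(\<integral>\<^sup>+ x. ennreal (Z x powr p) \<partial>lborel) = (\<integral>\<^sup>+ c. indicator {0..} c *
      ennreal (p * (p - 1) * c powr (p - 2)) * (\<integral>\<^sup>+ x. ennreal (Z x - c) \<partial>lborel) \<partial>lborel)"
    if [measurable]: "Z \<in> borel_measurable borel" and "\<And>x. 0 \<le> Z x" for Z :: "'a \<Rightarrow> real"
  proof -
    have "(\<integral>\<^sup>+ x. ennreal (Z x powr p) \<partial>lborel) = (\<integral>\<^sup>+ x. (\<integral>\<^sup>+ c. indicator {0..} c *
      ennreal (p * (p - 1) * c powr (p - 2)) * ennreal (Z x - c) \<partial>lborel) \<partial>lborel)"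
      using that(2) by (simp add: powr_layers[OF p])
    also have "\<dots> = (\<integral>\<^sup>+ c. (\<integral>\<^sup>+ x. indicator {0..} c *
      ennreal (p * (p - 1) * c powr (p - 2)) * ennreal (Z x - c) \<partial>lborel) \<partial>lborel)"
      by (intro lborel_pair.Fubini') measurable
    also have "\<dots> = (\<integral>\<^sup>+ c. indicator {0..} c *
      ennreal (p * (p - 1) * c powr (p - 2)) * (\<integral>\<^sup>+ x. ennreal (Z x - c) \<partial>lborel) \<partial>lborel)"
      by (intro nn_integral_cong nn_integral_cmult) measurable
    finally show ?thesis .
  qed
  show ?thesis
    unfolding layers[OF assms(2) nn(1)] layers[OF assms(3) nn(2)]
    by (intro nn_integral_mono) (use le in \<open>auto simp: indicator_def intro!: mult_left_mono\<close>)
qed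

context
  fixes f \<eta> :: "real ^ 'n::finite \<Rightarrow> real" and d :: real
  assumes f: "nice f" and \<eta>: "mollifier d \<eta>"
begin

lemma conv_mollifier_nonneg: "0 \<le> conv f \<eta> x"
  unfolding conv_def using niceD(1)[OF f] mollifierD(2)[OF \<eta>] by (intro Bochner_Integration.integral_nonneg) auto

lemma nn_integral_conv_mollifier: "(\<integral>\<^sup>+ x. ennreal (conv f \<eta> x) \<partial>lborel) = (\<integral>\<^sup>+ x. ennreal (f x) \<partial>lborel)"
proof -
  have "ennreal (conv f \<eta> x) = (\<integral>\<^sup>+ y. ennreal (\<eta> (x - y)) * ennreal (f y) \<partial>lborel)" for x
  proof -
    have "(\<integral>\<^sup>+ y. ennreal (f y * \<eta> (x - y)) \<partial>lborel) = ennreal (conv f \<eta> x)"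
      unfolding conv_def using niceD(1)[OF f] mollifierD(2)[OF \<eta>]
      by (intro nn_integral_eq_integral conv_integrable niceD(3)[OF f] mollifierD(5)[OF \<eta>]) auto
    then show ?thesis using niceD(1)[OF f] mollifierD(2)[OF \<eta>] by (simp add: ennreal_mult mult.commute)
  qed
  then show ?thesis using nn_integral_mollifier_average[OF \<eta>, of "\<lambda>y. ennreal (f y)"] niceD(4)[OF f] by simp
qed

lemma nice_conv_mollifier: "nice (conv f \<eta>)"
proof -
  have c: "continuous_on UNIV (conv f \<eta>)" using conv_continuous[OF niceD(3)[OF f] mollifierD(5)[OF \<eta>]] .
  moreover have "integrable lborel (conv f \<eta>)"
    using borel_measurable_continuous_onI[OF c] niceD(5)[OF f] nn_integral_conv_mollifier conv_mollifier_nonneg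
    by (intro integrableI_bounded) auto
  ultimately show ?thesis using conv_mollifier_nonneg by (simp add: nice_def)
qed

lemma cgrad_uniform:
  assumes "0 < e" shows "\<exists>r>0. \<forall>x y. dist x y < r \<longrightarrow> norm (cgrad f \<eta> x - cgrad f \<eta> y) < e"
proof (rule components_uniform[OF _ assms])
  fix i and e :: real assume "0 < e"
  then show "\<exists>d>0. \<forall>x y. dist x y < d \<longrightarrow> \<bar>cgrad f \<eta> x $ i - cgrad f \<eta> y $ i\<bar> < e"
    using conv_uniform[OF niceD(3)[OF f] partial_deriv_cc[OF mollifierD(1)[OF \<eta>]]] by (simp add: cgrad_def)
qed

lemma cgrad_vanish:
  assumes "0 < e" shows "\<exists>R>0. \<forall>x. R < norm x \<longrightarrow> norm (cgrad f \<eta> x) < e"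
proof -
  have "0 < e / real CARD('n)" using assms by simp
  then obtain R where R: "\<And>i. 0 < R i" "\<And>i x. R i < norm x \<Longrightarrow> \<bar>cgrad f \<eta> x $ i\<bar> < e / real CARD('n)"
    using conv_vanish[OF niceD(3)[OF f] partial_deriv_cc[OF mollifierD(1)[OF \<eta>]]] by (simp add: cgrad_def) metis
  have "norm (cgrad f \<eta> x) < e" if "Max (range R) < norm x" for x
    using R(2) that by (intro norm_vec_less) auto
  moreover have "0 < Max (range R)" using R(1) by (simp add: Max_gr_iff)
  ultimately show ?thesis by blast
qed

text \<open>The convolution and its gradient both vanish at infinity. Thus truncation at a positive
  height leaves a compact region in which \<open>u\<close> or a slightly larger \<open>v\<close> can
  be positive.\<close>

lemma compact_slope_set:
  assumes "0 < e" shows "compact {x. e \<le> conv f \<eta> x + norm (cgrad f \<eta> x)}"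
proof -
  obtain R1 where R1: "\<And>x. R1 < norm x \<Longrightarrow> \<bar>conv f \<eta> x\<bar> < e / 2"
    using conv_vanish[OF niceD(3)[OF f] mollifierD(5)[OF \<eta>], of "e / 2"] assms by auto
  obtain R2 where R2: "\<And>x. R2 < norm x \<Longrightarrow> norm (cgrad f \<eta> x) < e / 2"
    using cgrad_vanish[of "e / 2"] assms by auto
  have "norm x \<le> max R1 R2" if "e \<le> conv f \<eta> x + norm (cgrad f \<eta> x)" for x
  proof (rule ccontr)
    assume "\<not> norm x \<le> max R1 R2"
    then have "\<bar>conv f \<eta> x\<bar> < e / 2" "norm (cgrad f \<eta> x) < e / 2" using R1 R2 by auto
    then show False using that by linarith
  qed
  then have "bounded {x. e \<le> conv f \<eta> x + norm (cgrad f \<eta> x)}" by (auto simp: bounded_iff)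
  moreover have "closed {x. e \<le> conv f \<eta> x + norm (cgrad f \<eta> x)}"
    using niceD(2)[OF nice_conv_mollifier] cgrad_continuous[OF niceD(3)[OF f] mollifierD(1)[OF \<eta>]] by (intro closed_Collect_le continuous_intros)
  ultimately show ?thesis by (simp add: compact_eq_bounded_closed)
qed

text \<open>\<open>v\<close> is the positive part of \<open>conv f \<eta> - e + r (\<bar>cgrad f \<eta>\<bar> + \<kappa>)\<close>, with \<open>r\<close> so small that \<open>cgrad f \<eta>\<close>
  varies by less than \<open>\<kappa>\<close> over balls of radius \<open>r\<close>.\<close>

lemma slope_pair:
  assumes e: "0 < e" and \<kappa>: "0 < \<kappa>" and p: "1 < p"
  defines "u \<equiv> \<lambda>x. max 0 (conv f \<eta> x - e)"
  defines "K \<equiv> {x. e / 2 \<le> conv f \<eta> x + norm (cgrad f \<eta> x)}"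
  shows "nice u"
    and "\<exists>r0>0. \<forall>r. 0 < r \<and> r \<le> r0 \<longrightarrow> (\<exists>v B. nice v \<and> (\<forall>x. v x \<le> B) \<and>
      (\<forall>x y. dist x y < r \<longrightarrow> u y \<le> v x) \<and>
      (\<integral>\<^sup>+ x. ennreal ((v x - u x) powr p) \<partial>lborel) \<le>
      ennreal (r powr p) * (\<integral>\<^sup>+ x. indicator K x * ennreal ((norm (cgrad f \<eta> x) + \<kappa>) powr p) \<partial>lborel))"
proof -
  let ?F = "conv f \<eta>" and ?V = "cgrad f \<eta>"
  have K: "compact K" unfolding K_def using compact_slope_set[of "e / 2"] e by simp
  have contF: "continuous_on UNIV ?F" using niceD(2)[OF nice_conv_mollifier] .
  have nice: "nice w \<and> cc w" if "continuous_on UNIV w" "\<And>x. 0 \<le> w x" "\<And>x. x \<notin> K \<Longrightarrow> w x = 0" for w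
  proof -
    have "cc w" using ccI[OF that(1) K that(3)] .
    then show ?thesis using cc_integrable[of w] that by (simp add: nice_def)
  qed
  have u0: "u x = 0" if "x \<notin> K" for x 
  proof -
    have "?F x + norm (?V x) < e / 2" using that by (simp add: K_def not_le)
    then have "?F x < e" using e norm_ge_zero[of "?V x"] by linarith
    then show ?thesis by (simp add: u_def)
  qed
  have "continuous_on UNIV u" unfolding u_def by (intro continuous_intros contF)
  then show "nice u" using nice[of u] u0 by (simp add: u_def)
  obtain r1 where r1: "0 < r1" "\<And>x y. dist x y < r1 \<Longrightarrow> norm (?V x - ?V y) < \<kappa>"
    using cgrad_uniform[OF \<kappa>] by blast
  \<comment> \<open>The bounds control the oscillation of the gradient and give
    \<open>r \<le> 1\<close> and \<open>r * \<kappa> \<le> e / 2\<close>. By the last two,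
    \<open>v\<close> vanishes where the convolution plus its slope is below
    \<open>e / 2\<close>.\<close>
  define r0 where "r0 = min r1 (min 1 (e / (2 * \<kappa>)))"
  have r0: "0 < r0" "r0 \<le> r1" "r0 \<le> 1" "r0 \<le> e / (2 * \<kappa>)" using r1(1) e \<kappa> by (auto simp: r0_def)
  have "\<exists>v B. nice v \<and> (\<forall>x. v x \<le> B) \<and> (\<forall>x y. dist x y < r \<longrightarrow> u y \<le> v x) \<and>
      (\<integral>\<^sup>+ x. ennreal ((v x - u x) powr p) \<partial>lborel) \<le>
      ennreal (r powr p) * (\<integral>\<^sup>+ x. indicator K x * ennreal ((norm (?V x) + \<kappa>) powr p) \<partial>lborel)"
    if r: "0 < r" "r \<le> r0" for r
  proof -
    define v where "v x = max 0 (?F x - e + r * (norm (?V x) + \<kappa>))" for x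
    have r\<kappa>: "r * \<kappa> \<le> e / 2"
    proof -
      have "r * \<kappa> \<le> (e / (2 * \<kappa>)) * \<kappa>" using r r0 \<kappa> by (intro mult_right_mono) auto
      then show ?thesis using \<kappa> by simp
    qed
    have rV: "r * norm (?V x) \<le> norm (?V x)" for x
      using mult_right_mono[of r 1 "norm (?V x)"] r r0 by simp
    have v0: "v x = 0" if "x \<notin> K" for x
      using that r\<kappa> rV[of x] by (auto simp: v_def K_def distrib_left)
    have contv: "continuous_on UNIV v"
      unfolding v_def by (intro continuous_intros contF cgrad_continuous[OF niceD(3)[OF f] mollifierD(1)[OF \<eta>]])
    have v: "nice v" "cc v" using nice[of v] v0 contv by (auto simp: v_def)
    obtain B where B: "\<And>x. \<bar>v x\<bar> \<le> B" using cc_bounded[OF v(2)] by blast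
    have uv: "u y \<le> v x" if "dist x y < r" for x y
    proof -
      obtain \<xi> where \<xi>: "norm (\<xi> - x) \<le> norm (y - x)" "?F y - ?F x = ?V \<xi> \<bullet> (y - x)"
        using mean_value_gradient[OF conv_has_derivative[OF niceD(3)[OF f] mollifierD(1)[OF \<eta>]]] by blast
      have "dist \<xi> x < r1" using \<xi>(1) that r r0 by (simp add: dist_norm norm_minus_commute)
      then have "norm (?V \<xi>) \<le> norm (?V x) + \<kappa>"
        using r1(2)[of \<xi> x] norm_triangle_sub[of "?V \<xi>" "?V x"] by simp
      have "?V \<xi> \<bullet> (y - x) \<le> norm (?V \<xi>) * norm (y - x)" by (rule norm_cauchy_schwarz)
      also have "\<dots> \<le> (norm (?V x) + \<kappa>) * r"
        using \<open>norm (?V \<xi>) \<le> norm (?V x) + \<kappa>\<close> that \<kappa>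
        by (intro mult_mono) (auto simp: dist_norm norm_minus_commute)
      finally have "?F y \<le> ?F x + r * (norm (?V x) + \<kappa>)" using \<xi>(2) by (simp add: mult.commute)
      then show ?thesis by (auto simp: u_def v_def)
    qed
    have "(\<integral>\<^sup>+ x. ennreal ((v x - u x) powr p) \<partial>lborel) \<le>
        (\<integral>\<^sup>+ x. ennreal (r powr p) * (indicator K x * ennreal ((norm (?V x) + \<kappa>) powr p)) \<partial>lborel)"
    proof (rule nn_integral_mono)
      fix x
      show "ennreal ((v x - u x) powr p) \<le> ennreal (r powr p) * (indicator K x * ennreal ((norm (?V x) + \<kappa>) powr p))"
      proof (cases "x \<in> K")
        case True
        have q: "0 \<le> r * (norm (?V x) + \<kappa>)" using r \<kappa> by simp
        then have "0 \<le> v x - u x" "v x - u x \<le> r * (norm (?V x) + \<kappa>)" by (auto simp: u_def v_def max_def)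
        then have "(v x - u x) powr p \<le> (r * (norm (?V x) + \<kappa>)) powr p" using p by (intro powr_mono2) auto
        also have "\<dots> = r powr p * (norm (?V x) + \<kappa>) powr p" using r \<kappa> by (simp add: powr_mult)
        finally show ?thesis using True by (simp add: ennreal_leI ennreal_mult[symmetric])
      qed (use u0 v0 in simp)
    qed
    also have "\<dots> = ennreal (r powr p) * (\<integral>\<^sup>+ x. indicator K x * ennreal ((norm (?V x) + \<kappa>) powr p) \<partial>lborel)"
    proof -
      have [measurable]: "K \<in> sets borel" using K by (simp add: borel_compact)
      have [measurable]: "?V \<in> borel_measurable borel" using cgrad_continuous[OF niceD(3)[OF f] mollifierD(1)[OF \<eta>]] by (rule borel_measurable_continuous_onI)
      show ?thesis by (intro nn_integral_cmult) measurable
    qed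
    finally show ?thesis using v(1) B uv by (intro exI[of _ v] exI[of _ B]) (auto intro: abs_le_D1)
  qed
  then show "\<exists>r0>0. \<forall>r. 0 < r \<and> r \<le> r0 \<longrightarrow> (\<exists>v B. nice v \<and> (\<forall>x. v x \<le> B) \<and>
      (\<forall>x y. dist x y < r \<longrightarrow> u y \<le> v x) \<and>
      (\<integral>\<^sup>+ x. ennreal ((v x - u x) powr p) \<partial>lborel) \<le>
      ennreal (r powr p) * (\<integral>\<^sup>+ x. indicator K x * ennreal ((norm (?V x) + \<kappa>) powr p) \<partial>lborel))"
    using r0(1) by (intro exI[of _ r0]) blast
qed

end

section \<open>Energy inequality for mollified functions\<close>

lemma conv_mollifier_close:
  fixes h :: "real ^ 'n::finite \<Rightarrow> real"
  assumes h: "integrable lborel h" and \<eta>: "mollifier d \<eta>" and close: "\<And>y. dist y x \<le> d \<Longrightarrow> \<bar>h y - h x\<bar> \<le> e"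
  shows "\<bar>conv h \<eta> x - h x\<bar> \<le> e"
proof -
  have i: "integrable lborel (\<lambda>y. \<eta> (x - y))" using cc_integrable[OF cc_reflect[OF mollifierD(5)[OF \<eta>]]] .
  have one: "(LINT y|lborel. \<eta> (x - y)) = 1"
    using integral_lborel_reflect[OF mollifierD(6)[OF \<eta>]] mollifierD(3)[OF \<eta>] by simp
  note ci = conv_integrable[OF h mollifierD(5)[OF \<eta>], of x]
  have "conv h \<eta> x - h x = (LINT y|lborel. h y * \<eta> (x - y) - h x * \<eta> (x - y))"
    unfolding conv_def using ci i one by simp
  also have "\<bar>\<dots>\<bar> \<le> (LINT y|lborel. \<bar>h y * \<eta> (x - y) - h x * \<eta> (x - y)\<bar>)" by (rule integral_abs_bound)
  also have "\<dots> \<le> (LINT y|lborel. e * \<eta> (x - y))"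
  proof (intro integral_mono)
    fix y
    show "\<bar>h y * \<eta> (x - y) - h x * \<eta> (x - y)\<bar> \<le> e * \<eta> (x - y)"
    proof (cases "dist y x \<le> d")
      case True
      have "\<bar>h y * \<eta> (x - y) - h x * \<eta> (x - y)\<bar> = \<bar>h y - h x\<bar> * \<eta> (x - y)"
        using mollifierD(2)[OF \<eta>, of "x - y"] by (simp add: left_diff_distrib[symmetric] abs_mult)
      then show ?thesis using close[OF True] mollifierD(2)[OF \<eta>] by (simp add: mult_right_mono)
    next
      case False
      then show ?thesis using mollifierD(4)[OF \<eta>, of "x - y"] by (simp add: dist_norm norm_minus_commute)
    qed
  qed (use ci i in auto)
  also have "\<dots> = e" using one by simp
  finally show ?thesis .
qed

lemma reflected_integrable:
  fixes h :: "real ^ 'n::finite \<Rightarrow> real"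
  assumes h: "integrable lborel h" and \<rho>: "cc \<rho>"
  shows "integrable lborel (\<lambda>z. \<rho> z * h (x - z))" and "conv h \<rho> x = (LINT z|lborel. \<rho> z * h (x - z))"
proof -
  have [measurable]: "h \<in> borel_measurable borel" using h by simp
  note [measurable] = cc_measurable[OF \<rho>]
  have "integrable (distr lborel borel (\<lambda>y. x - y)) (\<lambda>y. h y * \<rho> (x - y))"
    unfolding distr_lborel_reflect by (rule conv_integrable[OF h \<rho>])
  then have "integrable lborel (\<lambda>z. h (x - z) * \<rho> (x - (x - z)))"
    by (subst (asm) integrable_distr_eq) auto
  then show "integrable lborel (\<lambda>z. \<rho> z * h (x - z))" by (simp add: mult.commute)
  show "conv h \<rho> x = (LINT z|lborel. \<rho> z * h (x - z))"
    using conv_commute[of h \<rho>] by (simp add: conv_def)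
qed

text \<open>One-sided bounds in all directions are enough: along the unit vector of the gradient the
  directional derivative is its norm, and the quotients in that direction converge to it.\<close>

lemma cgrad_le_liminf:
  fixes \<rho> :: "real ^ 'n::finite \<Rightarrow> real" and h :: "real ^ 'n \<Rightarrow> real" and D :: "nat \<Rightarrow> real"
  assumes \<rho>: "test_function \<rho>" and h: "integrable lborel h" and p: "1 < p"
    and r: "\<And>j. 0 < r j" "r \<longlonglongrightarrow> 0"
    and D: "\<And>j e. norm e = 1 \<Longrightarrow> conv h \<rho> (x + r j *\<^sub>R e) - conv h \<rho> x \<le> r j * D j"
  shows "ennreal (norm (cgrad h \<rho> x) powr p) \<le> liminf (\<lambda>j. ennreal (\<bar>D j\<bar> powr p))"
proof (cases "cgrad h \<rho> x = 0")
  case False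
  define c where "c = cgrad h \<rho> x"
  define e where "e = c /\<^sub>R norm c"
  have e: "norm e = 1" "c \<bullet> e = norm c"
    using False by (auto simp: e_def c_def dot_square_norm power2_eq_square)
  define q where "q j = (conv h \<rho> (x + r j *\<^sub>R e) - conv h \<rho> x) / r j" for j
  have "((\<lambda>t. conv h \<rho> (x + t *\<^sub>R e)) has_real_derivative norm c) (at 0)"
  proof -
    have "(conv h \<rho> has_derivative (\<lambda>k. c \<bullet> k)) (at (x + 0 *\<^sub>R e))"
      using conv_has_derivative[OF h \<rho>, of x] by (simp add: c_def)
    then have "((\<lambda>t. conv h \<rho> (x + t *\<^sub>R e)) has_derivative (\<lambda>s. c \<bullet> (s *\<^sub>R e))) (at 0)"
      by (rule has_derivative_compose[rotated]) (auto intro!: derivative_eq_intros)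
    then show ?thesis using e(2) by (simp add: has_field_derivative_def mult_commute_abs)
  qed
  then have lim: "((\<lambda>t. (conv h \<rho> (x + t *\<^sub>R e) - conv h \<rho> x) / t) \<longlongrightarrow> norm c) (at 0)"
    by (simp add: DERIV_def)
  have "filterlim r (at 0) sequentially"
    using r by (intro filterlim_atI) (auto intro!: always_eventually simp: less_imp_neq[symmetric])
  from filterlim_compose[OF lim this] have "q \<longlonglongrightarrow> norm c" by (simp add: q_def[abs_def])
  then have "(\<lambda>j. max 0 (q j)) \<longlonglongrightarrow> max 0 (norm c)" by (intro tendsto_intros)
  then have "(\<lambda>j. max 0 (q j) powr p) \<longlonglongrightarrow> norm c powr p"
    using p False by (intro tendsto_powr) (auto simp: c_def)
  then have "(\<lambda>j. ennreal (max 0 (q j) powr p)) \<longlonglongrightarrow> ennreal (norm c powr p)" by (rule tendsto_ennrealI)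
  then have "ennreal (norm c powr p) = liminf (\<lambda>j. ennreal (max 0 (q j) powr p))"
    by (intro lim_imp_Liminf[symmetric]) auto
  also have "\<dots> \<le> liminf (\<lambda>j. ennreal (\<bar>D j\<bar> powr p))"
  proof (intro Liminf_mono always_eventually allI ennreal_leI powr_mono2)
    show "max 0 (q j) \<le> \<bar>D j\<bar>" for j
    proof -
      have "q j \<le> D j" using D[OF e(1), of j] r(1)[of j] by (simp add: q_def field_simps)
      then show ?thesis by linarith
    qed
  qed (use p in auto)
  finally show ?thesis by (simp add: c_def)
qed simp

text \<open>The energy argument uses only these order and integral properties. The bound on
  \<open>v\<close> in the last one excludes infinite values, which \<open>css_op\<close> would turn
  into 0.\<close>

locale rearrangement =
  fixes W :: "(real ^ 'n::finite \<Rightarrow> real) \<Rightarrow> real ^ 'n \<Rightarrow> real"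
  assumes W_measurable: "nice u \<Longrightarrow> W u \<in> borel_measurable borel"
    and W_nonneg: "0 \<le> W u x"
    and W_integral: "nice u \<Longrightarrow> (\<integral>\<^sup>+ x. ennreal (W u x) \<partial>lborel) \<le> (\<integral>\<^sup>+ x. ennreal (u x) \<partial>lborel)"
    and W_contraction: "nice u \<Longrightarrow> nice v \<Longrightarrow> 0 \<le> c \<Longrightarrow>
      (\<integral>\<^sup>+ x. ennreal (W v x - W u x - c) \<partial>lborel) \<le> (\<integral>\<^sup>+ x. ennreal (v x - u x - c) \<partial>lborel)"
    and W_near: "nice u \<Longrightarrow> nice v \<Longrightarrow> (\<And>x y. dist x y < r \<Longrightarrow> u y \<le> v x) \<Longrightarrow> (\<And>x. v x \<le> B) \<Longrightarrow>
      dist x y < r \<Longrightarrow> W u y \<le> W v x"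
begin

lemma W_integrable: "nice u \<Longrightarrow> integrable lborel (W u)"
  using W_measurable[of u] W_integral[of u] niceD(5)[of u] W_nonneg[of u]
  by (intro integrableI_bounded) (auto intro: le_less_trans)

lemma W_powr_contraction:
  assumes u: "nice u" and v: "nice v" and uv: "\<And>x. u x \<le> v x" "\<And>x. W u x \<le> W v x" and p: "1 < p"
  shows "(\<integral>\<^sup>+ x. ennreal ((W v x - W u x) powr p) \<partial>lborel) \<le> (\<integral>\<^sup>+ x. ennreal ((v x - u x) powr p) \<partial>lborel)"
  using W_measurable[OF u] W_measurable[OF v] niceD(4)[OF u] niceD(4)[OF v] uv W_contraction[OF u v]
  by (intro powr_domination[OF p]) auto

lemma W_L1_contraction:
  assumes u: "nice u" and v: "nice v"
  shows "(\<integral>\<^sup>+ x. ennreal \<bar>W u x - W v x\<bar> \<partial>lborel) \<le> (\<integral>\<^sup>+ x. ennreal \<bar>u x - v x\<bar> \<partial>lborel)"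
proof -
  note [measurable] = W_measurable[OF u] W_measurable[OF v] niceD(4)[OF u] niceD(4)[OF v]
  have abs: "ennreal \<bar>a - b\<bar> = ennreal (a - b) + ennreal (b - a)" for a b :: real
    by (cases "a \<le> b") (auto simp: ennreal_neg)
  show ?thesis
    unfolding abs using W_contraction[OF u v, of 0] W_contraction[OF v u, of 0]
    by (simp add: nn_integral_add add_mono)
qed

text \<open>The difference quotients of the mollification of \<open>W u\<close>, in every direction, are bounded by the
  mollification of \<open>(W v - W u) / r\<close>.\<close>

lemma mollified_gradient_truncation:
  fixes \<rho> \<eta> :: "real ^ 'n \<Rightarrow> real"
  assumes f: "nice f" and \<eta>: "mollifier d \<eta>" and \<rho>: "mollifier d' \<rho>" and p: "1 < p" and e: "0 < e"
  shows "Lp_energy p (\<lambda>x. cgrad (W (\<lambda>x. max 0 (conv f \<eta> x - e))) \<rho> x)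
    \<le> Lp_energy p (cgrad f \<eta>)"
proof -
  define u where "u = (\<lambda>x. max 0 (conv f \<eta> x - e))"
  define K where "K = {x. e / 2 \<le> conv f \<eta> x + norm (cgrad f \<eta> x)}"
  have K: "compact K" unfolding K_def using compact_slope_set[OF f \<eta>, of "e / 2"] e by simp
  define \<kappa> where "\<kappa> j = 1 / real (Suc j)" for j
  have \<kappa>: "0 < \<kappa> j" "\<kappa> j \<le> 1" for j by (auto simp: \<kappa>_def)
  have \<kappa>0: "\<kappa> \<longlonglongrightarrow> 0" unfolding \<kappa>_def by (rule LIMSEQ_Suc[OF lim_1_over_n])
  define J where "J j = (\<integral>\<^sup>+ x. indicator K x * ennreal ((norm (cgrad f \<eta> x) + \<kappa> j) powr p) \<partial>lborel)" for j
  have u: "nice u" unfolding u_def using slope_pair(1)[OF f \<eta> e \<kappa>(1) p] .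
  define Q where "Q j r v B \<longleftrightarrow> nice v \<and> (\<forall>x. v x \<le> B) \<and> (\<forall>x y. dist x y < r \<longrightarrow> u y \<le> v x) \<and>
      (\<integral>\<^sup>+ x. ennreal ((v x - u x) powr p) \<partial>lborel) \<le> ennreal (r powr p) * J j" for j r v and B :: real
  have "\<exists>r. 0 < r \<and> r \<le> \<kappa> j \<and> (\<exists>v B. Q j r v B)" for j
  proof -
    obtain r0 where r0: "0 < r0" "\<And>r. 0 < r \<Longrightarrow> r \<le> r0 \<Longrightarrow> \<exists>v B. Q j r v B"
      using slope_pair(2)[OF f \<eta> e \<kappa>(1)[of j] p] unfolding Q_def u_def J_def K_def by blast
    \<comment> \<open>Keeping \<open>r\<close> below \<open>\<kappa> j\<close> lets a single
      sequence drive both the radius and the slope error to 0.\<close>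
    show ?thesis using r0(1) \<kappa>(1)[of j] by (intro exI[of _ "min r0 (\<kappa> j)"] conjI r0(2)) auto
  qed
  then obtain r where r: "\<And>j. 0 < r j" "\<And>j. r j \<le> \<kappa> j" and Qr: "\<And>j. \<exists>v B. Q j (r j) v B"
    by metis
  from Qr obtain v B where Qv: "\<And>j. Q j (r j) (v j) (B j)" by metis
  then have v: "\<And>j. nice (v j)" "\<And>j x. v j x \<le> B j" "\<And>j x y. dist x y < r j \<Longrightarrow> u y \<le> v j x"
      "\<And>j. (\<integral>\<^sup>+ x. ennreal ((v j x - u x) powr p) \<partial>lborel) \<le> ennreal (r j powr p) * J j"
    unfolding Q_def by blast+
  have r0: "r \<longlonglongrightarrow> 0"
    using r by (intro tendsto_sandwich[OF _ _ tendsto_const \<kappa>0]) (auto intro!: always_eventually less_imp_le)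
  have Wuv: "W u y \<le> W (v j) x" if "dist x y < r j" for j x y
    using W_near[OF u v(1) v(3) v(2) that] .
  define h where "h j y = W (v j) y - W u y" for j y
  have h: "integrable lborel (h j)" for j
    unfolding h_def using W_integrable[OF u] W_integrable[OF v(1)] by simp
  define D where "D j x = conv (h j) \<rho> x / r j" for j x
  note [measurable] = W_measurable[OF u] W_measurable[OF v(1)] mollifierD(6)[OF \<rho>]
  have DLp: "(\<integral>\<^sup>+ x. ennreal (\<bar>D j x\<bar> powr p) \<partial>lborel) \<le> J j" for j
  proof -
    have "(\<integral>\<^sup>+ x. ennreal (\<bar>D j x\<bar> powr p) \<partial>lborel) =
        (\<integral>\<^sup>+ x. ennreal ((1 / r j) powr p) * ennreal (\<bar>conv (h j) \<rho> x\<bar> powr p) \<partial>lborel)"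
      using r(1)[of j] by (intro nn_integral_cong) (simp add: D_def ennreal_mult[symmetric] powr_divide)
    also have "\<dots> = ennreal ((1 / r j) powr p) * (\<integral>\<^sup>+ x. ennreal (\<bar>conv (h j) \<rho> x\<bar> powr p) \<partial>lborel)"
      using borel_measurable_continuous_onI[OF conv_continuous[OF h mollifierD(5)[OF \<rho>]]]
      by (intro nn_integral_cmult) simp
    also have "\<dots> \<le> ennreal ((1 / r j) powr p) * (\<integral>\<^sup>+ x. ennreal (\<bar>h j x\<bar> powr p) \<partial>lborel)"
      by (intro mult_left_mono conv_Lp[OF \<rho> p h]) auto
    also have "(\<integral>\<^sup>+ x. ennreal (\<bar>h j x\<bar> powr p) \<partial>lborel) = (\<integral>\<^sup>+ x. ennreal ((W (v j) x - W u x) powr p) \<partial>lborel)"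
      using Wuv r(1) by (simp add: h_def)
    also have "\<dots> \<le> (\<integral>\<^sup>+ x. ennreal ((v j x - u x) powr p) \<partial>lborel)"
      using v(3) Wuv r(1) by (intro W_powr_contraction[OF u v(1) _ _ p]) auto
    also have "\<dots> \<le> ennreal (r j powr p) * J j" by (rule v(4))
    finally have "(\<integral>\<^sup>+ x. ennreal (\<bar>D j x\<bar> powr p) \<partial>lborel) \<le> ennreal ((1 / r j) powr p) * (ennreal (r j powr p) * J j)"
      by (simp add: mult_left_mono)
    also have "\<dots> = J j"
      using r(1)[of j] by (simp add: mult.assoc[symmetric] ennreal_mult[symmetric] powr_mult[symmetric])
    finally show ?thesis .
  qed
  have diff: "conv (W u) \<rho> (x + r j *\<^sub>R e) - conv (W u) \<rho> x \<le> r j * D j x" if "norm e = 1" for j x and e :: "real ^ 'n"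
  proof -
    \<comment> \<open>The domination is available at distances strictly below \<open>r j\<close>;
      the length \<open>r j\<close> itself follows by continuity of the convolution.\<close>
    have le: "conv (W u) \<rho> (x + s *\<^sub>R e) - conv (W u) \<rho> x \<le> r j * D j x" if "0 < s" "s < r j" for s
    proof -
      note ri = reflected_integrable[OF W_integrable[OF u] mollifierD(5)[OF \<rho>]]
        reflected_integrable[OF h mollifierD(5)[OF \<rho>]]
      have "conv (W u) \<rho> (x + s *\<^sub>R e) - conv (W u) \<rho> x =
          (LINT z|lborel. \<rho> z * W u (x + s *\<^sub>R e - z) - \<rho> z * W u (x - z))"
        unfolding ri(2) using ri(1) by simp
      also have "\<dots> \<le> (LINT z|lborel. \<rho> z * h j (x - z))"
      proof (intro integral_mono)
        fix z
        have "dist (x - z) (x + s *\<^sub>R e - z) < r j" using that \<open>norm e = 1\<close> by (simp add: dist_norm)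
        then have "W u (x + s *\<^sub>R e - z) - W u (x - z) \<le> h j (x - z)" using Wuv by (simp add: h_def)
        from mult_left_mono[OF this mollifierD(2)[OF \<rho>, of z]]
        show "\<rho> z * W u (x + s *\<^sub>R e - z) - \<rho> z * W u (x - z) \<le> \<rho> z * h j (x - z)"
          by (simp add: right_diff_distrib)
      qed (use ri in auto)
      also have "\<dots> = r j * D j x" unfolding ri(4)[symmetric] using r(1)[of j] by (simp add: D_def)
      finally show ?thesis .
    qed
    have "isCont (\<lambda>s. conv (W u) \<rho> (x + s *\<^sub>R e) - conv (W u) \<rho> x) (r j)"
      using conv_continuous[OF W_integrable[OF u] mollifierD(5)[OF \<rho>], of UNIV]
      by (intro continuous_intros isCont_o2[of "r j" "\<lambda>s. x + s *\<^sub>R e" "conv (W u) \<rho>"]) (auto simp: continuous_on_eq_continuous_at)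
    then have "((\<lambda>s. conv (W u) \<rho> (x + s *\<^sub>R e) - conv (W u) \<rho> x) \<longlongrightarrow>
        conv (W u) \<rho> (x + r j *\<^sub>R e) - conv (W u) \<rho> x) (at_left (r j))"
      unfolding isCont_def by (rule filterlim_mono) (auto simp: at_le)
    then show ?thesis
      by (rule tendsto_upperbound)
        (use le r(1)[of j] in \<open>auto simp: eventually_at_left_field intro!: exI[of _ 0]\<close>)
  qed
  have "Lp_energy p (cgrad (W u) \<rho>) \<le>
      (\<integral>\<^sup>+ x. liminf (\<lambda>j. ennreal (\<bar>D j x\<bar> powr p)) \<partial>lborel)"
    by (intro nn_integral_mono cgrad_le_liminf[OF mollifierD(1)[OF \<rho>] W_integrable[OF u] p r(1) r0 diff])
  also have "\<dots> \<le> liminf (\<lambda>j. \<integral>\<^sup>+ x. ennreal (\<bar>D j x\<bar> powr p) \<partial>lborel)"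
  proof (rule nn_integral_liminf)
    fix j
    have [measurable]: "conv (h j) \<rho> \<in> borel_measurable borel"
      using borel_measurable_continuous_onI[OF conv_continuous[OF h mollifierD(5)[OF \<rho>]]] .
    show "(\<lambda>x. ennreal (\<bar>D j x\<bar> powr p)) \<in> borel_measurable lborel" unfolding D_def by measurable
  qed
  also have "\<dots> \<le> liminf J" by (intro Liminf_mono always_eventually allI DLp)
  also have "\<dots> \<le> Lp_energy p (cgrad f \<eta>)"
  proof -
    have [measurable]: "K \<in> sets borel" using K by (simp add: borel_compact)
    have [measurable]: "cgrad f \<eta> \<in> borel_measurable borel"
      using cgrad_continuous[OF niceD(3)[OF f] mollifierD(1)[OF \<eta>]] by (rule borel_measurable_continuous_onI)
    have "bounded (cgrad f \<eta> ` K)"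
      using K cgrad_continuous[OF niceD(3)[OF f] mollifierD(1)[OF \<eta>]] by (intro compact_imp_bounded compact_continuous_image)
    then obtain C where C: "\<And>x. x \<in> K \<Longrightarrow> norm (cgrad f \<eta> x) \<le> C" by (auto simp: bounded_iff)
    \<comment> \<open>On the compact set \<open>K\<close> a constant dominates, and it is integrable
      because \<open>K\<close> has finite measure.\<close>
    have "J \<longlonglongrightarrow> (\<integral>\<^sup>+ x. indicator K x * ennreal (norm (cgrad f \<eta> x) powr p) \<partial>lborel)"
      unfolding J_def
    proof (rule nn_integral_dominated_convergence[where w = "\<lambda>x. ennreal ((C + 1) powr p) * indicator K x"])
      have "emeasure lborel K < \<infinity>" using K by (rule emeasure_compact_finite)
      then show "(\<integral>\<^sup>+ x. ennreal ((C + 1) powr p) * indicator K x \<partial>lborel) < \<infinity>"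
        by (simp add: nn_integral_cmult_indicator ennreal_mult_less_top)
      show "AE x in lborel. indicator K x * ennreal ((norm (cgrad f \<eta> x) + \<kappa> j) powr p) \<le> ennreal ((C + 1) powr p) * indicator K x" for j
      proof (intro AE_I2)
        fix x
        have "(norm (cgrad f \<eta> x) + \<kappa> j) powr p \<le> (C + 1) powr p" if "x \<in> K"
          using C[OF that] \<kappa>[of j] p norm_ge_zero[of "cgrad f \<eta> x"] by (intro powr_mono2) linarith+
        then show "indicator K x * ennreal ((norm (cgrad f \<eta> x) + \<kappa> j) powr p) \<le> ennreal ((C + 1) powr p) * indicator K x"
          by (auto simp: indicator_def ennreal_leI)
      qed
      show "AE x in lborel. (\<lambda>j. indicator K x * ennreal ((norm (cgrad f \<eta> x) + \<kappa> j) powr p)) \<longlonglongrightarrow> indicator K x * ennreal (norm (cgrad f \<eta> x) powr p)"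
      proof (intro AE_I2)
        fix x
        have "(\<lambda>j. norm (cgrad f \<eta> x) + \<kappa> j) \<longlonglongrightarrow> norm (cgrad f \<eta> x) + 0" by (intro tendsto_intros \<kappa>0)
        then have "(\<lambda>j. (norm (cgrad f \<eta> x) + \<kappa> j) powr p) \<longlonglongrightarrow> norm (cgrad f \<eta> x) powr p"
          using p \<kappa>(1) by (intro tendsto_powr') (auto intro!: always_eventually add_nonneg_nonneg less_imp_le)
        then show "(\<lambda>j. indicator K x * ennreal ((norm (cgrad f \<eta> x) + \<kappa> j) powr p)) \<longlonglongrightarrow> indicator K x * ennreal (norm (cgrad f \<eta> x) powr p)"
          by (cases "x \<in> K") (auto intro: tendsto_ennrealI)
      qed
    qed measurable
    then have "liminf J = (\<integral>\<^sup>+ x. indicator K x * ennreal (norm (cgrad f \<eta> x) powr p) \<partial>lborel)"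
      by (intro lim_imp_Liminf) auto
    also have "\<dots> \<le> Lp_energy p (cgrad f \<eta>)"
      by (intro nn_integral_mono) (auto simp: indicator_def)
    finally show ?thesis .
  qed
  finally show ?thesis by (simp add: u_def)
qed

text \<open>The mollifications are truncated at heights tending to 0 and converge to
  \<open>f\<close> in \<open>L^1\<close>. Since \<open>W\<close> is an \<open>L^1\<close>
  contraction and \<rho> is fixed, the mollified gradients converge pointwise, and Fatou's lemma
  transfers the bound.\<close>

lemma mollified_gradient_bound:
  fixes \<rho> :: "real ^ 'n \<Rightarrow> real"
  assumes f: "nice f" and g: "weak_gradient f g" and \<rho>: "mollifier d \<rho>" and p: "1 < p"
  shows "Lp_energy p (cgrad (W f) \<rho>) \<le> (\<integral>\<^sup>+ x. ennreal (norm (g x) powr p) \<partial>lebesgue)"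
    (is "_ \<le> ?A")
proof -
  define \<epsilon> where "\<epsilon> m = 1 / real (Suc m)" for m
  have \<epsilon>: "0 < \<epsilon> m" for m by (simp add: \<epsilon>_def)
  have \<epsilon>0: "\<epsilon> \<longlonglongrightarrow> 0" unfolding \<epsilon>_def by (rule LIMSEQ_Suc[OF lim_1_over_n])
  obtain \<eta> :: "nat \<Rightarrow> real ^ 'n \<Rightarrow> real" where \<eta>: "\<And>m. mollifier (\<epsilon> m) (\<eta> m)" using mollifier_exists[OF \<epsilon>] by metis
  define u where "u m = (\<lambda>x. max 0 (conv f (\<eta> m) x - \<epsilon> m))" for m
  have u: "nice (u m)" for m unfolding u_def by (rule slope_pair(1)[OF f \<eta> \<epsilon> \<epsilon>[of 0] p])
  have conv_lim: "(\<lambda>m. conv f (\<eta> m) x) \<longlonglongrightarrow> f x" for x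
  proof (rule LIMSEQ_I)
    fix e :: real assume "0 < e"
    then obtain r where r: "0 < r" "\<And>y. dist y x < r \<Longrightarrow> dist (f y) (f x) < e / 2"
      using niceD(2)[OF f] unfolding continuous_on_iff by (metis UNIV_I half_gt_zero)
    have "\<forall>\<^sub>F m in sequentially. \<epsilon> m < r" using order_tendstoD(2)[OF \<epsilon>0 r(1)] .
    then obtain N where N: "\<And>m. N \<le> m \<Longrightarrow> \<epsilon> m < r" by (auto simp: eventually_sequentially)
    have close: "\<bar>conv f (\<eta> m) x - f x\<bar> \<le> e / 2" if "N \<le> m" for m
      using r(2) N[OF that] by (intro conv_mollifier_close[OF niceD(3)[OF f] \<eta>]) (auto simp: dist_real_def intro: less_imp_le)
    then show "\<exists>N. \<forall>m\<ge>N. norm (conv f (\<eta> m) x - f x) < e"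
    proof (intro exI allI impI)
      fix m assume "N \<le> m"
      then show "norm (conv f (\<eta> m) x - f x) < e" using close[of m] \<open>0 < e\<close>
        unfolding real_norm_def by linarith
    qed
  qed
  \<comment> \<open>Scheffe's lemma: pointwise convergence gives convergence in \<open>L^1\<close>,
    as the masses do not exceed that of \<open>f\<close>.\<close>
  have "(\<lambda>m. \<integral>\<^sup>+ x. ennreal (norm (u m x - f x)) \<partial>lborel) \<longlonglongrightarrow> 0"
  proof (rule Scheffe_lemma2)
    show "u m \<in> borel_measurable lborel" for m using niceD(4)[OF u] by simp
    show "integrable lborel f" using niceD(3)[OF f] .
    show "AE x in lborel. (\<lambda>m. u m x) \<longlonglongrightarrow> f x"
    proof (rule AE_I2)
      fix x
      have "(\<lambda>m. max 0 (conv f (\<eta> m) x - \<epsilon> m)) \<longlonglongrightarrow> max 0 (f x - 0)" by (intro tendsto_intros conv_lim \<epsilon>0)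
      then show "(\<lambda>m. u m x) \<longlonglongrightarrow> f x" using niceD(1)[OF f, of x] by (simp add: u_def)
    qed
    show "(\<integral>\<^sup>+ x. ennreal (norm (u m x)) \<partial>lborel) \<le> (\<integral>\<^sup>+ x. ennreal (norm (f x)) \<partial>lborel)" for m
    proof -
      have "(\<integral>\<^sup>+ x. ennreal (norm (u m x)) \<partial>lborel) \<le> (\<integral>\<^sup>+ x. ennreal (conv f (\<eta> m) x) \<partial>lborel)"
        using conv_mollifier_nonneg[OF f \<eta>] \<epsilon>[of m] by (intro nn_integral_mono ennreal_leI) (auto simp: u_def)
      then show ?thesis using nn_integral_conv_mollifier[OF f \<eta>] niceD(1)[OF f] by simp
    qed
  qed
  then have uf: "(\<lambda>m. \<integral>\<^sup>+ x. ennreal \<bar>u m x - f x\<bar> \<partial>lborel) \<longlonglongrightarrow> 0" by simp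
  have L1: "(\<lambda>m. \<integral>\<^sup>+ x. ennreal \<bar>W (u m) x - W f x\<bar> \<partial>lborel) \<longlonglongrightarrow> 0"
    by (rule tendsto_sandwich[OF always_eventually always_eventually tendsto_const uf])
      (use W_L1_contraction[OF u f] in simp_all)
  have int: "integrable lborel (\<lambda>x. W (u m) x - W f x)" for m
    using W_integrable[OF u] W_integrable[OF f] by simp
  have "(\<lambda>m. LINT x|lborel. \<bar>W (u m) x - W f x\<bar>) \<longlonglongrightarrow> 0"
  proof -
    have "(\<integral>\<^sup>+ x. ennreal \<bar>W (u m) x - W f x\<bar> \<partial>lborel) = ennreal (LINT x|lborel. \<bar>W (u m) x - W f x\<bar>)" for m
      using integrable_abs[OF int] by (intro nn_integral_eq_integral) auto
    then have "(\<lambda>m. ennreal (LINT x|lborel. \<bar>W (u m) x - W f x\<bar>)) \<longlonglongrightarrow> ennreal 0" using L1 by simp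
    then show ?thesis by (rule tendsto_ennrealD) (auto intro!: always_eventually)
  qed
  note L1' = this
  have lim: "(\<lambda>m. cgrad (W (u m)) \<rho> x) \<longlonglongrightarrow> cgrad (W f) \<rho> x" for x
  proof (rule vec_tendstoI)
    fix i
    have cc: "cc (partial_deriv i \<rho>)" using partial_deriv_cc[OF mollifierD(1)[OF \<rho>]] .
    obtain B where B: "\<And>x. \<bar>partial_deriv i \<rho> x\<bar> \<le> B" using cc_bounded[OF cc] by blast
    have le: "\<bar>conv (W (u m)) (partial_deriv i \<rho>) x - conv (W f) (partial_deriv i \<rho>) x\<bar>
        \<le> B * (LINT x|lborel. \<bar>W (u m) x - W f x\<bar>)" for m
    proof -
      have "conv (W (u m)) (partial_deriv i \<rho>) x - conv (W f) (partial_deriv i \<rho>) x =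
          conv (\<lambda>x. W (u m) x - W f x) (partial_deriv i \<rho>) x"
        unfolding conv_def using conv_integrable[OF W_integrable[OF u] cc] conv_integrable[OF W_integrable[OF f] cc]
        by (simp add: left_diff_distrib)
      then show ?thesis using conv_bounded[OF int cc B] by simp
    qed
    have lim0: "(\<lambda>m. B * (LINT x|lborel. \<bar>W (u m) x - W f x\<bar>)) \<longlonglongrightarrow> 0"
      using tendsto_mult_left[OF L1', of B] by simp
    have "(\<lambda>m. conv (W (u m)) (partial_deriv i \<rho>) x - conv (W f) (partial_deriv i \<rho>) x) \<longlonglongrightarrow> 0"
      by (rule Lim_null_comparison[OF always_eventually lim0]) (simp only: real_norm_def le simp_thms)
    then show "(\<lambda>m. cgrad (W (u m)) \<rho> x $ i) \<longlonglongrightarrow> cgrad (W f) \<rho> x $ i"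
      by (simp add: cgrad_def LIM_zero_iff)
  qed
  have "ennreal (norm (cgrad (W f) \<rho> x) powr p) = liminf (\<lambda>m. ennreal (norm (cgrad (W (u m)) \<rho> x) powr p))" for x
    using p by (intro lim_imp_Liminf[symmetric] tendsto_ennrealI tendsto_powr' tendsto_norm lim) auto
  then have "Lp_energy p (cgrad (W f) \<rho>) =
      (\<integral>\<^sup>+ x. liminf (\<lambda>m. ennreal (norm (cgrad (W (u m)) \<rho> x) powr p)) \<partial>lborel)" by simp
  also have "\<dots> \<le> liminf (\<lambda>m. \<integral>\<^sup>+ x. ennreal (norm (cgrad (W (u m)) \<rho> x) powr p) \<partial>lborel)"
  proof (rule nn_integral_liminf)
    fix m
    have [measurable]: "cgrad (W (u m)) \<rho> \<in> borel_measurable borel"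
      by (rule borel_measurable_continuous_onI[OF cgrad_continuous[OF W_integrable[OF u] mollifierD(1)[OF \<rho>]]])
    show "(\<lambda>x. ennreal (norm (cgrad (W (u m)) \<rho> x) powr p)) \<in> borel_measurable lborel" by measurable
  qed
  also have "\<dots> \<le> liminf (\<lambda>m::nat. ?A)"
  proof (intro Liminf_mono always_eventually allI)
    fix m
    show "Lp_energy p (cgrad (W (u m)) \<rho>) \<le> ?A"
      using mollified_gradient_truncation[OF f \<eta> \<rho> p \<epsilon>, of m m] weak_gradient_conv[OF g niceD(3)[OF f] \<eta> p, of m]
      unfolding u_def by (rule order_trans)
  qed
  also have "\<dots> = ?A" by (simp add: Liminf_const)
  finally show ?thesis .
qed

end

section \<open>Strong convergence of mollified gradients\<close>

lemma powr_strict_tangent: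
  fixes p x m :: real
  assumes p: "1 < p" and "0 \<le> x" "0 \<le> m" "x \<noteq> m"
  shows "m powr p + p * m powr (p - 1) * (x - m) < x powr p"
proof -
  have mv: "\<exists>z. a < z \<and> z < b \<and> b powr p - a powr p = p * z powr (p - 1) * (b - a)" if "0 \<le> a" "a < b" for a b :: real
  proof -
    have "continuous_on {a..b} (\<lambda>z. z powr p)"
      by (rule continuous_on_powr'[OF continuous_on_id continuous_on_const]) (use p that in auto)
    moreover have "((\<lambda>z. z powr p) has_derivative (*) (p * z powr (p - 1))) (at z)" if "a < z" for z
    proof -
      have "((\<lambda>z. z powr p) has_real_derivative p * z powr (p - 1)) (at z)"
        using that \<open>0 \<le> a\<close> by (auto intro!: derivative_eq_intros)
      then show ?thesis by (simp add: has_field_derivative_def)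
    qed
    ultimately show ?thesis using mvt[OF that(2), of "\<lambda>z. z powr p" "\<lambda>z. (*) (p * z powr (p - 1))"] by metis
  qed
  show ?thesis
  proof (cases "m < x")
    case True
    then obtain z where z: "m < z" "z < x" "x powr p - m powr p = p * z powr (p - 1) * (x - m)" using mv assms by blast
    have "m powr (p - 1) < z powr (p - 1)" using z assms p by (intro powr_less_mono2) auto
    then have "p * m powr (p - 1) * (x - m) < p * z powr (p - 1) * (x - m)" using p True by simp
    then show ?thesis using z(3) by simp
  next
    case False
    then have xm: "x < m" using assms by simp
    then obtain z where z: "x < z" "z < m" "m powr p - x powr p = p * z powr (p - 1) * (m - x)" using mv assms by blast
    have "z powr (p - 1) < m powr (p - 1)" using z assms p by (intro powr_less_mono2) auto
    then have "p * z powr (p - 1) * (m - x) < p * m powr (p - 1) * (m - x)" using p xm by simp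
    then have "m powr p - x powr p < p * m powr (p - 1) * (m - x)" using z(3) by simp
    then show ?thesis by (simp add: algebra_simps)
  qed
qed

text \<open>The defect in the midpoint convexity of the \<open>p\<close>-th power of the
  norm.\<close>

definition midpoint_gap :: "real \<Rightarrow> 'a::real_normed_vector \<Rightarrow> 'a \<Rightarrow> real" where
  "midpoint_gap p a b = (norm a powr p + norm b powr p) / 2 - norm ((a + b) /\<^sub>R 2) powr p"

text \<open>Two inequalities are chained: the triangle inequality and convexity of the real power. A
  zero gap makes both sharp; the second gives equal norms, the first parallel vectors.\<close>

lemma
  fixes a b :: "'a::real_inner"
  assumes p: "1 < p"
  shows midpoint_gap_nonneg: "0 \<le> midpoint_gap p a b" and midpoint_gap_eq_0: "midpoint_gap p a b = 0 \<Longrightarrow> a = b"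
proof -
  define m where "m = (norm a + norm b) / 2"
  have m: "0 \<le> m" by (simp add: m_def)
  have le: "norm ((a + b) /\<^sub>R 2) \<le> m" using norm_triangle_ineq[of a b] by (simp add: m_def)
  then have mid: "norm ((a + b) /\<^sub>R 2) powr p \<le> m powr p" using p by (intro powr_mono2) auto
  have sum0: "p * m powr (p - 1) * (norm a - m) + p * m powr (p - 1) * (norm b - m) = 0"
  proof -
    have "(norm a - m) + (norm b - m) = 0" using m_def by argo
    then show ?thesis by (metis distrib_left mult_zero_right)
  qed
  have t: "m powr p + p * m powr (p - 1) * (x - m) \<le> x powr p" if "0 \<le> x" for x
    using powr_strict_tangent[OF p that m] by (cases "x = m") (auto intro: less_imp_le)
  have conv: "m powr p \<le> (norm a powr p + norm b powr p) / 2"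
    using t[of "norm a"] t[of "norm b"] sum0 by simp
  then show "0 \<le> midpoint_gap p a b" using mid by (simp add: midpoint_gap_def)
  assume 0: "midpoint_gap p a b = 0"
  have ab: "norm a = norm b"
  proof (rule ccontr)
    assume "norm a \<noteq> norm b"
    then have "norm a \<noteq> m" by (simp add: m_def field_simps)
    then have "m powr p < (norm a powr p + norm b powr p) / 2"
      using powr_strict_tangent[OF p norm_ge_zero m, of a] t[of "norm b"] sum0 by simp
    then show False using 0 mid by (simp add: midpoint_gap_def)
  qed
  then have "norm ((a + b) /\<^sub>R 2) powr p = norm a powr p" using 0 by (simp add: midpoint_gap_def)
  then have "(norm ((a + b) /\<^sub>R 2) powr p) powr (1 / p) = (norm a powr p) powr (1 / p)" by simp
  then have "norm ((a + b) /\<^sub>R 2) = norm a" using p by (simp add: powr_powr)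
  then have "norm (a + b) = norm a + norm b" using ab by simp
  then have "norm a *\<^sub>R b = norm b *\<^sub>R a" by (simp add: norm_triangle_eq)
  then show "a = b" using ab by (cases "norm a = 0") auto
qed

text \<open>Uniform convexity in a weak form; by homogeneity it suffices to consider the compact set
  of pairs with \<open>\<bar>a\<bar>\<^sup>p + \<bar>b\<bar>\<^sup>p = 1\<close>.\<close>

lemma uniform_convexity:
  assumes p: "1 < p" and e: "0 < e"
  shows "\<exists>C>0. \<forall>a b :: 'a::euclidean_space. norm (a - b) powr p \<le> e * (norm a powr p + norm b powr p) + C * midpoint_gap p a b"
proof -
  define n where "n z = norm (fst z) powr p + norm (snd z) powr p" for z :: "'a \<times> 'a"
  define d where "d z = norm (fst z - snd z) powr p" for z :: "'a \<times> 'a"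
  have contp: "continuous_on UNIV (\<lambda>z. norm (g z) powr p)" if "continuous_on UNIV g" for g :: "'a \<times> 'a \<Rightarrow> 'a"
    by (rule continuous_on_powr'[OF continuous_on_norm[OF that] continuous_on_const]) (use p in auto)
  have cn: "continuous_on UNIV n" and cd: "continuous_on UNIV d"
    unfolding n_def d_def
    by (intro continuous_on_diff continuous_on_add contp continuous_on_fst continuous_on_snd continuous_on_id)+
  have cc: "continuous_on UNIV (\<lambda>z :: 'a \<times> 'a. midpoint_gap p (fst z) (snd z))"
  proof -
    have f: "continuous_on UNIV (fst :: 'a \<times> 'a \<Rightarrow> 'a)" and g: "continuous_on UNIV (snd :: 'a \<times> 'a \<Rightarrow> 'a)"
      by (intro continuous_intros)+
    have "continuous_on UNIV (\<lambda>z. (fst z + snd z) /\<^sub>R 2 :: 'a)" by (intro continuous_intros)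
    from contp[OF f] contp[OF g] contp[OF this] show ?thesis
      unfolding midpoint_gap_def by (intro continuous_on_diff continuous_on_divide continuous_on_add continuous_on_const) auto
  qed
  \<comment> \<open>Off \<open>K\<close> the term \<open>e\<close> alone suffices. On
    \<open>K\<close> the gap has a positive minimum, because there the two vectors differ.\<close>
  define K where "K = {z. n z = 1 \<and> e \<le> d z}"
  have small: "norm a \<le> 1" if "norm a powr p + norm b powr p = 1" for a b :: 'a
  proof (rule ccontr)
    assume "\<not> norm a \<le> 1"
    then have "1 powr p < norm a powr p" using p by (intro powr_less_mono2) auto
    then show False using that powr_ge_zero[of "norm b" p] by simp
  qed
  have "norm z \<le> 1 + 1" if "z \<in> K" for z
  proof -
    have "norm (fst z) \<le> 1" "norm (snd z) \<le> 1"
      using that small[of "fst z" "snd z"] small[of "snd z" "fst z"] by (auto simp: K_def n_def add.commute)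
    then show ?thesis using norm_fst_le[of "fst z"] norm_Pair_le[of "fst z" "snd z"] by simp
  qed
  then have "bounded K" unfolding bounded_iff by blast
  moreover have "closed K" unfolding K_def
    using cn cd by (intro closed_Collect_conj closed_Collect_eq closed_Collect_le continuous_on_const)
  ultimately have K: "compact K" by (simp add: compact_eq_bounded_closed)
  have d2: "d z \<le> 2 powr p" if "n z = 1" for z
  proof -
    have "norm (fst z) \<le> 1" "norm (snd z) \<le> 1"
      using that small[of "fst z" "snd z"] small[of "snd z" "fst z"] by (auto simp: n_def add.commute)
    then have "norm (fst z - snd z) \<le> 2" using norm_triangle_ineq4[of "fst z" "snd z"] by simp
    then show ?thesis unfolding d_def using p by (intro powr_mono2) auto
  qed
  have "\<exists>C>0. \<forall>z. n z = 1 \<longrightarrow> d z \<le> e + C * midpoint_gap p (fst z) (snd z)"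
  proof (cases "K = {}")
    case True
    have "d z \<le> e + 1 * midpoint_gap p (fst z) (snd z)" if "n z = 1" for z
    proof -
      have "z \<notin> K" using True by simp
      then have "d z \<le> e" using that by (simp add: K_def)
      then show ?thesis using midpoint_gap_nonneg[OF p, of "fst z" "snd z"] by simp
    qed
    then show ?thesis by (intro exI[of _ 1]) auto
  next
    case False
    then obtain z0 where z0: "z0 \<in> K" "\<And>z. z \<in> K \<Longrightarrow> midpoint_gap p (fst z0) (snd z0) \<le> midpoint_gap p (fst z) (snd z)"
      using continuous_attains_inf[OF K False continuous_on_subset[OF cc subset_UNIV]] by blast
    \<comment> \<open>On \<open>K\<close> the left side is at most \<open>2 powr p\<close>, so the
      constant \<open>2 powr p / \<delta>\<close> makes the gap term large enough.\<close>
    define \<delta> where "\<delta> = midpoint_gap p (fst z0) (snd z0)"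
    have "\<delta> \<noteq> 0"
    proof
      assume "\<delta> = 0"
      then have "fst z0 = snd z0" using midpoint_gap_eq_0[OF p] by (simp add: \<delta>_def)
      then show False using z0(1) e by (simp add: K_def d_def)
    qed
    then have \<delta>: "0 < \<delta>" using midpoint_gap_nonneg[OF p, of "fst z0" "snd z0"] by (simp add: \<delta>_def)
    have "d z \<le> e + (2 powr p / \<delta>) * midpoint_gap p (fst z) (snd z)" if "n z = 1" for z
    proof (cases "z \<in> K")
      case True
      have "2 powr p = (2 powr p / \<delta>) * \<delta>" using \<delta> by simp
      also have "\<dots> \<le> (2 powr p / \<delta>) * midpoint_gap p (fst z) (snd z)"
        using z0(2)[OF True] \<delta> by (intro mult_left_mono) (auto simp: \<delta>_def)
      finally show ?thesis using d2[OF that] e by simp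
    next
      case False
      then have "d z \<le> e" using that by (simp add: K_def)
      moreover have "0 \<le> (2 powr p / \<delta>) * midpoint_gap p (fst z) (snd z)"
        using \<delta> midpoint_gap_nonneg[OF p, of "fst z" "snd z"] by simp
      ultimately show ?thesis by simp
    qed
    then show ?thesis using \<delta> by (intro exI[of _ "2 powr p / \<delta>"]) auto
  qed
  then obtain C where C: "0 < C" "\<And>z. n z = 1 \<Longrightarrow> d z \<le> e + C * midpoint_gap p (fst z) (snd z)" by blast
  have "norm (a - b) powr p \<le> e * (norm a powr p + norm b powr p) + C * midpoint_gap p a b" for a b :: 'a
  proof (cases "a = 0 \<and> b = 0")
    case False
    define s where "s = norm a powr p + norm b powr p"
    have s: "0 < s" using False by (auto simp: s_def add_pos_nonneg add_nonneg_pos)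
    define t where "t = s powr (1 / p)"
    have t: "0 < t" "t powr p = s" using s p by (auto simp: t_def powr_powr)
    have scale: "norm (c /\<^sub>R t) powr p = norm c powr p / s" for c :: 'a
    proof -
      have "norm (c /\<^sub>R t) = norm c / t" using t(1) by (simp add: divide_inverse mult.commute)
      then show ?thesis using t by (simp add: powr_divide)
    qed
    have "n (a /\<^sub>R t, b /\<^sub>R t) = 1"
      using s unfolding n_def fst_conv snd_conv scale by (simp add: s_def add_divide_distrib[symmetric])
    from C(2)[OF this] have "norm ((a - b) /\<^sub>R t) powr p \<le> e + C * midpoint_gap p (a /\<^sub>R t) (b /\<^sub>R t)"
      by (simp add: d_def scaleR_diff_right)
    moreover have "midpoint_gap p (a /\<^sub>R t) (b /\<^sub>R t) = midpoint_gap p a b / s"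
    proof -
      have "(a /\<^sub>R t + b /\<^sub>R t) /\<^sub>R 2 = ((a + b) /\<^sub>R 2) /\<^sub>R t" by (simp add: scaleR_add_right mult.commute)
      then have "norm ((a /\<^sub>R t + b /\<^sub>R t) /\<^sub>R 2) powr p = norm ((a + b) /\<^sub>R 2) powr p / s"
        by (simp only: scale)
      then show ?thesis unfolding midpoint_gap_def scale by (simp only: diff_divide_distrib add_divide_distrib divide_divide_eq_left mult.commute)
    qed
    ultimately have "norm (a - b) powr p / s \<le> e + C * (midpoint_gap p a b / s)" by (simp only: scale)
    then have "norm (a - b) powr p / s \<le> e + C * midpoint_gap p a b / s" by simp
    then have "norm (a - b) powr p \<le> (e + C * midpoint_gap p a b / s) * s" using s by (simp add: pos_divide_le_eq)
    then show ?thesis using s by (simp add: s_def[symmetric] distrib_right)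
  qed (simp add: midpoint_gap_def)
  then show ?thesis using C(1) by blast
qed


text \<open>Fubini and integration by parts carry the mollifier and the derivative over to \<phi>.
  The mollified derivative \<open>R m\<close> of \<phi> converges uniformly, which suffices for an
  integrable \<open>h\<close>.\<close>

lemma mollified_partial_weak_limit:
  fixes h :: "real ^ 'n::finite \<Rightarrow> real" and \<epsilon> :: "nat \<Rightarrow> real"
  assumes h: "integrable lborel h" and \<eta>: "\<And>m. mollifier (\<epsilon> m) (\<eta> m)" and \<epsilon>0: "\<epsilon> \<longlonglongrightarrow> 0"
    and \<phi>: "test_function \<phi>"
  shows "(\<lambda>m. LINT x|lborel. cgrad h (\<eta> m) x $ i * \<phi> x) \<longlonglongrightarrow> - (LINT y|lborel. h y * partial_deriv i \<phi> y)"
proof -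
  note \<phi>cc = test_function_cc[OF \<phi>] and d\<phi>cc = partial_deriv_cc[OF \<phi>, of i]
  have [measurable]: "h \<in> borel_measurable borel" using h by simp
  note [measurable] = cc_measurable[OF \<phi>cc] cc_measurable[OF d\<phi>cc] mollifierD(6)[OF \<eta>]
  define R where "R m y = (LINT x|lborel. \<eta> m (x - y) * partial_deriv i \<phi> x)" for m y
  have eq: "(LINT x|lborel. cgrad h (\<eta> m) x $ i * \<phi> x) = - (LINT y|lborel. h y * R m y)" for m
  proof -
    note dcc = partial_deriv_cc[OF mollifierD(1)[OF \<eta>[of m]], of i]
    note [measurable] = cc_measurable[OF dcc]
    obtain B where B: "\<And>x. \<bar>partial_deriv i (\<eta> m) x\<bar> \<le> B" using cc_bounded[OF dcc] by blast
    have "integrable (lborel \<Otimes>\<^sub>M lborel) (\<lambda>(x, y). h y * partial_deriv i (\<eta> m) (x - y) * \<phi> x)"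
    proof (rule Bochner_Integration.integrable_bound)
      show "integrable (lborel \<Otimes>\<^sub>M lborel) (\<lambda>(x, y). B * (\<phi> x * h y))"
        using cc_integrable[OF \<phi>cc] h
        by (intro lborel_pair.Fubini_integrable) (auto simp: abs_mult intro!: integrable_mult_right)
      show "AE z in lborel \<Otimes>\<^sub>M lborel. norm (case z of (x, y) \<Rightarrow> h y * partial_deriv i (\<eta> m) (x - y) * \<phi> x)
          \<le> norm (case z of (x, y) \<Rightarrow> B * (\<phi> x * h y))"
      proof (intro AE_I2, clarify)
        fix x y
        have "\<bar>partial_deriv i (\<eta> m) (x - y)\<bar> * \<bar>\<phi> x * h y\<bar> \<le> \<bar>B\<bar> * \<bar>\<phi> x * h y\<bar>"
          using B[of "x - y"] by (intro mult_right_mono) auto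
        then show "norm (h y * partial_deriv i (\<eta> m) (x - y) * \<phi> x) \<le> norm (B * (\<phi> x * h y))"
          by (simp add: abs_mult mult_ac)
      qed
    qed measurable
    then have "(LINT x|lborel. (LINT y|lborel. h y * partial_deriv i (\<eta> m) (x - y) * \<phi> x)) =
        (LINT y|lborel. (LINT x|lborel. h y * partial_deriv i (\<eta> m) (x - y) * \<phi> x))"
      by (rule lborel_pair.Fubini_integral[symmetric])
    moreover have "(LINT x|lborel. cgrad h (\<eta> m) x $ i * \<phi> x) =
        (LINT x|lborel. (LINT y|lborel. h y * partial_deriv i (\<eta> m) (x - y) * \<phi> x))"
      by (simp add: cgrad_def conv_def)
    moreover have "(LINT x|lborel. h y * partial_deriv i (\<eta> m) (x - y) * \<phi> x) = - (h y * R m y)" for y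
      using test_function_integration_by_parts[OF mollifierD(1)[OF \<eta>[of m]] \<phi>, of i y]
      by (simp add: R_def mult.assoc)
    ultimately show ?thesis by simp
  qed
  define I where "I = (LINT y|lborel. \<bar>h y\<bar>)"
  have I: "0 \<le> I" unfolding I_def by simp
  \<comment> \<open>The order of the variables is reversed, so this is a convolution with the
    reflected mollifier, which is a mollifier of the same radius.\<close>
  have R_eq: "R m y = conv (partial_deriv i \<phi>) (\<lambda>z. \<eta> m (0 - z)) y" for m y
    by (simp add: R_def conv_def mult.commute)
  have "(\<lambda>m. LINT y|lborel. h y * R m y) \<longlonglongrightarrow> (LINT y|lborel. h y * partial_deriv i \<phi> y)"
  proof (rule LIMSEQ_I)
    fix e :: real assume e: "0 < e"
    then have "0 < e / (I + 1)" using I by simp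
    then obtain d where d: "0 < d" "\<And>x y. dist x y < d \<Longrightarrow> \<bar>partial_deriv i \<phi> x - partial_deriv i \<phi> y\<bar> < e / (I + 1)"
      using cc_uniform[OF d\<phi>cc] by blast
    obtain N where N: "\<And>m. N \<le> m \<Longrightarrow> \<epsilon> m < d"
      using order_tendstoD(2)[OF \<epsilon>0 d(1)] by (auto simp: eventually_sequentially)
    have "norm ((LINT y|lborel. h y * R m y) - (LINT y|lborel. h y * partial_deriv i \<phi> y)) < e" if m: "N \<le> m" for m
    proof -
      have m': "mollifier (\<epsilon> m) (\<lambda>z. \<eta> m (0 - z))"
        using \<eta>[of m] test_function_reflect(1)[OF mollifierD(1)[OF \<eta>[of m]], of 0]
          integral_lborel_reflect[OF mollifierD(6)[OF \<eta>[of m]], of 0]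
        unfolding mollifier_def by (auto dest: spec[of _ "- _"] simp: norm_minus_cancel)
      have close: "\<bar>R m y - partial_deriv i \<phi> y\<bar> \<le> e / (I + 1)" for y
        unfolding R_eq
      proof (rule conv_mollifier_close[OF cc_integrable[OF d\<phi>cc] m'])
        fix z assume "dist z y \<le> \<epsilon> m"
        then show "\<bar>partial_deriv i \<phi> z - partial_deriv i \<phi> y\<bar> \<le> e / (I + 1)"
          using d(2)[of z y] N[OF m] by simp
      qed
      have [measurable]: "R m \<in> borel_measurable borel"
      proof -
        have "continuous_on UNIV (R m)"
          unfolding R_eq[abs_def] using conv_continuous[OF cc_integrable[OF d\<phi>cc] mollifierD(5)[OF m']] by simp
        then show ?thesis by (rule borel_measurable_continuous_onI)
      qed
      obtain B where B: "\<And>x. \<bar>partial_deriv i \<phi> x\<bar> \<le> B" using cc_bounded[OF d\<phi>cc] by blast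
      have RB: "\<bar>R m y\<bar> \<le> B + e / (I + 1)" for y using close[of y] B[of y] by linarith
      have i1: "integrable lborel (\<lambda>y. h y * R m y)" using RB by (intro integral_mult_bounded(1)[OF h]) auto
      have i2: "integrable lborel (\<lambda>y. h y * partial_deriv i \<phi> y)" using B by (intro integral_mult_bounded(1)[OF h]) auto
      have "(LINT y|lborel. h y * R m y) - (LINT y|lborel. h y * partial_deriv i \<phi> y) =
          (LINT y|lborel. h y * (R m y - partial_deriv i \<phi> y))"
        using i1 i2 by (simp add: right_diff_distrib)
      moreover have "\<bar>\<dots>\<bar> \<le> e / (I + 1) * I"
        unfolding I_def by (rule integral_mult_bounded(2)[OF h]) (use close in \<open>auto simp: I_def\<close>)
      moreover have "e / (I + 1) * I < e" using e I by (simp add: field_simps)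
      ultimately show ?thesis by simp
    qed
    then show "\<exists>N. \<forall>m\<ge>N. norm ((LINT y|lborel. h y * R m y) - (LINT y|lborel. h y * partial_deriv i \<phi> y)) < e" by blast
  qed
  then show ?thesis unfolding eq by (rule tendsto_minus)
qed

text \<open>The mollified gradients form a Cauchy sequence in \<open>L\<^sup>p\<close>: by uniform convexity this follows
  once the averages \<open>(v\<^sub>m + v\<^sub>k) / 2\<close> have almost maximal norm, which is the lower semicontinuity of
  the norm along a further mollification.\<close>

locale mollified_gradients =
  fixes h :: "real ^ 'n::finite \<Rightarrow> real" and p s :: real and \<epsilon> :: "nat \<Rightarrow> real" and \<eta> :: "nat \<Rightarrow> real ^ 'n \<Rightarrow> real"
  assumes h: "integrable lborel h" and p: "1 < p" and s: "0 \<le> s"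
    and \<eta>: "\<And>m. mollifier (\<epsilon> m) (\<eta> m)" and \<epsilon>0: "\<epsilon> \<longlonglongrightarrow> 0"
    and upper: "\<And>d \<rho>. mollifier d \<rho> \<Longrightarrow> Lp_energy p (cgrad h \<rho>) \<le> ennreal s"
    and sup: "\<And>e. 0 < e \<Longrightarrow> \<exists>d \<rho>. mollifier d \<rho> \<and> ennreal (s - e) \<le> Lp_energy p (cgrad h \<rho>)"
begin

definition v where "v m = cgrad h (\<eta> m)"

lemma v_continuous: "continuous_on A (v m)"
  unfolding v_def by (rule cgrad_continuous[OF h mollifierD(1)[OF \<eta>]])

lemma v_measurable [measurable]: "v m \<in> borel_measurable borel"
  using v_continuous by (rule borel_measurable_continuous_onI)

text \<open>If averages with arbitrarily large indices had energy below \<open>s - e\<close>, their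
  mollifications by a nearly optimal \<rho> would, too. These converge to
  \<open>cgrad h \<rho>\<close>, and Fatou's lemma contradicts the choice of \<rho>.\<close>

lemma midpoint_lower_bound:
  assumes e: "0 < e"
  shows "\<exists>N. \<forall>m\<ge>N. \<forall>k\<ge>N. ennreal (s - e) \<le> Lp_energy p (\<lambda>x. (v m x + v k x) /\<^sub>R 2)"
proof (rule ccontr)
  assume neg: "\<not> ?thesis"
  define A where "A m k \<longleftrightarrow> Lp_energy p (\<lambda>x. (v m x + v k x) /\<^sub>R 2) < ennreal (s - e)" for m k
  have "\<forall>N. \<exists>m k. N \<le> m \<and> N \<le> k \<and> A m k" using neg unfolding A_def linorder_not_le[symmetric] by blast
  then obtain a b where ab: "\<And>N. N \<le> a N" "\<And>N. N \<le> b N" "\<And>N. A (a N) (b N)" by metis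
  define w where "w N x = (v (a N) x + v (b N) x) /\<^sub>R 2" for N x
  have [measurable]: "w N \<in> borel_measurable borel" for N unfolding w_def by measurable
  have wc: "continuous_on UNIV (w N)" for N unfolding w_def by (intro continuous_intros v_continuous)
  have a_lim: "filterlim a at_top sequentially" "filterlim b at_top sequentially"
    by (rule filterlim_at_top_mono[OF filterlim_ident always_eventually]; use ab in blast)+
  obtain d \<rho> where \<rho>: "mollifier d \<rho>" "ennreal (s - e / 2) \<le> Lp_energy p (cgrad h \<rho>)"
    using sup[of "e / 2"] e by auto
  note \<rho>' = mollifierD[OF \<rho>(1)]
  have int: "integrable lborel (\<lambda>y. \<rho> (x - y) *\<^sub>R w N y)" for N x
  proof -
    have "cc (\<lambda>y. \<rho> (x - y))" by (rule cc_reflect[OF \<rho>'(5)])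
    then have c: "compact (closure {y. \<rho> (x - y) \<noteq> 0})" "continuous_on UNIV (\<lambda>y. \<rho> (x - y))" by (auto simp: cc_def)
    have "integrable lborel (\<lambda>y. indicator (closure {y. \<rho> (x - y) \<noteq> 0}) y *\<^sub>R (\<rho> (x - y) *\<^sub>R w N y))"
      using c wc by (intro borel_integrable_compact continuous_intros) (auto intro: continuous_on_subset)
    moreover have "indicator (closure {y. \<rho> (x - y) \<noteq> 0}) y *\<^sub>R (\<rho> (x - y) *\<^sub>R w N y) = \<rho> (x - y) *\<^sub>R w N y" for y
      using closure_subset[of "{y. \<rho> (x - y) \<noteq> 0}"] by (cases "\<rho> (x - y) = 0") (auto simp: indicator_def)
    ultimately show ?thesis by (simp only:)
  qed
  have lim: "(\<lambda>N. LINT y|lborel. \<rho> (x - y) *\<^sub>R w N y) \<longlonglongrightarrow> cgrad h \<rho> x" for x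
  proof (rule vec_tendstoI)
    fix i
    note tr = test_function_reflect[OF \<rho>'(1)]
    have "(\<lambda>m. LINT y|lborel. cgrad h (\<eta> m) y $ i * \<rho> (x - y)) \<longlonglongrightarrow> - (LINT y|lborel. h y * partial_deriv i (\<lambda>y. \<rho> (x - y)) y)"
      by (rule mollified_partial_weak_limit[OF h \<eta> \<epsilon>0 tr(1)])
    then have L: "(\<lambda>m. LINT y|lborel. v m y $ i * \<rho> (x - y)) \<longlonglongrightarrow> cgrad h \<rho> x $ i"
      by (simp add: v_def tr(2) cgrad_def conv_def)
    have vi: "integrable lborel (\<lambda>y. v m y $ i * \<rho> (x - y))" for m
    proof -
      have "cc (\<lambda>y. v m y $ i * \<rho> (x - y))"
      proof -
        have c: "cc (\<lambda>y. \<rho> (x - y))" by (rule cc_reflect[OF \<rho>'(5)])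
        show ?thesis
        proof (rule ccI[of _ "closure {y. \<rho> (x - y) \<noteq> 0}"])
          show "continuous_on UNIV (\<lambda>y. v m y $ i * \<rho> (x - y))"
            using c v_continuous[of UNIV m] by (auto simp: cc_def intro!: continuous_intros)
          show "compact (closure {y. \<rho> (x - y) \<noteq> 0})" using c by (simp add: cc_def)
          show "v m y $ i * \<rho> (x - y) = 0" if "y \<notin> closure {y. \<rho> (x - y) \<noteq> 0}" for y
            using that closure_subset[of "{y. \<rho> (x - y) \<noteq> 0}"] by auto
        qed
      qed
      then show ?thesis by (rule cc_integrable)
    qed
    have eqN: "(LINT y|lborel. \<rho> (x - y) *\<^sub>R w N y) $ i =
        ((LINT y|lborel. v (a N) y $ i * \<rho> (x - y)) + (LINT y|lborel. v (b N) y $ i * \<rho> (x - y))) / 2" for N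
    proof -
      have "(LINT y|lborel. \<rho> (x - y) *\<^sub>R w N y) $ i = (LINT y|lborel. (\<rho> (x - y) *\<^sub>R w N y) $ i)"
        by (rule integral_bounded_linear[OF bounded_linear_vec_nth int, symmetric])
      also have "\<dots> = (LINT y|lborel. (v (a N) y $ i * \<rho> (x - y) + v (b N) y $ i * \<rho> (x - y)) / 2)"
        by (intro Bochner_Integration.integral_cong) (simp_all add: w_def field_simps)
      finally show ?thesis using vi by simp
    qed
    have "(\<lambda>N. ((LINT y|lborel. v (a N) y $ i * \<rho> (x - y)) + (LINT y|lborel. v (b N) y $ i * \<rho> (x - y))) / 2)
        \<longlonglongrightarrow> (cgrad h \<rho> x $ i + cgrad h \<rho> x $ i) / 2"
      by (intro tendsto_intros filterlim_compose[OF L a_lim(1)] filterlim_compose[OF L a_lim(2)]) simp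
    then show "(\<lambda>N. (LINT y|lborel. \<rho> (x - y) *\<^sub>R w N y) $ i) \<longlonglongrightarrow> cgrad h \<rho> x $ i"
      unfolding eqN by simp
  qed
  note [measurable] = \<rho>'(6)
  have "Lp_energy p (cgrad h \<rho>) =
      (\<integral>\<^sup>+ x. liminf (\<lambda>N. ennreal (norm (LINT y|lborel. \<rho> (x - y) *\<^sub>R w N y) powr p)) \<partial>lborel)"
  proof (intro nn_integral_cong lim_imp_Liminf[symmetric] tendsto_ennrealI)
    fix x
    show "(\<lambda>N. norm (LINT y|lborel. \<rho> (x - y) *\<^sub>R w N y) powr p) \<longlonglongrightarrow> norm (cgrad h \<rho> x) powr p"
      using p by (intro tendsto_powr' tendsto_norm lim tendsto_const) auto
  qed simp
  also have "\<dots> \<le> liminf (\<lambda>N. \<integral>\<^sup>+ x. ennreal (norm (LINT y|lborel. \<rho> (x - y) *\<^sub>R w N y) powr p) \<partial>lborel)"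
    by (intro nn_integral_liminf) measurable
  also have "\<dots> \<le> liminf (\<lambda>N::nat. ennreal (s - e))"
  proof (intro Liminf_mono always_eventually allI)
    fix N
    have "Lp_energy p (\<lambda>x. LINT y|lborel. \<rho> (x - y) *\<^sub>R w N y)
        \<le> Lp_energy p (w N)"
      by (intro jensen_mollifier[OF \<rho>(1) p] int) measurable
    also have "\<dots> \<le> ennreal (s - e)" using ab(3)[of N] by (simp add: A_def w_def)
    finally show "Lp_energy p (\<lambda>x. LINT y|lborel. \<rho> (x - y) *\<^sub>R w N y) \<le> ennreal (s - e)" .
  qed
  also have "\<dots> = ennreal (s - e)" by (simp add: Liminf_const)
  finally have "ennreal (s - e / 2) \<le> ennreal (s - e)" using \<rho>(2) by simp
  \<comment> \<open>\<open>ennreal\<close> sends negative numbers to 0, so the two bounds can be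
    compared as real numbers only after positivity is known.\<close>
  moreover have "0 < s - e"
  proof (rule ccontr)
    assume "\<not> 0 < s - e"
    then have "ennreal (s - e) = 0" by (simp add: ennreal_neg)
    then show False using ab(3)[of 0] by (simp add: A_def)
  qed
  ultimately show False using e by (simp add: ennreal_le_iff)
qed

lemma v_cauchy:
  assumes e: "0 < e"
  shows "\<exists>N. \<forall>m\<ge>N. \<forall>k\<ge>N. Lp_energy p (\<lambda>x. v m x - v k x) \<le> ennreal e"
proof -
  \<comment> \<open>The error budget: both energies are at most \<open>s\<close>, so the term with
    \<open>e1\<close> contributes at most \<open>e / 2\<close>; \<open>e2\<close> leaves the other
    half for the gap term.\<close>
  define e1 where "e1 = e / (4 * (s + 1))"
  have e1: "0 < e1" "2 * s * e1 \<le> e / 2" using e s by (auto simp: e1_def field_simps)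
  obtain C where C: "0 < C" "\<And>a b :: real ^ 'n. norm (a - b) powr p \<le> e1 * (norm a powr p + norm b powr p) + C * midpoint_gap p a b"
    using uniform_convexity[OF p e1(1)] by blast
  define e2 where "e2 = e / (2 * C)"
  have e2: "0 < e2" "C * e2 = e / 2" using e C(1) by (auto simp: e2_def)
  obtain N where N: "\<And>m k. N \<le> m \<Longrightarrow> N \<le> k \<Longrightarrow>
      ennreal (s - e2) \<le> Lp_energy p (\<lambda>x. (v m x + v k x) /\<^sub>R 2)"
    using midpoint_lower_bound[OF e2(1)] by blast
  have "Lp_energy p (\<lambda>x. v m x - v k x) \<le> ennreal e" if mk: "N \<le> m" "N \<le> k" for m k
  proof -
    let ?X = "\<integral>\<^sup>+ x. ennreal (norm (v m x - v k x) powr p) \<partial>lborel"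
    let ?I = "\<integral>\<^sup>+ x. ennreal (norm ((v m x + v k x) /\<^sub>R 2) powr p) \<partial>lborel"
    \<comment> \<open>The subtracted midpoint term of the convexity inequality is moved to the left,
      where all terms are nonnegative; \<open>D\<close> collects the coefficients on the
      right.\<close>
    define D where "D = e1 + C / 2"
    have D: "0 \<le> D" using e1 C by (simp add: D_def)
    have "?X + ennreal C * ?I = (\<integral>\<^sup>+ x. ennreal (norm (v m x - v k x) powr p) +
        ennreal C * ennreal (norm ((v m x + v k x) /\<^sub>R 2) powr p) \<partial>lborel)"
      by (simp add: nn_integral_add nn_integral_cmult)
    also have "\<dots> \<le> (\<integral>\<^sup>+ x. ennreal D * (ennreal (norm (v m x) powr p) + ennreal (norm (v k x) powr p)) \<partial>lborel)"
    proof (rule nn_integral_mono)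
      fix x
      have "norm (v m x - v k x) powr p + C * norm ((v m x + v k x) /\<^sub>R 2) powr p \<le>
          D * (norm (v m x) powr p + norm (v k x) powr p)"
      proof -
        have "D * (norm (v m x) powr p + norm (v k x) powr p) = e1 * (norm (v m x) powr p + norm (v k x) powr p) +
            C * ((norm (v m x) powr p + norm (v k x) powr p) / 2)" by (simp add: D_def distrib_right)
        then show ?thesis using C(2)[of "v m x" "v k x"] by (simp add: midpoint_gap_def right_diff_distrib del: times_divide_eq_right)
      qed
      from ennreal_leI[OF this]
      show "ennreal (norm (v m x - v k x) powr p) + ennreal C * ennreal (norm ((v m x + v k x) /\<^sub>R 2) powr p)
          \<le> ennreal D * (ennreal (norm (v m x) powr p) + ennreal (norm (v k x) powr p))"
        using C(1) D by (simp add: ennreal_mult[symmetric] ennreal_plus[symmetric] del: ennreal_plus)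
    qed
    also have "\<dots> = ennreal D * (Lp_energy p (v m) + Lp_energy p (v k))"
      by (simp add: nn_integral_add nn_integral_cmult)
    also have "\<dots> \<le> ennreal D * (ennreal s + ennreal s)"
      using upper[OF \<eta>] unfolding v_def by (intro mult_left_mono add_mono) auto
    also have "\<dots> = ennreal (D * (s + s))"
      unfolding ennreal_plus[OF s s, symmetric] by (rule ennreal_mult[symmetric]) (use D s in auto)
    finally have 1: "?X + ennreal C * ?I \<le> ennreal (D * (s + s))" .
    then have "?X \<le> ennreal (D * (s + s))" by (rule order_trans[rotated]) simp
    then have "?X < \<infinity>" by (rule le_less_trans) simp
    then obtain x where x: "?X = ennreal x" "0 \<le> x" by (cases ?X) auto
    have "ennreal C * ennreal (s - e2) \<le> ennreal C * ?I" using N[OF mk] by (intro mult_left_mono) auto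
    from add_left_mono[OF this, of "ennreal x"] 1 have "ennreal x + ennreal C * ennreal (s - e2) \<le> ennreal (D * (s + s))"
      unfolding x(1) by (rule order_trans)
    then have "x + C * max 0 (s - e2) \<le> D * (s + s)"
    proof -
      assume a: "ennreal x + ennreal C * ennreal (s - e2) \<le> ennreal (D * (s + s))"
      have "ennreal (s - e2) = ennreal (max 0 (s - e2))" by (simp add: max_def ennreal_neg)
      then have "ennreal x + ennreal C * ennreal (s - e2) = ennreal (x + C * max 0 (s - e2))"
        using x(2) C(1) by (simp add: ennreal_mult)
      then show ?thesis using a D s by (simp add: ennreal_le_iff del: ennreal_plus)
    qed
    moreover have "C * (s - e2) \<le> C * max 0 (s - e2)" using C(1) by (intro mult_left_mono) auto
    ultimately have "x \<le> 2 * s * e1 + C * e2" by (simp add: D_def algebra_simps)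
    then have "x \<le> e" using e1(2) e2(2) by simp
    then show ?thesis using x by (simp add: ennreal_leI)
  qed
  then show ?thesis by blast
qed

text \<open>The factor \<open>((1/2) ^ j) powr p\<close> absorbs the weight \<open>2 ^ j\<close>
  that the increments receive below, and \<open>(1/2) ^ j\<close> makes the integrals
  summable.\<close>

lemma fast_subsequence:
  obtains n :: "nat \<Rightarrow> nat" where "strict_mono n" "\<And>j m k. n j \<le> m \<Longrightarrow> n j \<le> k \<Longrightarrow>
    Lp_energy p (\<lambda>x. v m x - v k x) \<le> ennreal ((1/2) ^ j * ((1/2) ^ j) powr p)"
proof -
  define Q where "Q j N \<longleftrightarrow> (\<forall>m\<ge>N. \<forall>k\<ge>N.
    Lp_energy p (\<lambda>x. v m x - v k x) \<le> ennreal ((1/2) ^ j * ((1/2) ^ j) powr p))" for j N :: nat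
  have "\<exists>N. Q j N" for j unfolding Q_def by (rule v_cauchy) simp
  then obtain N where Q: "\<And>j. Q j (N j)" by metis
  then have N: "Lp_energy p (\<lambda>x. v m x - v k x) \<le> ennreal ((1/2) ^ j * ((1/2) ^ j) powr p)"
    if "N j \<le> m" "N j \<le> k" for j m k using that unfolding Q_def by blast
  define n where "n j = j + sum N {..j}" for j
  have "strict_mono n" by (rule strict_monoI_Suc) (simp add: n_def)
  moreover have "N j \<le> n j" for j using member_le_sum[of j "{..j}" N] by (simp add: n_def)
  then have "Lp_energy p (\<lambda>x. v m x - v k x) \<le> ennreal ((1/2) ^ j * ((1/2) ^ j) powr p)"
    if "n j \<le> m" "n j \<le> k" for j m k using that by (intro N) (auto intro: order_trans)
  ultimately show ?thesis by (rule that)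
qed

text \<open>The Riesz-Fischer argument: the fast subsequence converges almost everywhere, and
  Fatou's lemma gives the bound and the convergence in the norm.\<close>

lemma Lp_limit:
  obtains n :: "nat \<Rightarrow> nat" and G :: "real ^ 'n \<Rightarrow> real ^ 'n" where "strict_mono n" "G \<in> borel_measurable borel"
    "Lp_energy p G \<le> ennreal s"
    "(\<lambda>j. \<integral>\<^sup>+ x. ennreal (norm (v (n j) x - G x) powr p) \<partial>lborel) \<longlonglongrightarrow> 0"
proof -
  obtain n where n: "strict_mono n" "\<And>j m k. n j \<le> m \<Longrightarrow> n j \<le> k \<Longrightarrow>
    Lp_energy p (\<lambda>x. v m x - v k x) \<le> ennreal ((1/2) ^ j * ((1/2) ^ j) powr p)"
    using fast_subsequence by blast
  define w where "w j = v (n j)" for j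
  have [measurable]: "w j \<in> borel_measurable borel" for j unfolding w_def by simp
  have wc: "Lp_energy p (\<lambda>x. w i x - w j x) \<le> ennreal ((1/2) ^ k * ((1/2) ^ k) powr p)"
    if "k \<le> i" "k \<le> j" for i j k
    unfolding w_def using n that by (simp add: strict_mono_less_eq)
  \<comment> \<open>Summability of \<open>t\<close> at a point bounds it there, which forces the
    increments to decay like \<open>(1/2) ^ j\<close>; so the telescoping series converges.\<close>
  define t where "t j x = (2 ^ j * norm (w (Suc j) x - w j x)) powr p" for j x
  have [measurable]: "t j \<in> borel_measurable borel" for j unfolding t_def by measurable
  have t_int: "(\<integral>\<^sup>+ x. ennreal (t j x) \<partial>lborel) \<le> ennreal ((1/2) ^ j)" for j
  proof -
    have "(\<integral>\<^sup>+ x. ennreal (t j x) \<partial>lborel) = (\<integral>\<^sup>+ x. ennreal ((2 ^ j) powr p) * ennreal (norm (w (Suc j) x - w j x) powr p) \<partial>lborel)"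
      by (simp add: t_def powr_mult ennreal_mult)
    also have "\<dots> = ennreal ((2 ^ j) powr p) * Lp_energy p (\<lambda>x. w (Suc j) x - w j x)"
      by (intro nn_integral_cmult) measurable
    also have "\<dots> \<le> ennreal ((2 ^ j) powr p) * ennreal ((1/2) ^ j * ((1/2) ^ j) powr p)"
      by (intro mult_left_mono wc) auto
    also have "\<dots> = ennreal ((2 ^ j) powr p * ((1/2) ^ j * ((1/2) ^ j) powr p))" by (rule ennreal_mult[symmetric]) auto
    also have "(2 ^ j) powr p * ((1/2) ^ j * ((1/2) ^ j) powr p) = (1/2 :: real) ^ j"
    proof -
      have "(2 ^ j) powr p * ((1/2) ^ j) powr p = (2 ^ j * (1/2 :: real) ^ j) powr p" by (simp add: powr_mult)
      also have "2 ^ j * (1/2 :: real) ^ j = 1" by (simp add: power_mult_distrib[symmetric])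
      finally show ?thesis by simp
    qed
    finally show ?thesis .
  qed
  have "(\<integral>\<^sup>+ x. (\<Sum>j. ennreal (t j x)) \<partial>lborel) = (\<Sum>j. \<integral>\<^sup>+ x. ennreal (t j x) \<partial>lborel)"
    by (intro nn_integral_suminf) measurable
  also have "\<dots> \<le> (\<Sum>j. ennreal ((1/2) ^ j))" by (intro suminf_le t_int) auto
  also have "\<dots> < \<infinity>"
    using summable_geometric[of "1/2 :: real"] by (subst suminf_ennreal2) auto
  finally have "AE x in lborel. (\<Sum>j. ennreal (t j x)) \<noteq> \<infinity>" by (intro nn_integral_PInf_AE) auto
  then have conv: "AE x in lborel. convergent (\<lambda>j. w j x)"
  proof eventually_elim
    case (elim x)
    then obtain c where c: "(\<Sum>j. ennreal (t j x)) = ennreal c" "0 \<le> c" by (cases "\<Sum>j. ennreal (t j x)") auto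
    have "norm (w (Suc j) x - w j x) \<le> c powr (1 / p) * (1/2) ^ j" for j
    proof -
      have "ennreal (t j x) \<le> ennreal c" unfolding c(1)[symmetric]
        using sum_le_suminf[of "\<lambda>j. ennreal (t j x)" "{j}"] by simp
      then have "t j x \<le> c" using c(2) by simp
      then have "t j x powr (1 / p) \<le> c powr (1 / p)" using p by (intro powr_mono2) (auto simp: t_def)
      moreover have "t j x powr (1 / p) = 2 ^ j * norm (w (Suc j) x - w j x)" using p by (simp add: t_def powr_powr)
      ultimately show ?thesis by (simp add: power_divide field_simps)
    qed
    then have "summable (\<lambda>j. w (Suc j) x - w j x)"
      by (intro summable_comparison_test'[OF summable_mult[OF summable_geometric], of "1/2 :: real" 0 _ "c powr (1 / p)"]) auto
    then have "convergent (\<lambda>n. (\<Sum>i<n. w (Suc i) x - w i x) + w 0 x)"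
      by (intro convergent_add convergent_const) (simp add: summable_iff_convergent)
    moreover have "(\<Sum>i<n. w (Suc i) x - w i x) + w 0 x = w n x" for n
      using sum_lessThan_telescope[of "\<lambda>i. w i x" n] by simp
    ultimately show ?case by simp
  qed
  define G where "G x = lim (\<lambda>j. w j x)" for x
  have [measurable]: "G \<in> borel_measurable borel" unfolding G_def by (rule borel_measurable_lim_metric) measurable
  have lim: "AE x in lborel. (\<lambda>j. w j x) \<longlonglongrightarrow> G x"
    using conv by eventually_elim (simp add: G_def convergent_LIMSEQ_iff)
  have powr_lim: "ennreal (norm (a - b) powr p) = liminf (\<lambda>j. ennreal (norm (a - c j) powr p))" if "c \<longlonglongrightarrow> b"
    for a b :: "real ^ 'n" and c
    using p that by (intro lim_imp_Liminf[symmetric] tendsto_ennrealI tendsto_powr' tendsto_intros) auto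
  have "Lp_energy p G = (\<integral>\<^sup>+ x. liminf (\<lambda>j. ennreal (norm (w j x) powr p)) \<partial>lborel)"
    using lim by (intro nn_integral_cong_AE, eventually_elim) (use powr_lim[where a = 0] in simp)
  also have "\<dots> \<le> liminf (\<lambda>j. \<integral>\<^sup>+ x. ennreal (norm (w j x) powr p) \<partial>lborel)" by (intro nn_integral_liminf) measurable
  also have "\<dots> \<le> liminf (\<lambda>j::nat. ennreal s)"
    using upper[OF \<eta>] unfolding w_def v_def by (intro Liminf_mono always_eventually allI)
  finally have Gs: "Lp_energy p G \<le> ennreal s" by (simp add: Liminf_const)
  have Gw: "Lp_energy p (\<lambda>x. w k x - G x) \<le> ennreal ((1/2) ^ k)" for k
  proof -
    have "Lp_energy p (\<lambda>x. w k x - G x) = (\<integral>\<^sup>+ x. liminf (\<lambda>j. ennreal (norm (w k x - w j x) powr p)) \<partial>lborel)"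
      using lim by (intro nn_integral_cong_AE, eventually_elim) (use powr_lim in simp)
    also have "\<dots> \<le> liminf (\<lambda>j. \<integral>\<^sup>+ x. ennreal (norm (w k x - w j x) powr p) \<partial>lborel)" by (intro nn_integral_liminf) measurable
    also have "\<dots> \<le> liminf (\<lambda>j::nat. ennreal ((1/2) ^ k * ((1/2) ^ k) powr p))"
      using wc[of k k] by (intro Liminf_mono) (auto simp: eventually_sequentially)
    also have "\<dots> = ennreal ((1/2) ^ k * ((1/2) ^ k) powr p)" by (simp add: Liminf_const)
    also have "\<dots> \<le> ennreal ((1/2) ^ k)"
    proof (rule ennreal_leI)
      have "((1/2 :: real) ^ k) powr p \<le> 1 powr p" using p by (intro powr_mono2) (auto simp: power_le_one)
      then show "(1/2 :: real) ^ k * ((1/2) ^ k) powr p \<le> (1/2) ^ k" by (simp add: mult_left_le)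
    qed
    finally show ?thesis .
  qed
  have "(\<lambda>k. ennreal ((1/2) ^ k)) \<longlonglongrightarrow> ennreal 0" by (intro tendsto_ennrealI LIMSEQ_power_zero) auto
  then have "(\<lambda>k. ennreal ((1/2) ^ k)) \<longlonglongrightarrow> 0" by simp
  from tendsto_sandwich[OF always_eventually always_eventually tendsto_const this]
  have "(\<lambda>k. \<integral>\<^sup>+ x. ennreal (norm (w k x - G x) powr p) \<partial>lborel) \<longlonglongrightarrow> 0" using Gw by simp
  then show ?thesis using that[OF n(1) _ Gs] unfolding w_def by simp
qed

lemma weak_gradient_limit:
  "\<exists>G. weak_gradient h G \<and> (\<integral>\<^sup>+ x. ennreal (norm (G x) powr p) \<partial>lebesgue) \<le> ennreal s"
proof -
  obtain n G where n: "strict_mono n" and G [measurable]: "G \<in> borel_measurable borel"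
    and Gs: "Lp_energy p G \<le> ennreal s"
    and Gv: "(\<lambda>j. \<integral>\<^sup>+ x. ennreal (norm (v (n j) x - G x) powr p) \<partial>lborel) \<longlonglongrightarrow> 0"
    using Lp_limit by blast
  have [measurable]: "h \<in> borel_measurable borel" using h by simp
  \<comment> \<open>This splitting stands in for Hoelder's inequality on compact sets: first order
    quantities are controlled by the \<open>p\<close>-th power up to an arbitrarily small
    \<open>a\<close>.\<close>
  have small: "x \<le> a + a powr (1 - p) * x powr p" if "0 < a" "0 \<le> x" for a x :: real
  proof (cases "x \<le> a")
    case False
    then have "x = x powr (1 - p) * x powr p" using that by (simp add: powr_add[symmetric])
    also have "\<dots> \<le> a powr (1 - p) * x powr p"
      using False that p by (intro mult_right_mono powr_mono2') auto
    finally show ?thesis using that by simp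
  qed (simp add: add_increasing2)
  have Gp: "integrable lborel (\<lambda>x. norm (G x) powr p)"
    using Gs by (intro integrableI_bounded) (auto intro: le_less_trans)
  have locint: "integrable lborel (\<lambda>x. indicator K x *\<^sub>R G x)" if "compact K" for K
  proof -
    have [measurable]: "K \<in> sets borel" using that by (simp add: borel_compact)
    have "integrable lborel (\<lambda>x. indicator K x + norm (G x) powr p)"
      using Gp emeasure_compact_finite[OF that] by simp
    then show ?thesis
    proof (rule Bochner_Integration.integrable_bound)
      show "AE x in lborel. norm (indicator K x *\<^sub>R G x) \<le> norm (indicator K x + norm (G x) powr p)"
        using small[of 1] by (intro AE_I2) (auto simp: indicator_def)
    qed measurable
  qed
  have "(LINT x|lborel. G x $ i * \<phi> x) = - (LINT x|lborel. h x * partial_deriv i \<phi> x)" if \<phi>: "test_function \<phi>" for \<phi> i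
  proof -
    note \<phi>cc = test_function_cc[OF \<phi>]
    note [measurable] = cc_measurable[OF \<phi>cc]
    obtain B where B: "0 < B" "\<And>x. \<bar>\<phi> x\<bar> \<le> B" using cc_bounded[OF \<phi>cc] by blast
    define P where "P = (\<integral>\<^sup>+ x. ennreal \<bar>\<phi> x\<bar> \<partial>lborel)"
    have P: "P < \<infinity>" using cc_integrable[OF \<phi>cc] by (simp add: P_def integrable_iff_bounded)
    have K: "compact (closure {x. \<phi> x \<noteq> 0})" using \<phi>cc by (simp add: cc_def)
    have supp: "indicator (closure {x. \<phi> x \<noteq> 0}) x * \<phi> x = \<phi> x" for x
      using closure_subset[of "{x. \<phi> x \<noteq> 0}"] by (cases "\<phi> x = 0") (auto simp: indicator_def)
    have mult_int: "integrable lborel (\<lambda>x. F x $ i * \<phi> x)"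
      if [measurable]: "F \<in> borel_measurable borel" and F: "integrable lborel (\<lambda>x. indicator (closure {x. \<phi> x \<noteq> 0}) x *\<^sub>R F x)"
      for F :: "real ^ 'n \<Rightarrow> real ^ 'n"
    proof -
      have "integrable lborel (\<lambda>x. (indicator (closure {x. \<phi> x \<noteq> 0}) x *\<^sub>R F x) $ i)"
        by (rule integrable_bounded_linear[OF bounded_linear_vec_nth F])
      from integral_mult_bounded(1)[OF this, of \<phi> B] B(2)
      have "integrable lborel (\<lambda>x. (indicator (closure {x. \<phi> x \<noteq> 0}) x *\<^sub>R F x) $ i * \<phi> x)" by simp
      moreover have "(indicator (closure {x. \<phi> x \<noteq> 0}) x *\<^sub>R F x) $ i * \<phi> x = F x $ i * \<phi> x" for x
        using supp[of x] by auto
      ultimately show ?thesis by (simp only:)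
    qed
    have iG: "integrable lborel (\<lambda>x. G x $ i * \<phi> x)" using locint[OF K] by (intro mult_int) auto
    have iv: "integrable lborel (\<lambda>x. v m x $ i * \<phi> x)" for m
      using K v_continuous by (intro mult_int borel_integrable_compact) auto
    have bound: "ennreal \<bar>(LINT x|lborel. v m x $ i * \<phi> x) - (LINT x|lborel. G x $ i * \<phi> x)\<bar> \<le>
        ennreal a * P + ennreal (B * a powr (1 - p)) * Lp_energy p (\<lambda>x. v m x - G x)"
      if a: "0 < a" for m a
    proof -
      have "(LINT x|lborel. v m x $ i * \<phi> x) - (LINT x|lborel. G x $ i * \<phi> x) = (LINT x|lborel. v m x $ i * \<phi> x - G x $ i * \<phi> x)"
        using iv iG by simp
      also have "ennreal \<bar>\<dots>\<bar> \<le> (\<integral>\<^sup>+ x. ennreal \<bar>v m x $ i * \<phi> x - G x $ i * \<phi> x\<bar> \<partial>lborel)"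
        using integral_norm_bound_ennreal[of lborel "\<lambda>x. v m x $ i * \<phi> x - G x $ i * \<phi> x"] iv iG by simp
      also have "\<dots> \<le> (\<integral>\<^sup>+ x. ennreal a * ennreal \<bar>\<phi> x\<bar> + ennreal (B * a powr (1 - p)) * ennreal (norm (v m x - G x) powr p) \<partial>lborel)"
      proof (rule nn_integral_mono)
        fix x
        have "\<bar>v m x $ i * \<phi> x - G x $ i * \<phi> x\<bar> = \<bar>(v m x - G x) $ i\<bar> * \<bar>\<phi> x\<bar>"
          by (simp add: abs_mult[symmetric] left_diff_distrib)
        also have "\<dots> \<le> (a + a powr (1 - p) * norm (v m x - G x) powr p) * \<bar>\<phi> x\<bar>"
          using component_le_norm_cart[of "v m x - G x" i] small[OF a, of "norm (v m x - G x)"]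
          by (intro mult_right_mono) auto
        also have "\<dots> \<le> a * \<bar>\<phi> x\<bar> + B * a powr (1 - p) * norm (v m x - G x) powr p"
          using mult_left_mono[OF B(2)[of x], of "a powr (1 - p) * norm (v m x - G x) powr p"] by (simp add: algebra_simps)
        finally have "\<bar>v m x $ i * \<phi> x - G x $ i * \<phi> x\<bar> \<le> a * \<bar>\<phi> x\<bar> + B * a powr (1 - p) * norm (v m x - G x) powr p" .
        from ennreal_leI[OF this]
        show "ennreal \<bar>v m x $ i * \<phi> x - G x $ i * \<phi> x\<bar> \<le> ennreal a * ennreal \<bar>\<phi> x\<bar> + ennreal (B * a powr (1 - p)) * ennreal (norm (v m x - G x) powr p)"
          using a B(1) by (simp add: ennreal_mult[symmetric] ennreal_plus[symmetric] del: ennreal_plus)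
      qed
      also have "\<dots> = ennreal a * P + ennreal (B * a powr (1 - p)) * Lp_energy p (\<lambda>x. v m x - G x)"
        by (simp add: nn_integral_add nn_integral_cmult P_def)
      finally show ?thesis .
    qed
    have L: "(\<lambda>j. LINT x|lborel. v (n j) x $ i * \<phi> x) \<longlonglongrightarrow> - (LINT x|lborel. h x * partial_deriv i \<phi> x)"
      using LIMSEQ_subseq_LIMSEQ[OF mollified_partial_weak_limit[OF h \<eta> \<epsilon>0 \<phi>, of i] n]
      by (simp add: v_def o_def)
    \<comment> \<open>\<open>c\<close> measures the failure of integration by parts. For fixed
      \<open>a\<close> the \<open>p\<close>-th power term tends to 0 along the subsequence; then
      \<open>a\<close> is sent to 0.\<close>
    define c where "c = \<bar>- (LINT x|lborel. h x * partial_deriv i \<phi> x) - (LINT x|lborel. G x $ i * \<phi> x)\<bar>"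
    have "ennreal c \<le> ennreal a * P" if a: "0 < a" for a
    proof -
      have "(\<lambda>j. ennreal \<bar>(LINT x|lborel. v (n j) x $ i * \<phi> x) - (LINT x|lborel. G x $ i * \<phi> x)\<bar>) \<longlonglongrightarrow> ennreal c"
        unfolding c_def by (intro tendsto_intros tendsto_ennrealI L)
      moreover have "(\<lambda>j. ennreal a * P + ennreal (B * a powr (1 - p)) * Lp_energy p (\<lambda>x. v (n j) x - G x))
          \<longlonglongrightarrow> ennreal a * P + ennreal (B * a powr (1 - p)) * 0"
        by (intro tendsto_add tendsto_const ennreal_tendsto_cmult Gv) auto
      ultimately have "ennreal c \<le> ennreal a * P + ennreal (B * a powr (1 - p)) * 0"
        by (rule LIMSEQ_le) (use bound[OF a] in blast)
      then show ?thesis by simp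
    qed
    note cP = this
    obtain P' where P': "P = ennreal P'" "0 \<le> P'" using P by (cases P) auto
    have "c \<le> 0"
    proof (rule field_le_epsilon)
      fix e :: real assume e: "0 < e"
      have "ennreal c \<le> ennreal (e / (P' + 1)) * P" using e P'(2) by (intro cP) simp
      also have "\<dots> = ennreal (e / (P' + 1) * P')" using e P' by (simp add: ennreal_mult[symmetric])
      finally have "c \<le> e / (P' + 1) * P'" using e P'(2) by (simp add: ennreal_le_iff)
      also have "\<dots> \<le> e" using e P'(2) by (simp add: field_simps)
      finally show "c \<le> 0 + e" by simp
    qed
    then show ?thesis by (simp add: c_def)
  qed
  note IBP = this
  have "weak_gradient h G"
    unfolding weak_gradient_def
  proof (intro conjI allI impI)
    show "locally_integrable h"
      unfolding locally_integrable_def set_integrable_def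
    proof (intro allI impI)
      fix K :: "(real ^ 'n) set" assume "compact K"
      then have [measurable]: "K \<in> sets borel" by (simp add: borel_compact)
      then have i: "integrable lborel (\<lambda>x. indicat_real K x *\<^sub>R h x)" using h by (intro integrable_mult_indicator) auto
      then show "integrable lebesgue (\<lambda>x. indicat_real K x *\<^sub>R h x)"
        using integrable_completion[OF borel_measurable_integrable[OF i]] by simp
    qed
    show "locally_integrable G"
      unfolding locally_integrable_def set_integrable_def
      using locint integrable_completion[OF borel_measurable_integrable[OF locint]] by blast
    fix \<phi> :: "real ^ 'n \<Rightarrow> real" and i assume \<phi>: "test_function \<phi>"
    note [measurable] = cc_measurable[OF test_function_cc[OF \<phi>]]
      cc_measurable[OF partial_deriv_cc[OF \<phi>]]
    have "(\<lambda>x. h x * partial_deriv i \<phi> x) \<in> borel_measurable lborel" "(\<lambda>x. G x $ i * \<phi> x) \<in> borel_measurable lborel"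
      by measurable
    then show "(LINT x|lebesgue. h x * partial_deriv i \<phi> x) = - (LINT x|lebesgue. G x $ i * \<phi> x)"
      using IBP[OF \<phi>, of i] by (simp add: integral_completion)
  qed
  then show ?thesis using Gs by (auto simp: nn_integral_completion)
qed

end

section \<open>From mollified bounds to the seminorms\<close>

text \<open>The bound is replaced by the supremum \<open>s\<close> of the energies over all
  mollifiers, which makes the averages nearly extremal and so yields the Cauchy property.\<close>

lemma weak_gradient_exists:
  fixes h :: "real ^ 'n::finite \<Rightarrow> real"
  assumes h: "integrable lborel h" and p: "1 < p" and A: "A < \<infinity>"
    and bound: "\<And>d \<rho>. mollifier d \<rho> \<Longrightarrow> Lp_energy p (cgrad h \<rho>) \<le> A"
  shows "\<exists>G. weak_gradient h G \<and> (\<integral>\<^sup>+ x. ennreal (norm (G x) powr p) \<partial>lebesgue) \<le> A"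
proof -
  define E where "E \<rho> = Lp_energy p (cgrad h \<rho>)" for \<rho>
  define S where "S = (SUP \<rho>\<in>{\<rho>. \<exists>d. mollifier d \<rho>}. E \<rho>)"
  have SA: "S \<le> A" unfolding S_def using bound by (intro SUP_least) (auto simp: E_def)
  then have "S < \<infinity>" using A by (rule le_less_trans)
  then obtain s where sS: "S = ennreal s" "0 \<le> s" by (cases S) auto
  define \<epsilon> where "\<epsilon> m = 1 / real (Suc m)" for m
  have \<epsilon>0: "\<epsilon> \<longlonglongrightarrow> 0" unfolding \<epsilon>_def by (rule LIMSEQ_Suc[OF lim_1_over_n])
  have "\<exists>\<eta> :: real ^ 'n \<Rightarrow> real. mollifier (\<epsilon> m) \<eta>" for m by (rule mollifier_exists) (simp add: \<epsilon>_def)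
  then obtain \<eta> :: "nat \<Rightarrow> real ^ 'n \<Rightarrow> real" where \<eta>: "\<And>m. mollifier (\<epsilon> m) (\<eta> m)" by metis
  interpret mollified_gradients h p s \<epsilon> \<eta>
  proof
    show "Lp_energy p (cgrad h \<rho>) \<le> ennreal s" if "mollifier d \<rho>" for d \<rho>
      unfolding sS(1)[symmetric] S_def E_def[symmetric] using that by (intro SUP_upper) auto
    show "\<exists>d \<rho>. mollifier d \<rho> \<and> ennreal (s - e) \<le> Lp_energy p (cgrad h \<rho>)" if e: "0 < e" for e
    proof (cases "s = 0")
      case False
      then have "ennreal (s - e) < S" using e sS by (simp add: sS(1) ennreal_lessI)
      then show ?thesis unfolding S_def less_SUP_iff E_def by (auto intro: less_imp_le)
    next
      case True
      then have "ennreal (s - e) = 0" using e by (simp add: ennreal_neg)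
      then show ?thesis using \<eta>[of 0] by auto
    qed
  qed (use h p sS \<eta> \<epsilon>0 in auto)
  have "ennreal s \<le> A" using SA sS(1) by simp
  then show ?thesis using weak_gradient_limit by (meson order_trans)
qed

text \<open>Needed because the symmetrization as defined agrees with \<open>css_op\<close> only
  almost everywhere; its measurability comes from completeness of Lebesgue measure.\<close>

lemma weak_gradient_AE_cong:
  fixes f' f :: "real ^ 'n::finite \<Rightarrow> real"
  assumes ae: "AE x in lborel. f x = f' x" and f [measurable]: "f \<in> borel_measurable borel"
    and G: "weak_gradient f G"
  shows "weak_gradient f' G"
proof -
  have ae': "AE x in lebesgue. f x = f' x" using ae by (simp add: AE_lebesgue_iff)
  have fl: "f \<in> borel_measurable lebesgue" by (rule measurable_completion) simp
  have f'l: "f' \<in> borel_measurable lebesgue"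
  proof (rule measurableI)
    fix A :: "real set" assume A: "A \<in> sets borel"
    have "f -` A \<inter> space lebesgue \<in> sets lebesgue" using fl A by (rule measurable_sets)
    moreover have "AE x in lebesgue. x \<in> f -` A \<inter> space lebesgue \<longleftrightarrow> x \<in> f' -` A \<inter> space lebesgue"
      using ae' by eventually_elim simp
    ultimately show "f' -` A \<inter> space lebesgue \<in> sets lebesgue" using completion.in_sets_AE by blast
  qed simp
  show ?thesis
    unfolding weak_gradient_def
  proof (intro conjI allI impI)
    show "locally_integrable f'"
      unfolding locally_integrable_def set_integrable_def
    proof (intro allI impI)
      fix K :: "(real ^ 'n) set" assume K: "compact K"
      then have Ks: "K \<in> sets lebesgue" by (simp add: lmeasurable_compact fmeasurableD)
      have "integrable lebesgue (\<lambda>x. indicat_real K x *\<^sub>R f x)"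
        using G K by (simp add: weak_gradient_def locally_integrable_def set_integrable_def)
      then show "integrable lebesgue (\<lambda>x. indicat_real K x *\<^sub>R f' x)"
      proof (rule Bochner_Integration.integrable_cong_AE_imp)
        show "(\<lambda>x. indicat_real K x *\<^sub>R f' x) \<in> borel_measurable lebesgue"
          using f'l Ks by (intro borel_measurable_scaleR borel_measurable_indicator)
        show "AE x in lebesgue. indicat_real K x *\<^sub>R f x = indicat_real K x *\<^sub>R f' x"
          using ae' by eventually_elim simp
      qed
    qed
    show "locally_integrable G" using G by (simp add: weak_gradient_def)
    fix \<phi> :: "real ^ 'n \<Rightarrow> real" and i assume \<phi>: "test_function \<phi>"
    have "partial_deriv i \<phi> \<in> borel_measurable lborel"
      using cc_measurable[OF partial_deriv_cc[OF \<phi>]] by simp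
    then have "partial_deriv i \<phi> \<in> borel_measurable lebesgue" by (rule measurable_completion)
    then have "(LINT x|lebesgue. f x * partial_deriv i \<phi> x) = (LINT x|lebesgue. f' x * partial_deriv i \<phi> x)"
      using fl f'l ae' by (intro integral_cong_AE) (auto intro: borel_measurable_times elim: eventually_mono)
    then show "(LINT x|lebesgue. f' x * partial_deriv i \<phi> x) = - (LINT x|lebesgue. G x $ i * \<phi> x)"
      using G \<phi> by (simp add: weak_gradient_def)
  qed
qed

lemma rearrangement_css_op:
  fixes T :: "real ^ 'n::finite \<Rightarrow> real ^ 'n"
  assumes T: "rigid_motion T" and \<tau>: "0 \<le> \<tau>"
  shows "rearrangement (css_op k T \<tau>)"
proof
  fix u v :: "real ^ 'n \<Rightarrow> real" and r B :: real and x y :: "real ^ 'n"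
  assume "\<And>x y. dist x y < r \<Longrightarrow> u y \<le> v x" "\<And>x. v x \<le> B" "dist x y < r"
  then show "css_op k T \<tau> u y \<le> css_op k T \<tau> v x"
    by (intro css_op_near_bounded[OF T \<tau>, of r u v x y B])
qed (use css_op_measurable[OF T \<tau>] nn_integral_css_op_le[OF T \<tau>] css_op_contraction[OF T \<tau>] in auto)

text \<open>Each weak gradient of \<open>f\<close> with finite energy produces one of
  \<open>W f\<close>, and thus of \<open>f'\<close>, with no larger energy; the infimum over all of
  them is taken at the end.\<close>

lemma (in rearrangement) W1p_seminorm_power_AE_le:
  assumes f: "nice f" and ae: "AE x in lborel. W f x = f' x" and p: "1 < p"
  shows "W1p_seminorm_power p f' \<le> W1p_seminorm_power p f"
  unfolding W1p_seminorm_power_def[of p f]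
proof (rule INF_greatest)
  fix g assume "g \<in> {g. weak_gradient f g}"
  then have g: "weak_gradient f g" by simp
  define A where "A = (\<integral>\<^sup>+ x. ennreal (norm (g x) powr p) \<partial>lebesgue)"
  have "W1p_seminorm_power p f' \<le> A"
  proof (cases "A = \<infinity>")
    case False
    then have "A < \<infinity>" by (simp add: less_top)
    then obtain G where G: "weak_gradient (W f) G" "(\<integral>\<^sup>+ x. ennreal (norm (G x) powr p) \<partial>lebesgue) \<le> A"
      using weak_gradient_exists[OF W_integrable[OF f] p] mollified_gradient_bound[OF f g _ p]
      unfolding A_def by blast
    have "weak_gradient f' G" using weak_gradient_AE_cong[OF ae W_measurable[OF f] G(1)] .
    then show ?thesis
      unfolding W1p_seminorm_power_def using G(2) by (intro INF_lower2) auto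
  qed simp
  then show "W1p_seminorm_power p f' \<le> (\<integral>\<^sup>+ x. ennreal (norm (g x) powr p) \<partial>lebesgue)" by (simp add: A_def)
qed

theorem corollary1p3:
  fixes f :: "real ^ 'n::finite \<Rightarrow> real" and k :: 'n
  assumes "\<And>x. 0 \<le> f x"
    and "integrable lebesgue f"
    and "continuous_on UNIV f"
    and "\<not> (\<exists>x0. radially_decreasing_about x0 f)"
  shows "\<exists>\<tau>0>0. \<exists>H. hyperplane H \<and>
    (\<forall>p. 1 < p \<longrightarrow> (\<forall>\<tau>. 0 \<le> \<tau> \<and> \<tau> \<le> \<tau>0 \<longrightarrow>
       W1p_seminorm_power p (css k H \<tau> f) \<le> W1p_seminorm_power p f)) \<and>
    (\<forall>\<tau>. 0 \<le> \<tau> \<and> \<tau> \<le> \<tau>0 \<longrightarrow> Lip_seminorm (css k H \<tau> f) \<le> Lip_seminorm f)"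
proof -
  define H :: "(real ^ 'n) set" where "H = {x. x $ k = 0}"
  have "axis k 1 \<noteq> (0 :: real ^ 'n)" by simp
  moreover have "H = {x. axis k 1 \<bullet> x = 0}" by (simp add: H_def inner_axis')
  ultimately have H: "hyperplane H" unfolding hyperplane_def by blast
  \<comment> \<open>The same choice as in \<open>css\<close>; being a rigid motion is all that the
    estimates use about it.\<close>
  define T where "T = (SOME T. rigid_motion T \<and> T ` H = {x. x $ k = 0})"
  have T: "rigid_motion T"
    using someI_ex[OF rigid_motion_to_coordinate_hyperplane[OF H, of k]] by (simp add: T_def)
  have css: "css k H \<tau> f = (\<lambda>x. css_coord k \<tau> (f \<circ> inv T) (T x))" for \<tau>
    by (simp add: css_def T_def[symmetric] o_def)
  have "f \<in> borel_measurable lborel" using borel_measurable_continuous_onI[OF assms(3)] by simp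
  then have f: "nice f" using assms integrable_completion[of f lborel] by (simp add: nice_def)
  have "W1p_seminorm_power p (css k H \<tau> f) \<le> W1p_seminorm_power p f" if "1 < p" "0 \<le> \<tau>" for p \<tau>
  proof -
    interpret rearrangement "css_op k T \<tau>" by (rule rearrangement_css_op[OF T that(2)])
    have "AE x in lborel. css_op k T \<tau> f x = css k H \<tau> f x"
      unfolding css using AE_css_coord_eq[OF T that(2) f, of k] by eventually_elim simp
    then show ?thesis by (rule W1p_seminorm_power_AE_le[OF f _ that(1)])
  qed
  moreover have "Lip_seminorm (css k H \<tau> f) \<le> Lip_seminorm f" if "0 \<le> \<tau>" for \<tau>
    unfolding css by (rule Lip_seminorm_css_op[OF T that f])
  \<comment> \<open>The inequalities were shown for every nonnegative \<tau>, so any positive bound,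
    such as 1, serves as witness.\<close>
  ultimately show ?thesis using H by (intro exI[of _ "1 :: real"] conjI exI[of _ H]) auto
qed

end
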